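(* Let $1\le m\le n$ and let $x:\Sigma^m\to\mathbb{S}^n(1)$ be an isometric and minimal immersion of a closed $m$-dimensional Riemannian manifold $\Sigma$ into the sphere $\mathbb{S}^n(1)$. Then for any point $p\in\mathbb{S}^n(1)$, any $\epsilon\in(0,\pi/2)$ and any $\delta\in[0,\tfrac12)$, $$1\ \ge\ \frac{\mathrm{vol}\left(x^{-1}(\Omega(p,\epsilon))\right)}{\mathrm{vol}(\Sigma)}\ \ge\ 1-\sqrt{\frac{1}{1-2\delta}}\;e^{-\delta\,\bar\epsilon^{2}(m+1)},\qquad \bar\epsilon=\sin\epsilon\in(0,1).$$ Hence, for each $\epsilon\in(0,\pi/2)$, $$\lim_{m\to\infty}\frac{\mathrm{vol}\left(x^{-1}(\Omega(p,\epsilon))\right)}{\mathrm{vol}(\Sigma)}=1,$$ that is, for every family of isometric minimal immersions $x_m:\Sigma_m^m\to\mathbb{S}^{n(m)}(1)$ of closed $m$-dimensional manifolds ($n(m)\ge m$) and points $p_m\in\mathbb{S}^{n(m)}(1)$, $m=1,2,\dots$, the ratio $\mathrm{vol}(x_m^{-1}(\Omega(p_m,\epsilon)))/\mathrm{vol}(\Sigma_m)$ tends to $1$ as $m\to\infty$.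
   Context: $\mathbb{S}^n(1)\subset\mathbb{R}^{n+1}$ is the unit sphere with its round metric of constant sectional curvature $1$. Closed means compact without boundary (and non-empty). $\mathrm{vol}$ is Riemannian volume of the appropriate dimension. An isometric immersion is minimal if its mean curvature vector vanishes identically. For $p\in\mathbb{S}^n(1)$ the intrinsic distance is $\mathrm{dist}^{\mathbb{S}^n(1)}(p,y)=\arccos(p\cdot y)$, and the strip of half-width $\epsilon$ around the equator with respect to $p$ is $$\Omega(p,\epsilon)=\{y\in\mathbb{S}^n(1): \tfrac{\pi}{2}-\epsilon<\mathrm{dist}^{\mathbb{S}^n(1)}(p,y)<\tfrac{\pi}{2}+\epsilon\}=\{y\in\mathbb{S}^n(1): -\sin\epsilon<p\cdot y<\sin\epsilon\}.$$ *)

theory Defs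
  imports "HOL-Analysis.Analysis" "Jordan_Normal_Form.Determinant"
begin

section \<open>Calculus on open subsets of \<open>m\<close>-dimensional coordinate space\<close>

text \<open>
  The dimension has to vary inside a statement, so it is a natural number and not a type.
  Coordinate \<open>m\<close>-space consists of the extensional functions on \<open>{..<m}\<close>; this is also the space
  of the product Lebesgue measure \<open>\<Pi>\<^sub>M i\<in>{..<m}. lborel\<close>, and it is closed under the
  updates \<open>p(i := t)\<close> with \<open>i < m\<close> through which partial derivatives are defined.
\<close>

abbreviation coord_space :: "nat \<Rightarrow> (nat \<Rightarrow> real) topology" where
  "coord_space m \<equiv> product_topology (\<lambda>_. euclideanreal) {..<m}"

definition lborel_coord :: "nat \<Rightarrow> (nat \<Rightarrow> real) measure" where
  "lborel_coord m = (\<Pi>\<^sub>M i\<in>{..<m}. lborel)"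

definition partial_deriv :: "nat \<Rightarrow> ((nat \<Rightarrow> real) \<Rightarrow> real) \<Rightarrow> (nat \<Rightarrow> real) \<Rightarrow> real" where
  "partial_deriv i h p = deriv (\<lambda>t. h (p(i := t))) (p i)"

fun Ck_on :: "nat \<Rightarrow> nat \<Rightarrow> (nat \<Rightarrow> real) set \<Rightarrow> ((nat \<Rightarrow> real) \<Rightarrow> real) \<Rightarrow> bool" where
  "Ck_on m 0 V h \<longleftrightarrow> continuous_map (subtopology (coord_space m) V) euclideanreal h"
| "Ck_on m (Suc k) V h \<longleftrightarrow>
     continuous_map (subtopology (coord_space m) V) euclideanreal h \<and>
     (\<forall>i<m. (\<forall>p\<in>V. (\<lambda>t. h (p(i := t))) differentiable at (p i)) \<and>
            Ck_on m k V (partial_deriv i h))"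

definition smooth_on_coord ::
  "nat \<Rightarrow> (nat \<Rightarrow> real) set \<Rightarrow> ((nat \<Rightarrow> real) \<Rightarrow> real) \<Rightarrow> bool" where
  "smooth_on_coord m V h \<longleftrightarrow> (\<forall>k. Ck_on m k V h)"

section \<open>Smooth manifolds and Riemannian metrics\<close>

text \<open>A chart is a pair of its domain and its coordinate map.\<close>

type_synonym 'a chart = "'a set \<times> ('a \<Rightarrow> nat \<Rightarrow> real)"

abbreviation chart_dom :: "'a chart \<Rightarrow> 'a set" where "chart_dom c \<equiv> fst c"
abbreviation chart_map :: "'a chart \<Rightarrow> 'a \<Rightarrow> nat \<Rightarrow> real" where "chart_map c \<equiv> snd c"
abbreviation chart_inv :: "'a chart \<Rightarrow> (nat \<Rightarrow> real) \<Rightarrow> 'a" where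
  "chart_inv c \<equiv> inv_into (chart_dom c) (chart_map c)"
abbreviation chart_img :: "'a chart \<Rightarrow> (nat \<Rightarrow> real) set" where
  "chart_img c \<equiv> chart_map c ` chart_dom c"

text \<open>
  \<open>metric M c q i j\<close> is the component $g_{ij}$ at the point \<open>q\<close> of the metric tensor with
  respect to the chart \<open>c\<close>.
\<close>

record 'a riemannian =
  mtop :: "'a topology"
  atlas :: "'a chart set"
  metric :: "'a chart \<Rightarrow> 'a \<Rightarrow> nat \<Rightarrow> nat \<Rightarrow> real"

definition is_chart :: "nat \<Rightarrow> 'a topology \<Rightarrow> 'a chart \<Rightarrow> bool" where
  "is_chart m T c \<longleftrightarrow>
     openin T (chart_dom c) \<and> openin (coord_space m) (chart_img c) \<and>
     homeomorphic_map (subtopology T (chart_dom c))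
       (subtopology (coord_space m) (chart_img c)) (chart_map c)"

definition is_smooth_atlas :: "nat \<Rightarrow> 'a topology \<Rightarrow> 'a chart set \<Rightarrow> bool" where
  "is_smooth_atlas m T A \<longleftrightarrow>
     (\<forall>c\<in>A. is_chart m T c) \<and> (\<Union>c\<in>A. chart_dom c) = topspace T \<and>
     (\<forall>c\<in>A. \<forall>d\<in>A. \<forall>k<m.
        smooth_on_coord m (chart_map c ` (chart_dom c \<inter> chart_dom d))
          (\<lambda>p. chart_map d (chart_inv c p) k))"

definition smooth_manifold :: "nat \<Rightarrow> 'a riemannian \<Rightarrow> bool" where
  "smooth_manifold m M \<longleftrightarrow>
     Hausdorff_space (mtop M) \<and> second_countable (mtop M) \<and>
     is_smooth_atlas m (mtop M) (atlas M)"

definition smooth_function :: "nat \<Rightarrow> 'a riemannian \<Rightarrow> ('a \<Rightarrow> real) \<Rightarrow> bool" where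
  "smooth_function m M f \<longleftrightarrow>
     (\<forall>c\<in>atlas M. smooth_on_coord m (chart_img c) (\<lambda>p. f (chart_inv c p)))"

definition cderiv :: "'a chart \<Rightarrow> nat \<Rightarrow> ('a \<Rightarrow> real) \<Rightarrow> 'a \<Rightarrow> real" where
  "cderiv c i f q = partial_deriv i (\<lambda>p. f (chart_inv c p)) (chart_map c q)"

definition cderiv2 :: "'a chart \<Rightarrow> nat \<Rightarrow> nat \<Rightarrow> ('a \<Rightarrow> real) \<Rightarrow> 'a \<Rightarrow> real" where
  "cderiv2 c i j f q =
     partial_deriv i (partial_deriv j (\<lambda>p. f (chart_inv c p))) (chart_map c q)"

definition riemannian_metric :: "nat \<Rightarrow> 'a riemannian \<Rightarrow> bool" where
  "riemannian_metric m M \<longleftrightarrow>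
     (\<forall>c\<in>atlas M.
        (\<forall>i<m. \<forall>j<m. smooth_on_coord m (chart_img c) (\<lambda>p. metric M c (chart_inv c p) i j)) \<and>
        (\<forall>q\<in>chart_dom c.
           (\<forall>i<m. \<forall>j<m. metric M c q i j = metric M c q j i) \<and>
           (\<forall>v. (\<exists>i<m. v i \<noteq> 0) \<longrightarrow> (\<Sum>i<m. \<Sum>j<m. metric M c q i j * v i * v j) > 0))) \<and>
     (\<forall>c\<in>atlas M. \<forall>d\<in>atlas M. \<forall>q\<in>chart_dom c \<inter> chart_dom d. \<forall>i<m. \<forall>j<m.
        metric M c q i j =
          (\<Sum>k<m. \<Sum>l<m. metric M d q k l *
             cderiv c i (\<lambda>r. chart_map d r k) q * cderiv c j (\<lambda>r. chart_map d r l) q))"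

text \<open>There is no boundary since charts map onto open subsets of the full coordinate space.\<close>

definition closed_riemannian_manifold :: "nat \<Rightarrow> 'a riemannian \<Rightarrow> bool" where
  "closed_riemannian_manifold m M \<longleftrightarrow>
     smooth_manifold m M \<and> riemannian_metric m M \<and>
     compact_space (mtop M) \<and> topspace (mtop M) \<noteq> {}"

definition metric_mat :: "nat \<Rightarrow> 'a riemannian \<Rightarrow> 'a chart \<Rightarrow> 'a \<Rightarrow> real mat" where
  "metric_mat m M c q = mat m m (\<lambda>(i, j). metric M c q i j)"

text \<open>The components $g^{ij}$ of the inverse matrix, by Cramer's rule.\<close>

definition inverse_metric ::
  "nat \<Rightarrow> 'a riemannian \<Rightarrow> 'a chart \<Rightarrow> 'a \<Rightarrow> nat \<Rightarrow> nat \<Rightarrow> real" where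
  "inverse_metric m M c q i j =
     adj_mat (metric_mat m M c q) $$ (i, j) / Determinant.det (metric_mat m M c q)"

text \<open>
  The Riemannian volume is the unique Borel measure which is $\sqrt{\det g}\,dx$ in every
  chart of the atlas.
\<close>

definition is_riemannian_volume :: "nat \<Rightarrow> 'a riemannian \<Rightarrow> 'a measure \<Rightarrow> bool" where
  "is_riemannian_volume m M \<mu> \<longleftrightarrow>
     space \<mu> = topspace (mtop M) \<and>
     sets \<mu> = sigma_sets (topspace (mtop M)) {U. openin (mtop M) U} \<and>
     (\<forall>c\<in>atlas M. \<forall>A\<in>sets \<mu>. A \<subseteq> chart_dom c \<longrightarrow>
        emeasure \<mu> A =
          (\<integral>\<^sup>+p\<in>chart_map c ` A.
             ennreal (sqrt (Determinant.det (metric_mat m M c (chart_inv c p)))) \<partial>lborel_coord m))"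

definition riemannian_volume :: "nat \<Rightarrow> 'a riemannian \<Rightarrow> 'a measure" where
  "riemannian_volume m M = (THE \<mu>. is_riemannian_volume m M \<mu>)"

section \<open>Minimal isometric immersions into the unit sphere\<close>

text \<open>
  The unit \<open>n\<close>-sphere is \<^term>\<open>topspace (nsphere n)\<close>; the ambient coordinates are indexed by
  \<open>0, \<dots>, n\<close>.
\<close>

definition dotp :: "nat \<Rightarrow> (nat \<Rightarrow> real) \<Rightarrow> (nat \<Rightarrow> real) \<Rightarrow> real" where
  "dotp n u v = (\<Sum>a\<le>n. u a * v a)"

definition sphere_dist :: "nat \<Rightarrow> (nat \<Rightarrow> real) \<Rightarrow> (nat \<Rightarrow> real) \<Rightarrow> real" where
  "sphere_dist n p y = arccos (dotp n p y)"

definition strip :: "nat \<Rightarrow> (nat \<Rightarrow> real) \<Rightarrow> real \<Rightarrow> (nat \<Rightarrow> real) set" where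
  "strip n p \<epsilon> = {y \<in> topspace (nsphere n).
     pi / 2 - \<epsilon> < sphere_dist n p y \<and> sphere_dist n p y < pi / 2 + \<epsilon>}"

definition sphere_map :: "nat \<Rightarrow> nat \<Rightarrow> 'a riemannian \<Rightarrow> ('a \<Rightarrow> nat \<Rightarrow> real) \<Rightarrow> bool" where
  "sphere_map m n M x \<longleftrightarrow>
     (\<forall>q\<in>topspace (mtop M). x q \<in> topspace (nsphere n)) \<and>
     (\<forall>a\<le>n. smooth_function m M (\<lambda>q. x q a))"

text \<open>\<open>frame c x k q\<close> is the $k$-th coordinate tangent vector $\partial_k x$ in the ambient space.\<close>

definition frame :: "'a chart \<Rightarrow> ('a \<Rightarrow> nat \<Rightarrow> real) \<Rightarrow> nat \<Rightarrow> 'a \<Rightarrow> nat \<Rightarrow> real" where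
  "frame c x k q = (\<lambda>a. cderiv c k (\<lambda>r. x r a) q)"

definition immersion :: "nat \<Rightarrow> nat \<Rightarrow> 'a riemannian \<Rightarrow> ('a \<Rightarrow> nat \<Rightarrow> real) \<Rightarrow> bool" where
  "immersion m n M x \<longleftrightarrow> sphere_map m n M x \<and>
     (\<forall>c\<in>atlas M. \<forall>q\<in>chart_dom c. \<forall>v.
        (\<forall>a\<le>n. (\<Sum>k<m. v k * frame c x k q a) = 0) \<longrightarrow> (\<forall>k<m. v k = 0))"

text \<open>The round metric is the restriction of the Euclidean inner product.\<close>

definition isometric_immersion ::
  "nat \<Rightarrow> nat \<Rightarrow> 'a riemannian \<Rightarrow> ('a \<Rightarrow> nat \<Rightarrow> real) \<Rightarrow> bool" where
  "isometric_immersion m n M x \<longleftrightarrow> immersion m n M x \<and>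
     (\<forall>c\<in>atlas M. \<forall>q\<in>chart_dom c. \<forall>i<m. \<forall>j<m.
        dotp n (frame c x i q) (frame c x j q) = metric M c q i j)"

text \<open>
  The Levi-Civita derivative of the sphere is the flat derivative followed by orthogonal
  projection to the tangent space of the sphere, so $\nabla_{\partial_i}\partial_j x$ is the
  projection of the vector of second derivatives of the ambient components.
\<close>

definition sphere_proj :: "nat \<Rightarrow> (nat \<Rightarrow> real) \<Rightarrow> (nat \<Rightarrow> real) \<Rightarrow> nat \<Rightarrow> real" where
  "sphere_proj n y w = (\<lambda>a. w a - dotp n w y * y a)"

definition sphere_cov_deriv ::
  "nat \<Rightarrow> 'a chart \<Rightarrow> ('a \<Rightarrow> nat \<Rightarrow> real) \<Rightarrow> nat \<Rightarrow> nat \<Rightarrow> 'a \<Rightarrow> nat \<Rightarrow> real" where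
  "sphere_cov_deriv n c x i j q = sphere_proj n (x q) (\<lambda>a. cderiv2 c i j (\<lambda>r. x r a) q)"

text \<open>Orthogonal projection onto the image of the differential of an isometric immersion.\<close>

definition tangential_part ::
  "nat \<Rightarrow> nat \<Rightarrow> 'a riemannian \<Rightarrow> ('a \<Rightarrow> nat \<Rightarrow> real) \<Rightarrow> 'a chart \<Rightarrow> 'a \<Rightarrow>
   (nat \<Rightarrow> real) \<Rightarrow> nat \<Rightarrow> real" where
  "tangential_part m n M x c q w =
     (\<lambda>a. \<Sum>k<m. \<Sum>l<m. inverse_metric m M c q k l * dotp n w (frame c x k q) * frame c x l q a)"

definition second_fundamental_form ::
  "nat \<Rightarrow> nat \<Rightarrow> 'a riemannian \<Rightarrow> ('a \<Rightarrow> nat \<Rightarrow> real) \<Rightarrow> 'a chart \<Rightarrow> 'a \<Rightarrow>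
   nat \<Rightarrow> nat \<Rightarrow> nat \<Rightarrow> real" where
  "second_fundamental_form m n M x c q i j =
     (\<lambda>a. sphere_cov_deriv n c x i j q a -
          tangential_part m n M x c q (sphere_cov_deriv n c x i j q) a)"

definition mean_curvature ::
  "nat \<Rightarrow> nat \<Rightarrow> 'a riemannian \<Rightarrow> ('a \<Rightarrow> nat \<Rightarrow> real) \<Rightarrow> 'a chart \<Rightarrow> 'a \<Rightarrow> nat \<Rightarrow> real" where
  "mean_curvature m n M x c q =
     (\<lambda>a. (\<Sum>i<m. \<Sum>j<m. inverse_metric m M c q i j *
             second_fundamental_form m n M x c q i j a) / real m)"

definition isometric_minimal_immersion ::
  "nat \<Rightarrow> nat \<Rightarrow> 'a riemannian \<Rightarrow> ('a \<Rightarrow> nat \<Rightarrow> real) \<Rightarrow> bool" where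
  "isometric_minimal_immersion m n M x \<longleftrightarrow> isometric_immersion m n M x \<and>
     (\<forall>c\<in>atlas M. \<forall>q\<in>chart_dom c. \<forall>a\<le>n. mean_curvature m n M x c q a = 0)"

definition vol_ratio ::
  "nat \<Rightarrow> 'a riemannian \<Rightarrow> ('a \<Rightarrow> nat \<Rightarrow> real) \<Rightarrow> (nat \<Rightarrow> real) set \<Rightarrow> real" where
  "vol_ratio m M x S =
     measure (riemannian_volume m M) (x -` S \<inter> topspace (mtop M)) /
     measure (riemannian_volume m M) (topspace (mtop M))"

end

theory Submission
  imports Defs
begin

text \<open>
  For a unit vector \<open>v\<close> the function \<open>f = v \<cdot> x\<close> satisfies $\Delta f = -m f$ (Takahashi) and
  $|\nabla f|^2 \le 1 - f^2$, because $\nabla f$ and \<open>f x\<close> are orthogonal projections of \<open>v\<close>. Testing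
  the equation with $f^{2k+1}$ gives $(m+2k+1)\int f^{2k+2} \le (2k+1)\int f^{2k}$, hence
  $(m+1)^k\int f^{2k} \le 1\cdot 3\cdots(2k-1)\,\mathrm{vol}(\Sigma)$. Summing Markov's inequality for
  these moments against the exponential series produces the binomial series of $(1-2\delta)^{-1/2}$.

  The volume measure exists since the chart densities agree on overlaps. This is the change of variables
  formula; it is proved by bisection: a box on which the volume of the image and the integral of
  the Jacobian differed by a factor would contain arbitrarily small boxes with the same defect, which
  contradicts the linear approximation at their limit point.
\<close>

section \<open>Differential calculus on coordinate space\<close>

text \<open>\<open>riemannian_volume\<close> is a definite description, so nothing can be said about
  \<open>vol_ratio\<close> before a volume is known to exist and to be unique; this is why measure
  theory on charts precedes the geometry. The Laplacian is used only in weak form, against powers of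
  f cut off by bump functions, so test functions need just one continuous derivative. The constants
  are Gaussian. The moment bound says that the even moments of f, normalised by the total volume,
  are at most those of a centred normal variable Z of variance 1/(m+1), and the expectation of
  exp(\<delta>(m+1)Z^2) is (1-2\<delta>)^(-1/2), finite exactly for \<delta> < 1/2. Thus
  \<delta>(m+1) is the parameter of an exponential Markov bound and the square root is the Gaussian
  integral. All terms are nonnegative, so partial sums of the exponential series suffice and no sum
  has to be exchanged with an integral.\<close>

abbreviation cs :: "nat \<Rightarrow> (nat \<Rightarrow> real) set" where
  "cs m \<equiv> Pi\<^sub>E {..<m} (\<lambda>_. UNIV)"

abbreviation cont_on_coord :: "nat \<Rightarrow> (nat \<Rightarrow> real) set \<Rightarrow> ((nat \<Rightarrow> real) \<Rightarrow> real) \<Rightarrow> bool" where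
  "cont_on_coord m V h \<equiv> continuous_map (subtopology (coord_space m) V) euclideanreal h"

section \<open>Topology of coordinate space through cubes\<close>

definition near :: "nat \<Rightarrow> real \<Rightarrow> (nat \<Rightarrow> real) \<Rightarrow> (nat \<Rightarrow> real) \<Rightarrow> bool" where
  "near m d p q \<longleftrightarrow> (\<forall>i<m. \<bar>q i - p i\<bar> < d)"

lemma near_mono: "near m d p q \<Longrightarrow> d \<le> d' \<Longrightarrow> near m d' p q"
  unfolding near_def by fastforce

lemma topspace_coord: "topspace (coord_space m) = cs m"
  by simp

lemma upd_cs: "p \<in> cs m \<Longrightarrow> i < m \<Longrightarrow> p(i := t) \<in> cs m"
  by (auto simp: PiE_iff extensional_def)

text \<open>With finitely many factors, a basic open product set around p contains a cube around p.
  This turns the product topology into epsilon-delta statements, the form in which continuity is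
  used from here on.\<close>

lemma openin_coord:
  "openin (coord_space m) V \<longleftrightarrow>
     V \<subseteq> cs m \<and> (\<forall>p\<in>V. \<exists>d>0. \<forall>q\<in>cs m. near m d p q \<longrightarrow> q \<in> V)"
proof
  assume L: "openin (coord_space m) V"
  then have "V \<subseteq> cs m"
    using openin_subset by fastforce
  moreover have "\<exists>d>0. \<forall>q\<in>cs m. near m d p q \<longrightarrow> q \<in> V" if p: "p \<in> V" for p
  proof -
    obtain U where U: "\<forall>i\<in>{..<m}. open (U i)" "p \<in> Pi\<^sub>E {..<m} U" "Pi\<^sub>E {..<m} U \<subseteq> V"
      using L p unfolding openin_product_topology_alt by auto
    \<comment> \<open>There is one radius per coordinate. Phrased as eventual properties at 0 from
      the right, they are combined by \<open>eventually_ball_finite\<close>, also for m = 0, where a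
      minimum of radii would range over the empty set.\<close>
    have "\<forall>\<^sub>F d in at_right (0::real). \<forall>t. \<bar>t - p i\<bar> < d \<longrightarrow> t \<in> U i" if "i \<in> {..<m}" for i
    proof -
      have "open (U i)" "p i \<in> U i"
        using U that by auto
      then obtain e where e: "e > 0" "ball (p i) e \<subseteq> U i"
        using open_contains_ball by blast
      show ?thesis
        unfolding eventually_at_right_field
      proof (intro exI[of _ e] conjI allI impI)
        fix d t assume "0 < d" "d < e" "\<bar>t - p i\<bar> < d"
        then have "t \<in> ball (p i) e"
          by (auto simp: dist_real_def)
        then show "t \<in> U i" using e by auto
      qed (use e in auto)
    qed
    then have "\<forall>\<^sub>F d in at_right (0::real). \<forall>i\<in>{..<m}. \<forall>t. \<bar>t - p i\<bar> < d \<longrightarrow> t \<in> U i"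
      by (intro eventually_ball_finite) auto
    then obtain e where e: "e > 0" "\<And>d i t. 0 < d \<Longrightarrow> d < e \<Longrightarrow> i < m \<Longrightarrow> \<bar>t - p i\<bar> < d \<Longrightarrow> t \<in> U i"
      unfolding eventually_at_right_field by force
    show ?thesis
    proof (intro exI[of _ "e/2"] conjI ballI impI)
      fix q assume q: "q \<in> cs m" "near m (e/2) p q"
      then have "q \<in> Pi\<^sub>E {..<m} U"
        using e(1) e(2)[of "e/2"] by (auto simp: near_def PiE_iff)
      then show "q \<in> V" using U by auto
    qed (use e in auto)
  qed
  ultimately show "V \<subseteq> cs m \<and> (\<forall>p\<in>V. \<exists>d>0. \<forall>q\<in>cs m. near m d p q \<longrightarrow> q \<in> V)"
    by blast
next
  assume R: "V \<subseteq> cs m \<and> (\<forall>p\<in>V. \<exists>d>0. \<forall>q\<in>cs m. near m d p q \<longrightarrow> q \<in> V)"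
  show "openin (coord_space m) V"
    unfolding openin_product_topology_alt
  proof
    fix p assume p: "p \<in> V"
    with R obtain d where d: "d > 0" "\<forall>q\<in>cs m. near m d p q \<longrightarrow> q \<in> V" by blast
    have "p \<in> cs m" using R p by auto
    show "\<exists>U. finite {i \<in> {..<m}. U i \<noteq> topspace euclideanreal} \<and>
           (\<forall>i\<in>{..<m}. openin euclideanreal (U i)) \<and> p \<in> Pi\<^sub>E {..<m} U \<and> Pi\<^sub>E {..<m} U \<subseteq> V"
    proof (intro exI[of _ "\<lambda>i. ball (p i) d"] conjI)
      show "p \<in> (\<Pi>\<^sub>E i\<in>{..<m}. ball (p i) d)"
        using \<open>p \<in> cs m\<close> d by (auto simp: PiE_iff)
      show "(\<Pi>\<^sub>E i\<in>{..<m}. ball (p i) d) \<subseteq> V"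
      proof
        fix q assume q: "q \<in> (\<Pi>\<^sub>E i\<in>{..<m}. ball (p i) d)"
        then have "q \<in> cs m" by (auto simp: PiE_iff)
        moreover have "near m d p q"
          using q by (auto simp: near_def PiE_iff dist_real_def abs_minus_commute)
        ultimately show "q \<in> V" using d by auto
      qed
    qed auto
  qed
qed

lemma openin_cs: "openin (coord_space m) (cs m)"
  unfolding openin_coord by (auto intro: exI[of _ 1])

lemma line_nearby:
  assumes "openin (coord_space m) V" "p \<in> V" "i < m"
  shows "\<forall>\<^sub>F t in nhds (p i). p(i := t) \<in> V"
proof -
  obtain d where d: "d > 0" "\<forall>q\<in>cs m. near m d p q \<longrightarrow> q \<in> V" and "p \<in> cs m"
    using assms unfolding openin_coord by blast
  show ?thesis
    unfolding eventually_nhds_metric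
    using d \<open>p \<in> cs m\<close> assms(3)
    by (intro exI[of _ d]) (auto simp: dist_real_def near_def intro!: upd_cs bspec[OF d(2), THEN mp])
qed

text \<open>Membership of q in V is part of the conclusion because V is open, so a single radius
  serves both purposes.\<close>

lemma cont_on_coord_iff:
  assumes V: "openin (coord_space m) V"
  shows "cont_on_coord m V h \<longleftrightarrow>
    (\<forall>p\<in>V. \<forall>e>0. \<exists>d>0. \<forall>q\<in>cs m. near m d p q \<longrightarrow> q \<in> V \<and> \<bar>h q - h p\<bar> < e)"
proof
  have Vcs: "V \<subseteq> cs m" using V openin_coord by blast
  assume L: "cont_on_coord m V h"
  show "\<forall>p\<in>V. \<forall>e>0. \<exists>d>0. \<forall>q\<in>cs m. near m d p q \<longrightarrow> q \<in> V \<and> \<bar>h q - h p\<bar> < e"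
  proof (intro ballI allI impI)
    fix p and e :: real assume p: "p \<in> V" and e: "e > 0"
    have "openin (subtopology (coord_space m) V) {q \<in> topspace (subtopology (coord_space m) V). h q \<in> ball (h p) e}"
      by (rule openin_continuous_map_preimage[OF L]) auto
    moreover have "{q \<in> topspace (subtopology (coord_space m) V). h q \<in> ball (h p) e} = {q\<in>V. h q \<in> ball (h p) e}"
      using Vcs by auto
    ultimately have "openin (coord_space m) {q\<in>V. h q \<in> ball (h p) e}"
      using openin_open_subtopology[OF V] by simp
    moreover have "p \<in> {q\<in>V. h q \<in> ball (h p) e}" using p e by simp
    ultimately obtain d where "d > 0" "\<forall>q\<in>cs m. near m d p q \<longrightarrow> q \<in> {q\<in>V. h q \<in> ball (h p) e}"
      unfolding openin_coord by blast
    then show "\<exists>d>0. \<forall>q\<in>cs m. near m d p q \<longrightarrow> q \<in> V \<and> \<bar>h q - h p\<bar> < e"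
      by (intro exI[of _ d]) (auto simp: dist_real_def abs_minus_commute)
  qed
next
  have Vcs: "V \<subseteq> cs m" using V openin_coord by blast
  assume R: "\<forall>p\<in>V. \<forall>e>0. \<exists>d>0. \<forall>q\<in>cs m. near m d p q \<longrightarrow> q \<in> V \<and> \<bar>h q - h p\<bar> < e"
  show "cont_on_coord m V h"
    unfolding continuous_map_def
  proof (intro conjI allI impI)
    fix U assume "openin euclideanreal U"
    then have U: "open U" by simp
    have "openin (coord_space m) {q\<in>V. h q \<in> U}"
      unfolding openin_coord
    proof (intro conjI ballI)
      fix p assume "p \<in> {q \<in> V. h q \<in> U}"
      then have p: "p \<in> V" "h p \<in> U" by auto
      then obtain e where e: "e > 0" "ball (h p) e \<subseteq> U" using U open_contains_ball by blast
      obtain d where d: "d > 0" "\<forall>q\<in>cs m. near m d p q \<longrightarrow> q \<in> V \<and> \<bar>h q - h p\<bar> < e"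
        using R p e by blast
      then show "\<exists>d>0. \<forall>q\<in>cs m. near m d p q \<longrightarrow> q \<in> {q \<in> V. h q \<in> U}"
        using e by (intro exI[of _ d]) (auto simp: subset_iff dist_real_def abs_minus_commute dest!: bspec)
    qed (use Vcs in auto)
    moreover have "{x \<in> topspace (subtopology (coord_space m) V). h x \<in> U} = {q\<in>V. h q \<in> U}"
      using Vcs by auto
    ultimately show "openin (subtopology (coord_space m) V) {x \<in> topspace (subtopology (coord_space m) V). h x \<in> U}"
      using openin_open_subtopology[OF V] by simp
  qed auto
qed

lemma cont_on_coord_cong:
  assumes "cont_on_coord m V h" "\<And>p. p \<in> V \<Longrightarrow> h p = h' p"
  shows "cont_on_coord m V h'"
  using assms by (auto intro: continuous_map_eq)

lemma cont_on_coord_subset: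
  "cont_on_coord m V h \<Longrightarrow> W \<subseteq> V \<Longrightarrow> cont_on_coord m W h"
  by (metis continuous_map_from_subtopology inf.absorb_iff2 subtopology_subtopology)

lemma cont_on_coord_coordinate:
  assumes "i < m"
  shows "cont_on_coord m V (\<lambda>p. p i)"
  by (intro continuous_map_from_subtopology continuous_map_product_coordinates)
     (use assms in auto)

lemma cont_on_coord_real:
  assumes "cont_on_coord m V h" "\<And>p. p \<in> V \<Longrightarrow> isCont \<phi> (h p)"
  shows "cont_on_coord m V (\<lambda>p. \<phi> (h p))"
proof -
  have 1: "continuous_on (h ` (topspace (coord_space m) \<inter> V)) \<phi>"
    using assms(2) by (auto intro!: continuous_at_imp_continuous_on)
  have "continuous_map (subtopology (coord_space m) V) (subtopology euclideanreal (h ` (topspace (coord_space m) \<inter> V))) h"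
    using assms(1) by (auto simp: continuous_map_in_subtopology)
  then have "continuous_map (subtopology (coord_space m) V) euclideanreal (\<phi> \<circ> h)"
    by (rule continuous_map_compose) (use 1 in simp)
  then show ?thesis by (simp add: o_def)
qed

lemma cont_on_coord_local:
  assumes V: "openin (coord_space m) V"
    and loc: "\<And>p. p \<in> V \<Longrightarrow> \<exists>W. openin (coord_space m) W \<and> p \<in> W \<and> W \<subseteq> V \<and> cont_on_coord m W h"
  shows "cont_on_coord m V h"
  unfolding cont_on_coord_iff[OF V]
proof (intro ballI allI impI)
  fix p and e :: real assume p: "p \<in> V" and e: "e > 0"
  then obtain W where W: "openin (coord_space m) W" "p \<in> W" "W \<subseteq> V" "cont_on_coord m W h"
    using loc by blast
  then obtain d where "d>0" "\<forall>q\<in>cs m. near m d p q \<longrightarrow> q \<in> W \<and> \<bar>h q - h p\<bar> < e"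
    using e unfolding cont_on_coord_iff[OF W(1)] by blast
  then show "\<exists>d>0. \<forall>q\<in>cs m. near m d p q \<longrightarrow> q \<in> V \<and> \<bar>h q - h p\<bar> < e"
    using W by (intro exI[of _ d]) auto
qed

section \<open>Partial derivatives and the class C1\<close>

lemma partial_deriv_eqI:
  "DERIV (\<lambda>t. h (p(i := t))) (p i) :> D \<Longrightarrow> partial_deriv i h p = D"
  unfolding partial_deriv_def by (rule DERIV_imp_deriv)

lemma line_deriv_cong:
  assumes "openin (coord_space m) V" "p \<in> V" "i < m" "\<And>q. q \<in> V \<Longrightarrow> h q = h' q"
  shows "DERIV (\<lambda>t. h (p(i := t))) (p i) :> D \<longleftrightarrow> DERIV (\<lambda>t. h' (p(i := t))) (p i) :> D"
proof -
  have "\<forall>\<^sub>F t in nhds (p i). h (p(i := t)) = h' (p(i := t))"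
    using line_nearby[OF assms(1-3)] assms(4) by (auto elim: eventually_mono)
  then show ?thesis by (intro DERIV_cong_ev) auto
qed

lemma partial_deriv_cong:
  assumes "openin (coord_space m) V" "p \<in> V" "i < m" "\<And>q. q \<in> V \<Longrightarrow> h q = h' q"
  shows "partial_deriv i h p = partial_deriv i h' p"
  unfolding partial_deriv_def deriv_def using line_deriv_cong[of m V p i h h'] assms by simp

lemma differentiable_iff_DERIV:
  "(f::real\<Rightarrow>real) differentiable at x \<longleftrightarrow> (\<exists>D. DERIV f x :> D)"
  by (simp add: real_differentiable_def)

text \<open>The derivative is recorded as the value of \<open>partial_deriv\<close> itself, so a
  \<open>C1\<close> fact hands over a usable \<open>DERIV\<close> statement. Smooth data enter the
  analysis only as \<open>C1\<close> facts about functions and about their first partial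
  derivatives.\<close>

definition C1 :: "nat \<Rightarrow> (nat \<Rightarrow> real) set \<Rightarrow> ((nat \<Rightarrow> real) \<Rightarrow> real) \<Rightarrow> bool" where
  "C1 m V h \<longleftrightarrow> cont_on_coord m V h \<and>
     (\<forall>i<m. (\<forall>p\<in>V. DERIV (\<lambda>t. h (p(i := t))) (p i) :> partial_deriv i h p) \<and>
        cont_on_coord m V (partial_deriv i h))"

lemma differentiable_iff_deriv:
  "(f::real\<Rightarrow>real) differentiable at x \<longleftrightarrow> DERIV f x :> deriv f x"
  by (auto simp: differentiable_iff_DERIV DERIV_deriv_iff_has_field_derivative)

lemma C1_iff_Ck: "C1 m V h \<longleftrightarrow> Ck_on m (Suc 0) V h"
  by (auto simp: C1_def partial_deriv_def differentiable_iff_deriv)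

lemma C1D:
  assumes "C1 m V h"
  shows "cont_on_coord m V h"
    and "\<And>i p. i < m \<Longrightarrow> p \<in> V \<Longrightarrow> DERIV (\<lambda>t. h (p(i := t))) (p i) :> partial_deriv i h p"
    and "\<And>i. i < m \<Longrightarrow> cont_on_coord m V (partial_deriv i h)"
  using assms by (auto simp: C1_def)

lemma C1I:
  assumes "cont_on_coord m V h"
    and "\<And>i p. i < m \<Longrightarrow> p \<in> V \<Longrightarrow> DERIV (\<lambda>t. h (p(i := t))) (p i) :> D i p"
    and "\<And>i. i < m \<Longrightarrow> cont_on_coord m V (D i)"
  shows "C1 m V h"
  unfolding C1_def
proof (intro conjI allI impI ballI assms(1))
  fix i assume i: "i < m"
  have eq: "partial_deriv i h p = D i p" if "p \<in> V" for p
    by (rule partial_deriv_eqI[OF assms(2)[OF i that]])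
  then show "cont_on_coord m V (partial_deriv i h)"
    using assms(3)[OF i] by (auto intro: cont_on_coord_cong)
  show "DERIV (\<lambda>t. h (p(i := t))) (p i) :> partial_deriv i h p" if "p \<in> V" for p
    using assms(2)[OF i that] eq[OF that] by simp
qed

lemma C1_subset: "C1 m V h \<Longrightarrow> W \<subseteq> V \<Longrightarrow> C1 m W h"
  unfolding C1_def using cont_on_coord_subset[of m V _ W] by auto

lemma C1_cong:
  assumes V: "openin (coord_space m) V" and "C1 m V h" "\<And>p. p \<in> V \<Longrightarrow> h p = h' p"
  shows "C1 m V h'"
proof (rule C1I[where D = "\<lambda>i. partial_deriv i h"])
  show "cont_on_coord m V h'" using assms C1D(1) cont_on_coord_cong by blast
  show "DERIV (\<lambda>t. h' (p(i := t))) (p i) :> partial_deriv i h p" if "i < m" "p \<in> V" for i p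
    using C1D(2)[OF assms(2) that] line_deriv_cong[of m V p i h h'] V that assms(3) by simp
qed (use assms C1D in auto)

text \<open>Partial derivatives and continuity see only a neighbourhood. The lemma is used for
  gluing: extensions by zero and bump functions are C1 on each member of an open cover.\<close>

lemma C1_local:
  assumes V: "openin (coord_space m) V"
    and loc: "\<And>p. p \<in> V \<Longrightarrow> \<exists>W. openin (coord_space m) W \<and> p \<in> W \<and> W \<subseteq> V \<and> C1 m W h"
  shows "C1 m V h"
  unfolding C1_def
proof (intro conjI allI impI ballI)
  show "cont_on_coord m V h"
  proof (rule cont_on_coord_local[OF V])
    fix p assume "p \<in> V"
    then obtain W where "openin (coord_space m) W" "p \<in> W" "W \<subseteq> V" "C1 m W h" using loc by blast
    then show "\<exists>W. openin (coord_space m) W \<and> p \<in> W \<and> W \<subseteq> V \<and> cont_on_coord m W h"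
      by (intro exI[of _ W]) (simp add: C1D(1))
  qed
  fix i assume i: "i < m"
  show "cont_on_coord m V (partial_deriv i h)"
  proof (rule cont_on_coord_local[OF V])
    fix p assume "p \<in> V"
    then obtain W where "openin (coord_space m) W" "p \<in> W" "W \<subseteq> V" "C1 m W h" using loc by blast
    then show "\<exists>W. openin (coord_space m) W \<and> p \<in> W \<and> W \<subseteq> V \<and> cont_on_coord m W (partial_deriv i h)"
      by (intro exI[of _ W]) (simp add: C1D(3) i)
  qed
  show "DERIV (\<lambda>t. h (p(i := t))) (p i) :> partial_deriv i h p" if "p \<in> V" for p
    using loc[OF that] C1D(2) i by blast
qed

lemma C1_const: "C1 m V (\<lambda>_. c)"
  by (rule C1I[where D = "\<lambda>_ _. 0"]) auto

lemma C1_add: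
  assumes "C1 m V f" "C1 m V g"
  shows "C1 m V (\<lambda>p. f p + g p)"
  by (rule C1I[where D = "\<lambda>i p. partial_deriv i f p + partial_deriv i g p"])
     (auto intro!: DERIV_add continuous_map_add C1D[OF assms(1)] C1D[OF assms(2)])

lemma C1_mult:
  assumes "C1 m V f" "C1 m V g"
  shows "C1 m V (\<lambda>p. f p * g p)"
proof (rule C1I[where D = "\<lambda>i p. partial_deriv i f p * g p + partial_deriv i g p * f p"])
  show "DERIV (\<lambda>t. f (p(i := t)) * g (p(i := t))) (p i) :> partial_deriv i f p * g p + partial_deriv i g p * f p"
    if "i < m" "p \<in> V" for i p
    using DERIV_mult[OF C1D(2)[OF assms(1) that] C1D(2)[OF assms(2) that]] by simp
qed (auto intro!: continuous_map_add continuous_map_real_mult C1D[OF assms(1)] C1D[OF assms(2)])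

lemma C1_sum:
  assumes "\<And>a. a \<in> I \<Longrightarrow> C1 m V (f a)"
  shows "C1 m V (\<lambda>p. \<Sum>a\<in>I. f a p)"
  using assms by (induction I rule: infinite_finite_induct) (auto intro: C1_add C1_const)

lemma C1_prod:
  assumes "\<And>a. a \<in> I \<Longrightarrow> C1 m V (f a)"
  shows "C1 m V (\<lambda>p. \<Prod>a\<in>I. f a p)"
  using assms by (induction I rule: infinite_finite_induct) (auto intro: C1_mult C1_const)

lemma C1_power: "C1 m V f \<Longrightarrow> C1 m V (\<lambda>p. f p ^ k)"
  by (induction k) (auto intro: C1_mult C1_const)

lemma C1_real:
  assumes f: "C1 m V f" and \<phi>: "\<And>p. p \<in> V \<Longrightarrow> DERIV \<phi> (f p) :> \<phi>' (f p)"
    and \<phi>': "\<And>p. p \<in> V \<Longrightarrow> isCont \<phi>' (f p)"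
  shows "C1 m V (\<lambda>p. \<phi> (f p))"
proof (rule C1I[where D = "\<lambda>i p. \<phi>' (f p) * partial_deriv i f p"])
  show "cont_on_coord m V (\<lambda>p. \<phi> (f p))"
    using \<phi> DERIV_isCont by (blast intro: cont_on_coord_real[OF C1D(1)[OF f]])
  show "DERIV (\<lambda>t. \<phi> (f (p(i := t)))) (p i) :> \<phi>' (f p) * partial_deriv i f p"
    if "i < m" "p \<in> V" for i p
    by (rule DERIV_chain2[OF _ C1D(2)[OF f that]]) (use \<phi>[OF that(2)] in simp)
  show "cont_on_coord m V (\<lambda>p. \<phi>' (f p) * partial_deriv i f p)" if "i < m" for i
    by (intro continuous_map_real_mult cont_on_coord_real[OF C1D(1)[OF f]] \<phi>' C1D[OF f] that)
qed

lemma C1_inverse: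
  assumes "C1 m V f" "\<And>p. p \<in> V \<Longrightarrow> f p \<noteq> 0"
  shows "C1 m V (\<lambda>p. inverse (f p))"
  by (rule C1_real[OF assms(1), where \<phi>' = "\<lambda>x. - (inverse x ^ 2)"])
     (use assms in \<open>auto intro!: derivative_eq_intros continuous_intros simp: power2_eq_square\<close>)

lemma C1_sqrt:
  assumes "C1 m V f" "\<And>p. p \<in> V \<Longrightarrow> f p > 0"
  shows "C1 m V (\<lambda>p. sqrt (f p))"
  by (rule C1_real[OF assms(1), where \<phi>' = "\<lambda>x. inverse (sqrt x) / 2"])
     (use assms(2) in \<open>force intro!: DERIV_real_sqrt continuous_intros\<close>)+

lemma C1_coordinate: "j < m \<Longrightarrow> C1 m V (\<lambda>p. p j)"
  by (rule C1I[where D = "\<lambda>i p. if i = j then 1 else 0"]) (auto intro!: cont_on_coord_coordinate)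

lemma smooth_C1: "smooth_on_coord m V h \<Longrightarrow> C1 m V h"
  unfolding smooth_on_coord_def C1_iff_Ck by blast

lemma smooth_partial_deriv:
  "smooth_on_coord m V h \<Longrightarrow> i < m \<Longrightarrow> smooth_on_coord m V (partial_deriv i h)"
  unfolding smooth_on_coord_def using Ck_on.simps(2) by blast

lemma abs_component_le_sum: "a < m \<Longrightarrow> \<bar>q a - p a\<bar> \<le> (\<Sum>i<m. \<bar>q i - p i\<bar>)" for q p :: "nat \<Rightarrow> real"
  by (rule member_le_sum[where f = "\<lambda>i. \<bar>q i - p i\<bar>"]) auto

text \<open>Change the coordinates one at a time.\<close>

lemma C1_linear_approx:
  assumes V: "openin (coord_space m) V" and h: "C1 m V h" and p: "p \<in> V" and e: "e > 0"
  shows "\<exists>d>0. \<forall>q\<in>cs m. near m d p q \<longrightarrow> q \<in> V \<and>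
    \<bar>h q - h p - (\<Sum>i<m. partial_deriv i h p * (q i - p i))\<bar> \<le> e * (\<Sum>i<m. \<bar>q i - p i\<bar>)"
proof -
  have pcs: "p \<in> cs m" using V p openin_coord by blast
  have "\<forall>\<^sub>F d in at_right (0::real). \<forall>q\<in>cs m. near m d p q \<longrightarrow> q \<in> V \<and> \<bar>partial_deriv i h q - partial_deriv i h p\<bar> < e"
    if "i \<in> {..<m}" for i
  proof -
    have "cont_on_coord m V (partial_deriv i h)" using C1D(3)[OF h] that by simp
    then obtain d where "d > 0" "\<forall>q\<in>cs m. near m d p q \<longrightarrow> q \<in> V \<and> \<bar>partial_deriv i h q - partial_deriv i h p\<bar> < e"
      using p e unfolding cont_on_coord_iff[OF V] by blast
    then show ?thesis
      unfolding eventually_at_right_field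
      using near_mono less_imp_le by (intro exI[of _ d]) blast
  qed
  then have "\<forall>\<^sub>F d in at_right (0::real). \<forall>i\<in>{..<m}. \<forall>q\<in>cs m. near m d p q \<longrightarrow> q \<in> V \<and> \<bar>partial_deriv i h q - partial_deriv i h p\<bar> < e"
    by (intro eventually_ball_finite) auto
  then obtain d1 where d1: "d1 > 0" "\<And>d. 0 < d \<Longrightarrow> d < d1 \<Longrightarrow> \<forall>i\<in>{..<m}. \<forall>q\<in>cs m. near m d p q \<longrightarrow> q \<in> V \<and> \<bar>partial_deriv i h q - partial_deriv i h p\<bar> < e"
    unfolding eventually_at_right_field by force
  obtain d2 where d2: "d2 > 0" "\<forall>q\<in>cs m. near m d2 p q \<longrightarrow> q \<in> V"
    using V p unfolding openin_coord by blast
  define d where "d = min (d1/2) d2"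
  have d: "d > 0" using d1 d2 by (simp add: d_def)
  have dV: "q \<in> V" if "q \<in> cs m" "near m d p q" for q
    using d2(2) that near_mono[of m d p q d2] by (simp add: d_def)
  have dp: "\<bar>partial_deriv i h q - partial_deriv i h p\<bar> \<le> e" if "i < m" "q \<in> cs m" "near m d p q" for i q
  proof -
    have "near m (d1/2) p q" using near_mono[OF that(3), of "d1/2"] by (simp add: d_def)
    then show ?thesis using d1(2)[of "d1/2"] d1(1) that(1,2) by (auto intro: less_imp_le)
  qed
  show ?thesis
  proof (intro exI[of _ d] conjI ballI impI d)
    fix q assume q: "q \<in> cs m" "near m d p q"
    then show "q \<in> V" using dV by blast
    define z where "z k = (\<lambda>i. if i < k then q i else p i)" for k
    have z0: "z 0 = p" by (simp add: z_def)
    have zm: "z m = q"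
      using q(1) pcs by (auto simp: z_def fun_eq_iff PiE_iff extensional_def)
    have step: "\<bar>h (z (Suc k)) - h (z k) - partial_deriv k h p * (q k - p k)\<bar> \<le> e * \<bar>q k - p k\<bar>"
      if k: "k < m" for k
    proof -
      define S where "S = closed_segment (p k) (q k)"
      have on: "(z k)(k := t) \<in> cs m \<and> near m d p ((z k)(k := t))" if "t \<in> S" for t
      proof
        have "z k \<in> cs m" using q(1) pcs k by (auto simp: z_def PiE_iff extensional_def)
        then show "(z k)(k := t) \<in> cs m" by (rule upd_cs[OF _ k])
        have "\<bar>t - p k\<bar> \<le> \<bar>q k - p k\<bar>"
          using that by (auto simp: S_def closed_segment_eq_real_ivl split: if_splits)
        also have "\<dots> < d" using q k by (auto simp: near_def)
        finally show "near m d p ((z k)(k := t))"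
          using q d by (auto simp: near_def z_def)
      qed
      \<comment> \<open>The linear term is moved to the left before the mean value bound is applied,
        so that the derivative to be bounded is the oscillation of the k-th partial derivative along
        the segment.\<close>
      have "norm ((h ((z k)(k := q k)) - partial_deriv k h p * q k) - (h ((z k)(k := p k)) - partial_deriv k h p * p k)) \<le> e * norm (q k - p k)"
      proof (rule field_differentiable_bound[of S _ "\<lambda>t. partial_deriv k h ((z k)(k := t)) - partial_deriv k h p"])
        show "convex S" by (simp add: S_def)
        fix t assume t: "t \<in> S"
        have "((z k)(k := t)) \<in> V" using on[OF t] dV by blast
        from C1D(2)[OF h k this]
        have "DERIV (\<lambda>s. h ((z k)(k := s))) t :> partial_deriv k h ((z k)(k := t))" by simp
        then have "DERIV (\<lambda>t. h ((z k)(k := t)) - partial_deriv k h p * t) t :> partial_deriv k h ((z k)(k := t)) - partial_deriv k h p"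
          by (auto intro!: derivative_eq_intros)
        then show "((\<lambda>t. h ((z k)(k := t)) - partial_deriv k h p * t) has_field_derivative partial_deriv k h ((z k)(k := t)) - partial_deriv k h p) (at t within S)"
          using has_field_derivative_at_within by blast
        show "norm (partial_deriv k h ((z k)(k := t)) - partial_deriv k h p) \<le> e"
          using on[OF t] dp[OF k] by auto
      qed (auto simp: S_def)
      moreover have "(z k)(k := q k) = z (Suc k)" "(z k)(k := p k) = z k"
        by (auto simp: z_def fun_eq_iff less_Suc_eq)
      ultimately show ?thesis by (simp add: algebra_simps)
    qed
    have "h q - h p - (\<Sum>i<m. partial_deriv i h p * (q i - p i))
        = (\<Sum>k<m. h (z (Suc k)) - h (z k) - partial_deriv k h p * (q k - p k))"
      using sum_lessThan_telescope[of "\<lambda>k. h (z k)" m] by (simp add: sum_subtractf z0 zm)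
    also have "\<bar>\<dots>\<bar> \<le> (\<Sum>k<m. e * \<bar>q k - p k\<bar>)"
      by (rule order_trans[OF sum_abs sum_mono]) (use step in auto)
    finally show "\<bar>h q - h p - (\<Sum>i<m. partial_deriv i h p * (q i - p i))\<bar> \<le> e * (\<Sum>i<m. \<bar>q i - p i\<bar>)"
      by (simp add: sum_distrib_left)
  qed
qed

text \<open>The remainder of \<open>C1_linear_approx\<close> is at most e times the l1 distance
  travelled, and this distance divided by |t - t0| converges. Hence \<gamma> only has to be
  differentiable at t0 and to stay in coordinate space near t0.\<close>

lemma C1_chain:
  assumes V: "openin (coord_space m) V" and h: "C1 m V h"
    and \<gamma>V: "\<forall>\<^sub>F t in at t0. \<gamma> t \<in> cs m" "\<gamma> t0 \<in> V"
    and \<gamma>: "\<And>i. i < m \<Longrightarrow> DERIV (\<lambda>t. \<gamma> t i) t0 :> \<gamma>' i"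
  shows "DERIV (\<lambda>t. h (\<gamma> t)) t0 :> (\<Sum>i<m. partial_deriv i h (\<gamma> t0) * \<gamma>' i)"
proof -
  define p where "p = \<gamma> t0"
  define N where "N t = (\<Sum>i<m. \<bar>\<gamma> t i - p i\<bar>)" for t
  define R where "R t = h (\<gamma> t) - h p - (\<Sum>i<m. partial_deriv i h p * (\<gamma> t i - p i))" for t
  have quot: "((\<lambda>t. (\<gamma> t i - p i) / (t - t0)) \<longlongrightarrow> \<gamma>' i) (at t0)" if "i < m" for i
    using \<gamma>[OF that] unfolding has_field_derivative_iff p_def by simp
  have cont: "((\<lambda>t. \<gamma> t i) \<longlongrightarrow> p i) (at t0)" if "i < m" for i
    using DERIV_isCont[OF \<gamma>[OF that]] unfolding isCont_def p_def by simp
  have N_quot: "((\<lambda>t. N t / \<bar>t - t0\<bar>) \<longlongrightarrow> (\<Sum>i<m. \<bar>\<gamma>' i\<bar>)) (at t0)"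
  proof -
    have "((\<lambda>t. \<Sum>i<m. \<bar>(\<gamma> t i - p i) / (t - t0)\<bar>) \<longlongrightarrow> (\<Sum>i<m. \<bar>\<gamma>' i\<bar>)) (at t0)"
      by (intro tendsto_sum tendsto_rabs quot) auto
    then show ?thesis by (simp add: N_def sum_divide_distrib abs_divide)
  qed
  have "((\<lambda>t. R t / (t - t0)) \<longlongrightarrow> 0) (at t0)"
  proof (rule tendstoI)
    fix e :: real assume e: "e > 0"
    \<comment> \<open>A strict upper bound for the limit of \<open>N t / \<bar>t - t0\<bar>\<close>,
      positive even if all derivatives of \<gamma> vanish.\<close>
    define B where "B = (\<Sum>i<m. \<bar>\<gamma>' i\<bar>) + 1"
    have B: "B > 0" unfolding B_def by (simp add: add_nonneg_pos sum_nonneg)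
    obtain d where d: "d > 0" "\<forall>q\<in>cs m. near m d p q \<longrightarrow> q \<in> V \<and>
      \<bar>h q - h p - (\<Sum>i<m. partial_deriv i h p * (q i - p i))\<bar> \<le> e / (2 * B) * (\<Sum>i<m. \<bar>q i - p i\<bar>)"
      using C1_linear_approx[OF V h, of p "e / (2*B)"] \<gamma>V(2) e B unfolding p_def by auto
    have "\<forall>\<^sub>F t in at t0. \<forall>i\<in>{..<m}. \<bar>\<gamma> t i - p i\<bar> < d"
      using tendstoD[OF cont d(1)] by (intro eventually_ball_finite) (auto simp: dist_real_def)
    moreover have "\<forall>\<^sub>F t in at t0. N t / \<bar>t - t0\<bar> < B"
      using order_tendstoD(2)[OF N_quot, of B] by (simp add: B_def)
    moreover have "\<forall>\<^sub>F t in at t0. t \<noteq> t0"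
      by (simp add: eventually_at_filter)
    ultimately show "\<forall>\<^sub>F t in at t0. dist (R t / (t - t0)) 0 < e"
      using \<gamma>V(1)
    proof eventually_elim
      case (elim t)
      have "near m d p (\<gamma> t)" using elim by (auto simp: near_def)
      then have R: "\<bar>R t\<bar> \<le> e / (2*B) * N t" using d(2) elim unfolding R_def N_def by blast
      have "\<bar>R t / (t - t0)\<bar> = \<bar>R t\<bar> / \<bar>t - t0\<bar>" by simp
      also have "\<dots> \<le> e / (2*B) * N t / \<bar>t - t0\<bar>" using R by (intro divide_right_mono) auto
      also have "\<dots> = e / (2*B) * (N t / \<bar>t - t0\<bar>)" by simp
      also have "\<dots> \<le> e / (2*B) * B" using elim e B by (intro mult_left_mono) auto
      also have "\<dots> < e" using e B by simp
      finally show ?case by simp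
    qed
  qed
  moreover have "((\<lambda>t. \<Sum>i<m. partial_deriv i h p * ((\<gamma> t i - p i) / (t - t0))) \<longlongrightarrow> (\<Sum>i<m. partial_deriv i h p * \<gamma>' i)) (at t0)"
    by (intro tendsto_sum tendsto_mult quot tendsto_const) auto
  ultimately have "((\<lambda>t. R t / (t - t0) + (\<Sum>i<m. partial_deriv i h p * ((\<gamma> t i - p i) / (t - t0)))) \<longlongrightarrow> 0 + (\<Sum>i<m. partial_deriv i h p * \<gamma>' i)) (at t0)"
    by (rule tendsto_add)
  moreover have "R t / (t - t0) + (\<Sum>i<m. partial_deriv i h p * ((\<gamma> t i - p i) / (t - t0))) = (h (\<gamma> t) - h (\<gamma> t0)) / (t - t0)" for t
    unfolding R_def p_def times_divide_eq_right sum_divide_distrib[symmetric] add_divide_distrib[symmetric] by simp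
  ultimately show ?thesis
    unfolding has_field_derivative_iff p_def by simp
qed

lemma continuous_map_coord_compose:
  assumes W: "W \<subseteq> cs m" and \<psi>: "\<And>k. k < m \<Longrightarrow> cont_on_coord m V (\<lambda>p. \<psi> p k)" "\<And>p. p \<in> V \<Longrightarrow> \<psi> p \<in> W"
    and h: "cont_on_coord m W h" and V: "V \<subseteq> cs m"
  shows "cont_on_coord m V (\<lambda>p. h (\<psi> p))"
proof -
  have "continuous_map (subtopology (coord_space m) V) (coord_space m) \<psi>"
    unfolding continuous_map_componentwise
    using W \<psi> by (fastforce simp: PiE_iff)
  then have "continuous_map (subtopology (coord_space m) V) (subtopology (coord_space m) W) \<psi>"
    using \<psi>(2) by (auto simp: continuous_map_in_subtopology)
  from continuous_map_compose[OF this h] show ?thesis by (simp add: o_def)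
qed

text \<open>Reduces to \<open>C1_chain\<close> along the coordinate lines of the source; the
  resulting formula for the partial derivatives then shows their continuity.\<close>

lemma C1_compose:
  assumes V: "openin (coord_space m) V" and W: "openin (coord_space m) W"
    and \<psi>: "\<And>k. k < m \<Longrightarrow> C1 m V (\<lambda>p. \<psi> p k)" "\<And>p. p \<in> V \<Longrightarrow> \<psi> p \<in> W"
    and h: "C1 m W h"
  shows "C1 m V (\<lambda>p. h (\<psi> p))"
    and "\<And>i p. i < m \<Longrightarrow> p \<in> V \<Longrightarrow> partial_deriv i (\<lambda>p. h (\<psi> p)) p =
      (\<Sum>k<m. partial_deriv k h (\<psi> p) * partial_deriv i (\<lambda>p. \<psi> p k) p)"
proof -
  have Vcs: "V \<subseteq> cs m" and Wcs: "W \<subseteq> cs m" using V W openin_coord by blast+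
  have D: "DERIV (\<lambda>t. h (\<psi> (p(i := t)))) (p i) :>
      (\<Sum>k<m. partial_deriv k h (\<psi> p) * partial_deriv i (\<lambda>p. \<psi> p k) p)"
    if "i < m" "p \<in> V" for i p
  proof -
    have "\<forall>\<^sub>F t in nhds (p i). \<psi> (p(i := t)) \<in> cs m"
      using line_nearby[OF V that(2,1)] by eventually_elim (use \<psi>(2) Wcs in auto)
    then have "\<forall>\<^sub>F t in at (p i). \<psi> (p(i := t)) \<in> cs m"
      by (auto simp: eventually_at_filter elim: eventually_mono)
    from C1_chain[OF W h this, of "\<lambda>k. partial_deriv i (\<lambda>p. \<psi> p k) p"]
    show ?thesis using \<psi>(2)[OF that(2)] C1D(2)[OF \<psi>(1) that] by simp
  qed
  show "partial_deriv i (\<lambda>p. h (\<psi> p)) p =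
      (\<Sum>k<m. partial_deriv k h (\<psi> p) * partial_deriv i (\<lambda>p. \<psi> p k) p)" if "i < m" "p \<in> V" for i p
    by (rule partial_deriv_eqI[OF D[OF that]])
  show "C1 m V (\<lambda>p. h (\<psi> p))"
  proof (rule C1I[OF _ D])
    have c: "cont_on_coord m V (\<lambda>p. g (\<psi> p))" if "cont_on_coord m W g" for g
      using continuous_map_coord_compose[OF Wcs C1D(1)[OF \<psi>(1)] \<psi>(2) that Vcs] .
    show "cont_on_coord m V (\<lambda>p. h (\<psi> p))" by (rule c[OF C1D(1)[OF h]])
    show "cont_on_coord m V (\<lambda>p. \<Sum>k<m. partial_deriv k h (\<psi> p) * partial_deriv i (\<lambda>p. \<psi> p k) p)"
      if "i < m" for i
      by (intro continuous_map_sum continuous_map_real_mult c C1D(3)[OF h] C1D(3)[OF \<psi>(1)] that) auto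
  qed
qed

text \<open>Both mixed partial derivatives are limits of the same second difference quotients.\<close>

lemma mixed_partials_meet:
  assumes h: "C1 m V h" "C1 m V (partial_deriv i h)" and ij: "i < m" "j < m" "i \<noteq> j"
    and s: "s > 0" and sq: "\<And>a b. p i \<le> a \<Longrightarrow> a \<le> p i + s \<Longrightarrow> p j \<le> b \<Longrightarrow> b \<le> p j + s \<Longrightarrow> p(i := a, j := b) \<in> V"
  shows "\<exists>a b. p i \<le> a \<and> a \<le> p i + s \<and> p j \<le> b \<and> b \<le> p j + s \<and>
    h (p(i := p i + s, j := p j + s)) - h (p(i := p i + s, j := p j)) - h (p(i := p i, j := p j + s)) + h (p(i := p i, j := p j))
     = s * (s * partial_deriv j (partial_deriv i h) (p(i := a, j := b)))"
proof -
  define G where "G a = h (p(i := a, j := p j + s)) - h (p(i := a, j := p j))" for a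
  have dh: "DERIV (\<lambda>a. h (p(i := a, j := b))) a :> partial_deriv i h (p(i := a, j := b))"
    if "p i \<le> a" "a \<le> p i + s" "p j \<le> b" "b \<le> p j + s" for a b
  proof -
    have "(\<lambda>t. h ((p(i := a, j := b))(i := t))) = (\<lambda>t. h (p(i := t, j := b)))"
      using ij by (simp add: fun_upd_twist)
    then show ?thesis using C1D(2)[OF h(1) ij(1) sq[OF that]] ij by simp
  qed
  have "\<exists>a>p i. a < p i + s \<and> G (p i + s) - G (p i) = (p i + s - p i) *
     (partial_deriv i h (p(i := a, j := p j + s)) - partial_deriv i h (p(i := a, j := p j)))"
  proof (rule MVT2)
    show "DERIV G a :> partial_deriv i h (p(i := a, j := p j + s)) - partial_deriv i h (p(i := a, j := p j))"
      if "p i \<le> a" "a \<le> p i + s" for a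
      unfolding G_def using that s by (intro DERIV_diff dh) auto
  qed (use s in auto)
  then obtain a where a: "p i < a" "a < p i + s" "G (p i + s) - G (p i) = s *
     (partial_deriv i h (p(i := a, j := p j + s)) - partial_deriv i h (p(i := a, j := p j)))" by auto
  have "\<exists>b>p j. b < p j + s \<and> partial_deriv i h (p(i := a, j := p j + s)) - partial_deriv i h (p(i := a, j := p j))
     = (p j + s - p j) * partial_deriv j (partial_deriv i h) (p(i := a, j := b))"
  proof (rule MVT2)
    show "DERIV (\<lambda>b. partial_deriv i h (p(i := a, j := b))) b :> partial_deriv j (partial_deriv i h) (p(i := a, j := b))"
      if "p j \<le> b" "b \<le> p j + s" for b
      using C1D(2)[OF h(2) ij(2) sq[of a b]] a that by simp
  qed (use s in auto)
  then obtain b where b: "p j < b" "b < p j + s"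
    "partial_deriv i h (p(i := a, j := p j + s)) - partial_deriv i h (p(i := a, j := p j))
     = s * partial_deriv j (partial_deriv i h) (p(i := a, j := b))" by auto
  show ?thesis
    using a b by (intro exI[of _ a] exI[of _ b]) (simp add: G_def)
qed

lemma mixed_partials:
  assumes V: "openin (coord_space m) V" and p: "p \<in> V" and ij: "i < m" "j < m"
    and h: "C1 m V h" "C1 m V (partial_deriv i h)" "C1 m V (partial_deriv j h)"
  shows "partial_deriv i (partial_deriv j h) p = partial_deriv j (partial_deriv i h) p"
proof (cases "i = j")
  case False
  let ?A = "partial_deriv i (partial_deriv j h)" and ?B = "partial_deriv j (partial_deriv i h)"
  have pcs: "p \<in> cs m" using V p openin_coord by blast
  have "\<bar>?A p - ?B p\<bar> \<le> e" if e: "e > 0" for e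
  proof -
    have "cont_on_coord m V ?A" "cont_on_coord m V ?B" using C1D(3) h ij by blast+
    note c = this[unfolded cont_on_coord_iff[OF V], rule_format, OF p half_gt_zero[OF e]]
    obtain d1 where d1: "d1 > 0" "\<forall>q\<in>cs m. near m d1 p q \<longrightarrow> q \<in> V \<and> \<bar>?A q - ?A p\<bar> < e/2"
      using c(1) by blast
    obtain d2 where d2: "d2 > 0" "\<forall>q\<in>cs m. near m d2 p q \<longrightarrow> q \<in> V \<and> \<bar>?B q - ?B p\<bar> < e/2"
      using c(2) by blast
    note d = d1 d2
    define s where "s = min d1 d2 / 2"
    have s: "s > 0" using d by (simp add: s_def)
    have n: "p(i := a, j := b) \<in> cs m" "near m d1 p (p(i := a, j := b))" "near m d2 p (p(i := a, j := b))"
      if "p i \<le> a" "a \<le> p i + s" "p j \<le> b" "b \<le> p j + s" for a b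
      using that d False unfolding near_def s_def by (auto intro!: upd_cs pcs ij)
    have sq: "p(i := a, j := b) \<in> V"
      if "p i \<le> a" "a \<le> p i + s" "p j \<le> b" "b \<le> p j + s" for a b
      using n[OF that] d by blast
    obtain a b where ab: "p i \<le> a" "a \<le> p i + s" "p j \<le> b" "b \<le> p j + s"
      "h (p(i := p i + s, j := p j + s)) - h (p(i := p i + s, j := p j)) - h (p(i := p i, j := p j + s)) + h (p(i := p i, j := p j))
     = s * (s * ?B (p(i := a, j := b)))"
      using mixed_partials_meet[OF h(1,2) ij False s sq] by blast
    have tw: "p(j := b, i := a) = p(i := a, j := b)" for a b
      using False by (simp add: fun_upd_twist)
    \<comment> \<open>With i and j exchanged, the second difference is the same number with its two
      middle terms swapped, so both intermediate points belong to one quotient.\<close>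
    obtain a' b' where ab': "p i \<le> a'" "a' \<le> p i + s" "p j \<le> b'" "b' \<le> p j + s"
      "h (p(i := p i + s, j := p j + s)) - h (p(i := p i, j := p j + s)) - h (p(i := p i + s, j := p j)) + h (p(i := p i, j := p j))
     = s * (s * ?A (p(i := a', j := b')))"
      using mixed_partials_meet[OF h(1,3) ij(2,1) False[symmetric] s, of p] sq unfolding tw by blast
    have "s * (s * ?B (p(i := a, j := b))) = s * (s * ?A (p(i := a', j := b')))"
      using ab(5) ab'(5) by linarith
    then have "?B (p(i := a, j := b)) = ?A (p(i := a', j := b'))" using s by simp
    moreover have "\<bar>?B (p(i := a, j := b)) - ?B p\<bar> < e/2" using d n[OF ab(1-4)] by blast
    moreover have "\<bar>?A (p(i := a', j := b')) - ?A p\<bar> < e/2" using d n[OF ab'(1-4)] by blast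
    ultimately show ?thesis by linarith
  qed
  then have "\<bar>?A p - ?B p\<bar> \<le> 0" by (rule field_le_epsilon) auto
  then show ?thesis by simp
qed simp

section \<open>Determinants and inverses of matrices of functions\<close>

definition fmat :: "nat \<Rightarrow> (nat \<Rightarrow> nat \<Rightarrow> real) \<Rightarrow> real mat" where
  "fmat m A = mat m m (\<lambda>(i, j). A i j)"

definition fdet :: "nat \<Rightarrow> (nat \<Rightarrow> nat \<Rightarrow> real) \<Rightarrow> real" where
  "fdet m A = Determinant.det (fmat m A)"

definition fcof :: "nat \<Rightarrow> (nat \<Rightarrow> nat \<Rightarrow> real) \<Rightarrow> nat \<Rightarrow> nat \<Rightarrow> real" where
  "fcof m A i j = cofactor (fmat m A) i j"

text \<open>Cramer's rule instead of an abstract inverse: the entries are quotients of determinants,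
  so \<open>C1_finv\<close> reduces to polynomials in the entries and one division.\<close>

definition finv :: "nat \<Rightarrow> (nat \<Rightarrow> nat \<Rightarrow> real) \<Rightarrow> nat \<Rightarrow> nat \<Rightarrow> real" where
  "finv m A i j = fcof m A j i / fdet m A"

lemma fmat_carrier [simp]: "fmat m A \<in> carrier_mat m m"
  by (simp add: fmat_def)

lemma fmat_cong: "(\<And>i j. i < m \<Longrightarrow> j < m \<Longrightarrow> A i j = B i j) \<Longrightarrow> fmat m A = fmat m B"
  unfolding fmat_def by (rule eq_matI) auto

lemma fdet_cong: "(\<And>i j. i < m \<Longrightarrow> j < m \<Longrightarrow> A i j = B i j) \<Longrightarrow> fdet m A = fdet m B"
  unfolding fdet_def using fmat_cong[of m A B] by simp

lemma fcof_cong: "(\<And>i j. i < m \<Longrightarrow> j < m \<Longrightarrow> A i j = B i j) \<Longrightarrow> fcof m A k l = fcof m B k l"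
  unfolding fcof_def using fmat_cong[of m A B] by simp

lemma fdet_mult: "fdet m (\<lambda>i j. \<Sum>k<m. A i k * B k j) = fdet m A * fdet m B"
proof -
  have "fmat m (\<lambda>i j. \<Sum>k<m. A i k * B k j) = fmat m A * fmat m B"
    unfolding fmat_def by (rule eq_matI) (auto simp: scalar_prod_def lessThan_atLeast0)
  then show ?thesis unfolding fdet_def by (simp add: det_mult[of _ m])
qed

lemma fdet_transpose: "fdet m (\<lambda>i j. A j i) = fdet m A"
proof -
  have "fmat m (\<lambda>i j. A j i) = transpose_mat (fmat m A)"
    unfolding fmat_def by (rule eq_matI) auto
  then show ?thesis unfolding fdet_def by (simp add: det_transpose[of _ m])
qed

lemma fmat_one: "fmat m (\<lambda>i j. if i = j then 1 else 0) = 1\<^sub>m m"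
  unfolding fmat_def by (rule eq_matI) auto

lemma fdet_one: "fdet m (\<lambda>i j. if i = j then 1 else 0) = 1"
  unfolding fdet_def fmat_one by simp

text \<open>Laplace expansion of B along row k. The minors of this row do not see the row itself,
  hence the cofactors of A may be used.\<close>

lemma fdet_row:
  assumes "k < m" "\<And>i j. i < m \<Longrightarrow> j < m \<Longrightarrow> i \<noteq> k \<Longrightarrow> B i j = A i j"
  shows "fdet m B = (\<Sum>j<m. B k j * fcof m A k j)"
proof -
  have "mat_delete (fmat m B) k j = mat_delete (fmat m A) k j" if "j < m" for j
    unfolding mat_delete_def fmat_def by (rule eq_matI) (use assms that in auto)
  then have "cofactor (fmat m B) k j = fcof m A k j" if "j < m" for j
    using that unfolding fcof_def cofactor_def by simp
  then show ?thesis
    unfolding fdet_def using laplace_expansion_row[OF fmat_carrier assms(1), of B] assms(1)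
    by (simp add: fmat_def)
qed

text \<open>Presents a cofactor as the determinant of a matrix whose entries are constants or
  entries of A, so differentiability of cofactors is a case of \<open>C1_fdet\<close>.\<close>

lemma fcof_eq_fdet:
  assumes "k < m" "l < m"
  shows "fcof m A k l = fdet m (\<lambda>i j. if i = k then (if j = l then 1 else 0) else A i j)"
  by (subst fdet_row[of k m _ A]) (use assms in \<open>auto simp: if_distrib[of "\<lambda>x. x * _"] cong: if_cong\<close>)

lemma fmat_adj:
  assumes "i < m" "j < m"
  shows "(\<Sum>k<m. A i k * fcof m A j k) = (if i = j then fdet m A else 0)"
    and "(\<Sum>k<m. fcof m A k i * A k j) = (if i = j then fdet m A else 0)"
proof -
  have a: "adj_mat (fmat m A) = mat m m (\<lambda>(i,j). fcof m A j i)"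
    unfolding adj_mat_def fcof_def by (simp add: fmat_def)
  have "(fmat m A * adj_mat (fmat m A)) $$ (i, j) = (fdet m A \<cdot>\<^sub>m 1\<^sub>m m) $$ (i, j)"
    unfolding fdet_def using adj_mat(2)[OF fmat_carrier] by metis
  then show "(\<Sum>k<m. A i k * fcof m A j k) = (if i = j then fdet m A else 0)"
    using assms unfolding a by (simp add: fmat_def scalar_prod_def lessThan_atLeast0)
  have "(adj_mat (fmat m A) * fmat m A) $$ (i, j) = (fdet m A \<cdot>\<^sub>m 1\<^sub>m m) $$ (i, j)"
    unfolding fdet_def using adj_mat(3)[OF fmat_carrier] by metis
  then show "(\<Sum>k<m. fcof m A k i * A k j) = (if i = j then fdet m A else 0)"
    using assms unfolding a by (simp add: fmat_def scalar_prod_def lessThan_atLeast0)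
qed

lemma finv_right:
  assumes "fdet m A \<noteq> 0" "i < m" "j < m"
  shows "(\<Sum>k<m. A i k * finv m A k j) = (if i = j then 1 else 0)"
  using fmat_adj(1)[OF assms(2,3), of A] assms(1)
  by (simp add: finv_def sum_divide_distrib[symmetric])

lemma finv_left:
  assumes "fdet m A \<noteq> 0" "i < m" "j < m"
  shows "(\<Sum>k<m. finv m A i k * A k j) = (if i = j then 1 else 0)"
  using fmat_adj(2)[OF assms(2,3), of A] assms(1)
  by (simp add: finv_def sum_divide_distrib[symmetric])

lemma sum_delta_left: "(i::nat) < m \<Longrightarrow> (\<Sum>k<m. (if i = k then 1 else 0) * f k) = (f i :: real)"
  and sum_delta_right: "(i::nat) < m \<Longrightarrow> (\<Sum>k<m. f k * (if k = i then 1 else 0)) = (f i :: real)"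
  by (simp_all add: if_distrib[of "\<lambda>x. x * _"] if_distrib[of "\<lambda>x. _ * x"] sum.delta sum.delta' cong: if_cong)

lemma left_inverse_eq_right_inverse:
  fixes L A R :: "nat \<Rightarrow> nat \<Rightarrow> real"
  assumes L: "\<And>i j. i < m \<Longrightarrow> j < m \<Longrightarrow> (\<Sum>k<m. L i k * A k j) = (if i = j then 1 else 0)"
    and R: "\<And>i j. i < m \<Longrightarrow> j < m \<Longrightarrow> (\<Sum>k<m. A i k * R k j) = (if i = j then 1 else 0)"
    and ij: "i < m" "j < m"
  shows "L i j = R i j"
proof -
  have "L i j = (\<Sum>k<m. L i k * (\<Sum>l<m. A k l * R l j))"
    using ij by (simp add: R sum_delta_right)
  also have "\<dots> = (\<Sum>k<m. \<Sum>l<m. L i k * A k l * R l j)"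
    by (simp add: sum_distrib_left mult.assoc)
  also have "\<dots> = (\<Sum>l<m. \<Sum>k<m. L i k * A k l * R l j)"
    by (rule sum.swap)
  also have "\<dots> = (\<Sum>l<m. (\<Sum>k<m. L i k * A k l) * R l j)"
    by (simp add: sum_distrib_right)
  also have "\<dots> = R i j"
    using ij by (simp add: L sum_delta_left)
  finally show ?thesis .
qed

text \<open>For symmetric A the transpose of the inverse is again an inverse, and left and right
  inverses coincide.\<close>

lemma finv_sym:
  assumes "fdet m A \<noteq> 0" "\<And>i j. i < m \<Longrightarrow> j < m \<Longrightarrow> A i j = A j i" "i < m" "j < m"
  shows "finv m A i j = finv m A j i"
proof (rule left_inverse_eq_right_inverse[where A = A and m = m and R = "\<lambda>i j. finv m A j i"])
  show "(\<Sum>k<m. A i k * finv m A j k) = (if i = j then 1 else 0)" if "i < m" "j < m" for i j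
  proof -
    have "(\<Sum>k<m. A i k * finv m A j k) = (\<Sum>k<m. finv m A j k * A k i)"
      using assms(2) that by (intro sum.cong) auto
    then show ?thesis using finv_left[OF assms(1) that(2,1)] by auto
  qed
qed (use assms(1,3,4) finv_left in auto)

lemma fdet_Leibniz: "fdet m A = (\<Sum>p\<in>{p. p permutes {0..<m}}. signof p * (\<Prod>i=0..<m. A i (p i)))"
proof -
  have "(\<Prod>i=0..<m. fmat m A $$ (i, p i)) = (\<Prod>i=0..<m. A i (p i))" if "p permutes {0..<m}" for p
    by (rule prod.cong) (use permutes_in_image[OF that] in \<open>auto simp: fmat_def\<close>)
  then show ?thesis unfolding fdet_def det_def'[OF fmat_carrier] by simp
qed

text \<open>Jacobi's formula. The product rule in the Leibniz sum gives one determinant per row,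
  with that row replaced by its derivative; expanding along this row produces the cofactors.\<close>

lemma DERIV_fdet:
  assumes "\<And>i j. i < m \<Longrightarrow> j < m \<Longrightarrow> DERIV (\<lambda>t. A t i j) t0 :> A' i j"
  shows "DERIV (\<lambda>t. fdet m (A t)) t0 :> (\<Sum>i<m. \<Sum>j<m. A' i j * fcof m (A t0) i j)"
proof -
  let ?P = "{p. p permutes {0..<m}}"
  have "DERIV (\<lambda>t. fdet m (A t)) t0 :>
     (\<Sum>p\<in>?P. signof p * (\<Sum>k=0..<m. A' k (p k) * (\<Prod>i\<in>{0..<m} - {k}. A t0 i (p i))))"
    unfolding fdet_Leibniz
  proof (intro DERIV_sum DERIV_cmult has_field_derivative_prod)
    fix p k assume "p \<in> ?P" "k \<in> {0..<m}"
    then have "k < m" "p k < m" using permutes_in_image[of p "{0..<m}" k] by auto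
    then show "DERIV (\<lambda>t. A t k (p k)) t0 :> A' k (p k)" by (rule assms)
  qed
  also have "(\<Sum>p\<in>?P. signof p * (\<Sum>k=0..<m. A' k (p k) * (\<Prod>i\<in>{0..<m} - {k}. A t0 i (p i))))
     = (\<Sum>k=0..<m. \<Sum>p\<in>?P. signof p * (A' k (p k) * (\<Prod>i\<in>{0..<m} - {k}. A t0 i (p i))))"
    unfolding sum_distrib_left by (rule sum.swap)
  also have "\<dots> = (\<Sum>k=0..<m. fdet m (\<lambda>i j. if i = k then A' k j else A t0 i j))"
  proof (rule sum.cong[OF refl])
    fix k assume k: "k \<in> {0..<m}"
    have "(\<Prod>i=0..<m. if i = k then A' k (p i) else A t0 i (p i)) =
        A' k (p k) * (\<Prod>i\<in>{0..<m} - {k}. A t0 i (p i))" for p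
      by (subst prod.remove[OF _ k]) (auto intro!: prod.cong)
    then show "(\<Sum>p\<in>?P. signof p * (A' k (p k) * (\<Prod>i\<in>{0..<m} - {k}. A t0 i (p i))))
      = fdet m (\<lambda>i j. if i = k then A' k j else A t0 i j)"
      unfolding fdet_Leibniz by simp
  qed
  also have "\<dots> = (\<Sum>i<m. \<Sum>j<m. A' i j * fcof m (A t0) i j)"
    unfolding lessThan_atLeast0
  proof (rule sum.cong[OF refl])
    fix k assume "k \<in> {0..<m}"
    then show "fdet m (\<lambda>i j. if i = k then A' k j else A t0 i j) = (\<Sum>j=0..<m. A' k j * fcof m (A t0) k j)"
      using fdet_row[of k m "\<lambda>i j. if i = k then A' k j else A t0 i j" "A t0"] by (simp add: lessThan_atLeast0)
  qed
  finally show ?thesis .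
qed

lemma C1_fdet:
  assumes "\<And>i j. i < m \<Longrightarrow> j < m \<Longrightarrow> C1 n V (\<lambda>p. A p i j)"
  shows "C1 n V (\<lambda>p. fdet m (A p))"
  unfolding fdet_Leibniz
proof (intro C1_sum C1_mult C1_prod C1_const)
  fix p i assume "p \<in> {p. p permutes {0..<m}}" "i \<in> {0..<m}"
  then have "i < m" "p i < m" using permutes_in_image[of p "{0..<m}" i] by auto
  then show "C1 n V (\<lambda>q. A q i (p i))" by (rule assms)
qed

lemma C1_if: "(b \<Longrightarrow> C1 n V f) \<Longrightarrow> (\<not> b \<Longrightarrow> C1 n V g) \<Longrightarrow> C1 n V (\<lambda>p. if b then f p else g p)"
  by (cases b) auto

lemma C1_fcof:
  assumes "\<And>i j. i < m \<Longrightarrow> j < m \<Longrightarrow> C1 n V (\<lambda>p. A p i j)" "k < m" "l < m"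
  shows "C1 n V (\<lambda>p. fcof m (A p) k l)"
  unfolding fcof_eq_fdet[OF assms(2,3)] by (intro C1_fdet C1_if C1_const assms)

lemma C1_finv:
  assumes "\<And>i j. i < m \<Longrightarrow> j < m \<Longrightarrow> C1 n V (\<lambda>p. A p i j)" "\<And>p. p \<in> V \<Longrightarrow> fdet m (A p) \<noteq> 0" "k < m" "l < m"
  shows "C1 n V (\<lambda>p. finv m (A p) k l)"
  unfolding finv_def divide_inverse by (intro C1_mult C1_inverse C1_fcof C1_fdet assms)

section \<open>Positive definite matrices\<close>

definition pos_def :: "nat \<Rightarrow> (nat \<Rightarrow> nat \<Rightarrow> real) \<Rightarrow> bool" where
  "pos_def m A \<longleftrightarrow> (\<forall>v. (\<exists>i<m. v i \<noteq> 0) \<longrightarrow> (\<Sum>i<m. \<Sum>j<m. A i j * v i * v j) > 0)"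

text \<open>A nonzero kernel vector would make the quadratic form vanish.\<close>

lemma pos_def_fdet_nonzero:
  assumes "pos_def m A"
  shows "fdet m A \<noteq> 0"
proof
  assume "fdet m A = 0"
  then obtain v where v: "v \<in> carrier_vec m" "v \<noteq> 0\<^sub>v m" "fmat m A *\<^sub>v v = 0\<^sub>v m"
    unfolding fdet_def using det_0_iff_vec_prod_zero_field[OF fmat_carrier] by blast
  let ?v = "\<lambda>i. vec_index v i"
  have "(\<Sum>j<m. A i j * ?v j) = 0" if "i < m" for i
  proof -
    have "vec_index (fmat m A *\<^sub>v v) i = 0" using v(3) that by simp
    then show ?thesis
      using that v(1) by (simp add: fmat_def scalar_prod_def lessThan_atLeast0)
  qed
  then have "(\<Sum>i<m. \<Sum>j<m. A i j * ?v i * ?v j) = 0"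
    by (simp add: mult.assoc mult.left_commute[of "A _ _"] sum_distrib_left[symmetric])
  moreover have "\<exists>i<m. ?v i \<noteq> 0" using v(1,2) by (auto simp: vec_eq_iff)
  ultimately show False using assms unfolding pos_def_def by force
qed

text \<open>The segment from the identity matrix to A consists of positive definite, hence
  invertible, matrices. The determinant is 1 at its start and cannot pass through 0 along it.
  Positivity makes the square root in the volume density differentiable.\<close>

lemma pos_def_fdet_pos:
  assumes "pos_def m A"
  shows "fdet m A > 0"
proof -
  define B where "B t = (\<lambda>i j. (1 - t) * (if i = j then 1 else 0) + t * A i j)" for t :: real
  have "pos_def m (B t)" if t: "0 \<le> t" "t \<le> 1" for t
    unfolding pos_def_def
  proof (intro allI impI)
    fix v :: "nat \<Rightarrow> real" assume v: "\<exists>i<m. v i \<noteq> 0"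
    have "(\<Sum>i<m. \<Sum>j<m. B t i j * v i * v j) =
        (1 - t) * (\<Sum>i<m. \<Sum>j<m. (if i = j then 1 else 0) * v i * v j) + t * (\<Sum>i<m. \<Sum>j<m. A i j * v i * v j)"
      by (simp add: B_def sum_distrib_left sum.distrib[symmetric] algebra_simps)
    also have "(\<Sum>i<m. \<Sum>j<m. (if i = j then 1 else 0) * v i * v j) = (\<Sum>i<m. v i * v i)"
      by (simp add: mult.assoc sum_delta_left)
    finally have *: "(\<Sum>i<m. \<Sum>j<m. B t i j * v i * v j) = (1 - t) * (\<Sum>i<m. v i * v i) + t * (\<Sum>i<m. \<Sum>j<m. A i j * v i * v j)" .
    have "(\<Sum>i<m. v i * v i) > 0"
    proof -
      obtain i where "i < m" "v i \<noteq> 0" using v by blast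
      then show ?thesis
        by (intro sum_pos2[where i = i]) (auto simp: zero_less_mult_iff)
    qed
    moreover have "(\<Sum>i<m. \<Sum>j<m. A i j * v i * v j) > 0" using assms v unfolding pos_def_def by blast
    ultimately show "(\<Sum>i<m. \<Sum>j<m. B t i j * v i * v j) > 0"
      unfolding * using t by (cases "t = 0") (auto intro!: add_nonneg_pos)
  qed
  then have nz: "fdet m (B t) \<noteq> 0" if "0 \<le> t" "t \<le> 1" for t
    using pos_def_fdet_nonzero that by blast
  have cont: "continuous_on {0..1} (\<lambda>t. fdet m (B t))"
    unfolding fdet_Leibniz B_def by (intro continuous_intros)
  have "B 0 = (\<lambda>i j. if i = j then 1 else 0)" "B 1 = A" by (auto simp: B_def fun_eq_iff)
  then have "fdet m (B 0) = 1" "fdet m (B 1) = fdet m A" by (auto simp: fdet_one)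
  then have "\<not> fdet m A \<le> 0"
    using IVT2'[of "\<lambda>t. fdet m (B t)" 1 0 0] nz cont by auto
  then show ?thesis by simp
qed

lemma metric_mat_eq_fmat: "metric_mat m M c q = fmat m (metric M c q)"
  by (simp add: metric_mat_def fmat_def)

lemma inverse_metric_eq_finv:
  "i < m \<Longrightarrow> j < m \<Longrightarrow> inverse_metric m M c q i j = finv m (metric M c q) i j"
  unfolding inverse_metric_def finv_def metric_mat_eq_fmat fdet_def fcof_def adj_mat_def
  by (simp add: fmat_def)

section \<open>Lebesgue measure on coordinate space\<close>

interpretation lborel_family: product_sigma_finite "\<lambda>_::nat. lborel :: real measure" ..

lemma space_lborel_coord [simp]: "space (lborel_coord m) = cs m"
  by (simp add: lborel_coord_def space_PiM)

lemma coordinate_measurable [measurable]: "i < m \<Longrightarrow> (\<lambda>p. p i) \<in> borel_measurable (lborel_coord m)"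
proof -
  assume "i < m"
  then have "(\<lambda>p. p i) \<in> measurable (lborel_coord m) lborel"
    unfolding lborel_coord_def by (intro measurable_component_singleton) auto
  then show ?thesis by simp
qed

lemma measurable_into_coord:
  assumes "\<And>i. i < m \<Longrightarrow> (\<lambda>x. f x i) \<in> borel_measurable N" "\<And>x. x \<in> space N \<Longrightarrow> f x \<in> cs m"
  shows "f \<in> measurable N (lborel_coord m)"
  unfolding lborel_coord_def
proof (rule measurable_PiM_single')
  show "(\<lambda>x. f x i) \<in> measurable N lborel" if "i \<in> {..<m}" for i using assms(1) that by simp
  show "f \<in> space N \<rightarrow> (\<Pi>\<^sub>E i\<in>{..<m}. space lborel)" using assms(2) by auto
qed

text \<open>Half-open boxes split into disjoint halves and intersect in half-open boxes; the closed
  boxes below are their compact counterparts.\<close>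

definition hbox :: "nat \<Rightarrow> (nat \<Rightarrow> real) \<Rightarrow> (nat \<Rightarrow> real) \<Rightarrow> (nat \<Rightarrow> real) set" where
  "hbox m a b = Pi\<^sub>E {..<m} (\<lambda>i. {a i..<b i})"

definition kbox :: "nat \<Rightarrow> (nat \<Rightarrow> real) \<Rightarrow> (nat \<Rightarrow> real) \<Rightarrow> (nat \<Rightarrow> real) set" where
  "kbox m a b = Pi\<^sub>E {..<m} (\<lambda>i. {a i..b i})"

lemma hbox_iff: "p \<in> hbox m a b \<longleftrightarrow> p \<in> cs m \<and> (\<forall>i<m. a i \<le> p i \<and> p i < b i)"
  by (auto simp: hbox_def PiE_iff)

lemma kbox_iff: "p \<in> kbox m a b \<longleftrightarrow> p \<in> cs m \<and> (\<forall>i<m. a i \<le> p i \<and> p i \<le> b i)"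
  by (auto simp: kbox_def PiE_iff)

lemma hbox_subset_kbox: "hbox m a b \<subseteq> kbox m a b"
  by (auto simp: hbox_iff kbox_iff less_imp_le)

lemma hbox_sets [measurable, simp]: "hbox m a b \<in> sets (lborel_coord m)"
  unfolding hbox_def lborel_coord_def by (intro sets_PiM_I_finite) auto

lemma kbox_sets [measurable, simp]: "kbox m a b \<in> sets (lborel_coord m)"
  unfolding kbox_def lborel_coord_def by (intro sets_PiM_I_finite) auto

lemma emeasure_hbox:
  assumes "\<And>i. i < m \<Longrightarrow> a i \<le> b i"
  shows "emeasure (lborel_coord m) (hbox m a b) = ennreal (\<Prod>i<m. b i - a i)"
proof -
  have "emeasure (lborel_coord m) (hbox m a b) = (\<Prod>i<m. emeasure lborel {a i..<b i})"
    unfolding hbox_def lborel_coord_def by (rule lborel_family.emeasure_PiM) auto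
  also have "\<dots> = (\<Prod>i<m. ennreal (b i - a i))"
    using assms by (intro prod.cong) auto
  also have "\<dots> = ennreal (\<Prod>i<m. b i - a i)"
    using assms by (intro prod_ennreal) auto
  finally show ?thesis .
qed

lemma emeasure_kbox:
  assumes "\<And>i. i < m \<Longrightarrow> a i \<le> b i"
  shows "emeasure (lborel_coord m) (kbox m a b) = ennreal (\<Prod>i<m. b i - a i)"
proof -
  have "emeasure (lborel_coord m) (kbox m a b) = (\<Prod>i<m. emeasure lborel {a i..b i})"
    unfolding kbox_def lborel_coord_def by (rule lborel_family.emeasure_PiM) auto
  also have "\<dots> = (\<Prod>i<m. ennreal (b i - a i))"
    using assms by (intro prod.cong) auto
  also have "\<dots> = ennreal (\<Prod>i<m. b i - a i)"
    using assms by (intro prod_ennreal) auto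
  finally show ?thesis .
qed

text \<open>The boxes have rational corners. Keeping each closed box inside V makes continuous
  densities on V bounded on every member of the cover.\<close>

lemma openin_countable_hboxes:
  assumes V: "openin (coord_space m) V"
  shows "\<exists>C. countable C \<and> V = (\<Union>(a,b)\<in>C. hbox m a b) \<and>
     (\<forall>(a,b)\<in>C. (\<forall>i<m. a i < b i) \<and> kbox m a b \<subseteq> V)"
proof -
  define R where "R = Pi\<^sub>E {..<m} (\<lambda>_. \<rat> :: real set)"
  define C where "C = {(a,b) \<in> R \<times> R. (\<forall>i<m. a i < b i) \<and> kbox m a b \<subseteq> V}"
  have "countable R" unfolding R_def by (intro countable_PiE) (auto simp: countable_rat)
  then have "countable C" unfolding C_def by (intro countable_subset[OF _ countable_SIGMA]) auto
  moreover have "V = (\<Union>(a,b)\<in>C. hbox m a b)"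
  proof
    show "(\<Union>(a,b)\<in>C. hbox m a b) \<subseteq> V"
      using hbox_subset_kbox by (fastforce simp: C_def)
    show "V \<subseteq> (\<Union>(a,b)\<in>C. hbox m a b)"
    proof
      fix p assume p: "p \<in> V"
      then obtain d where d: "d > 0" "\<forall>q\<in>cs m. near m d p q \<longrightarrow> q \<in> V" and pcs: "p \<in> cs m"
        using V unfolding openin_coord by blast
      have "\<forall>i. \<exists>r\<in>\<rat>. p i - d < r \<and> r < p i" "\<forall>i. \<exists>r\<in>\<rat>. p i < r \<and> r < p i + d"
        using d(1) Rats_dense_in_real[of "p i - d" "p i" for i] Rats_dense_in_real[of "p i" "p i + d" for i]
        by auto
      then obtain a b where ab: "\<And>i. a i \<in> \<rat> \<and> p i - d < a i \<and> a i < p i" "\<And>i. b i \<in> \<rat> \<and> p i < b i \<and> b i < p i + d"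
        by metis
      \<comment> \<open>Outside the index set the corners take the fixed undefined value; only then
        do they belong to the countable set R.\<close>
      let ?a = "restrict a {..<m}" and ?b = "restrict b {..<m}"
      have "kbox m ?a ?b \<subseteq> V"
      proof
        fix q assume q: "q \<in> kbox m ?a ?b"
        have "\<bar>q i - p i\<bar> < d" if "i < m" for i
        proof -
          have "a i \<le> q i" "q i \<le> b i" using q that by (auto simp: kbox_iff)
          then show ?thesis using ab[of i] by linarith
        qed
        then show "q \<in> V" using d(2) q by (auto simp: kbox_iff near_def)
      qed
      moreover have "\<forall>i<m. a i < b i" using ab less_trans by blast
      ultimately have "(?a, ?b) \<in> C" using ab by (auto simp: C_def R_def)
      moreover have "p \<in> hbox m ?a ?b" using ab pcs by (auto simp: hbox_iff less_imp_le)
      ultimately show "p \<in> (\<Union>(a,b)\<in>C. hbox m a b)" by blast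
    qed
  qed
  ultimately show ?thesis unfolding C_def by blast
qed

lemma openin_sets: "openin (coord_space m) V \<Longrightarrow> V \<in> sets (lborel_coord m)"
proof -
  assume "openin (coord_space m) V"
  then obtain C where C: "countable C" "V = (\<Union>(a,b)\<in>C. hbox m a b)"
    using openin_countable_hboxes by metis
  show ?thesis unfolding C(2) by (intro sets.countable_UN' C(1)) auto
qed

text \<open>Open sets are countable unions of boxes, which gives one inclusion; for the other, the
  coordinates are continuous and generate the product sigma-algebra.\<close>

lemma sets_lborel_coord: "sets (lborel_coord m) = sigma_sets (cs m) {U. openin (coord_space m) U}"
proof
  have op: "{U. openin (coord_space m) U} \<subseteq> Pow (cs m)" using openin_coord by blast
  show "sigma_sets (cs m) {U. openin (coord_space m) U} \<subseteq> sets (lborel_coord m)"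
    using sets.sigma_sets_subset[of "{U. openin (coord_space m) U}" "lborel_coord m"] openin_sets by auto
  let ?B = "measure_of (cs m) {U. openin (coord_space m) U} (\<lambda>_. 0)"
  have sp: "space ?B = cs m" and st: "sets ?B = sigma_sets (cs m) {U. openin (coord_space m) U}"
    using op by (auto simp: space_measure_of_conv sets_measure_of)
  have "(\<lambda>p. p) \<in> measurable ?B (lborel_coord m)"
  proof (rule measurable_into_coord)
    fix i assume i: "i < m"
    show "(\<lambda>p. p i) \<in> borel_measurable ?B"
    proof (rule borel_measurableI)
      fix S :: "real set" assume "open S"
      have "openin (coord_space m) {p \<in> topspace (coord_space m). p i \<in> S}"
        by (rule openin_continuous_map_preimage[where Y = euclideanreal])
           (use i \<open>open S\<close> in \<open>auto intro: continuous_map_product_coordinates\<close>)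
      moreover have "(\<lambda>p. p i) -` S \<inter> space ?B = {p \<in> topspace (coord_space m). p i \<in> S}"
        unfolding sp by auto
      ultimately show "(\<lambda>p. p i) -` S \<inter> space ?B \<in> sets ?B" unfolding st by auto
    qed
  qed (simp add: sp)
  then show "sets (lborel_coord m) \<subseteq> sigma_sets (cs m) {U. openin (coord_space m) U}"
    unfolding measurable_def sp st using sets.sets_into_space[of _ "lborel_coord m"]
    by (auto simp: Int_absorb2)
qed

lemma cont_on_coord_measurable:
  assumes V: "openin (coord_space m) V" and h: "cont_on_coord m V h"
  shows "h \<in> borel_measurable (restrict_space (lborel_coord m) V)"
proof (rule borel_measurableI)
  have Vcs: "V \<subseteq> cs m" using V openin_coord by blast
  have sp: "space (restrict_space (lborel_coord m) V) = V" using Vcs by (auto simp: space_restrict_space)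
  fix S :: "real set" assume S: "open S"
  have "openin (subtopology (coord_space m) V) {x \<in> topspace (subtopology (coord_space m) V). h x \<in> S}"
    by (rule openin_continuous_map_preimage[OF h]) (use S in simp)
  moreover have "{x \<in> topspace (subtopology (coord_space m) V). h x \<in> S} = h -` S \<inter> V"
    using Vcs by auto
  ultimately have "openin (coord_space m) (h -` S \<inter> V)"
    using openin_open_subtopology[OF V] by simp
  then have "h -` S \<inter> V \<in> sets (lborel_coord m)" by (rule openin_sets)
  then show "h -` S \<inter> space (restrict_space (lborel_coord m) V) \<in> sets (restrict_space (lborel_coord m) V)"
    unfolding sp using openin_sets[OF V] by (subst sets_restrict_space_iff) (auto simp: Int_absorb2[OF Vcs])
qed

section \<open>Linear changes of coordinates\<close>

text \<open>Since \<beta> does not depend on coordinate k, integrating this coordinate first leaves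
  a one-dimensional affine substitution. Dilations, shears and translations in one coordinate are
  all special cases.\<close>

lemma nn_integral_coordinate_affine:
  assumes k: "k < m" and c: "c \<noteq> 0" and f: "f \<in> borel_measurable (lborel_coord m)"
    and \<beta>: "\<beta> \<in> borel_measurable (lborel_coord m)" "\<And>p t. p \<in> cs m \<Longrightarrow> \<beta> (p(k := t)) = \<beta> p"
  shows "(\<integral>\<^sup>+p. f p \<partial>lborel_coord m) =
    ennreal \<bar>c\<bar> * (\<integral>\<^sup>+p. f (p(k := \<beta> p + c * p k)) \<partial>lborel_coord m)"
proof -
  let ?I = "{..<m} - {k}"
  have I: "finite ?I" "k \<notin> ?I" and ins: "insert k ?I = {..<m}" using k by auto
  let ?P = "\<lambda>J. Pi\<^sub>M J (\<lambda>_. lborel :: real measure)"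
  have fm: "f \<in> borel_measurable (?P (insert k ?I))" using f unfolding ins lborel_coord_def .
  have T: "(\<lambda>p. p(k := \<beta> p + c * p k)) \<in> measurable (lborel_coord m) (lborel_coord m)"
  proof (rule measurable_into_coord)
    show "(\<lambda>p. (p(k := \<beta> p + c * p k)) i) \<in> borel_measurable (lborel_coord m)" if "i < m" for i
      using that k \<beta>(1) by (cases "i = k") auto
  qed (use k in \<open>auto intro!: upd_cs\<close>)
  have fTm: "(\<lambda>p. f (p(k := \<beta> p + c * p k))) \<in> borel_measurable (?P (insert k ?I))"
    using measurable_compose[OF T f] unfolding ins lborel_coord_def .
  have "(\<integral>\<^sup>+p. f p \<partial>lborel_coord m) = (\<integral>\<^sup>+x. (\<integral>\<^sup>+y. f (x(k := y)) \<partial>lborel) \<partial>?P ?I)"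
    using lborel_family.product_nn_integral_insert[OF I fm] unfolding ins lborel_coord_def .
  also have "\<dots> = (\<integral>\<^sup>+x. ennreal \<bar>c\<bar> * (\<integral>\<^sup>+y. f (x(k := \<beta> (x(k := y)) + c * y)) \<partial>lborel) \<partial>?P ?I)"
  proof (rule nn_integral_cong)
    fix x assume x: "x \<in> space (?P ?I)"
    have xk: "x(k := t) \<in> cs m" for t
      using x k by (auto simp: space_PiM PiE_iff extensional_def)
    define b where "b = \<beta> (x(k := 0))"
    have "\<beta> (x(k := y)) = b" for y
      using \<beta>(2)[OF xk[of 0], of y] by (simp add: b_def)
    moreover have "(\<lambda>y. f (x(k := y))) \<in> borel_measurable borel"
      using measurable_comp[OF measurable_component_update fm, OF x I(2)] by (simp add: comp_def fun_upd_def)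
    ultimately show "(\<integral>\<^sup>+y. f (x(k := y)) \<partial>lborel) = ennreal \<bar>c\<bar> * (\<integral>\<^sup>+y. f (x(k := \<beta> (x(k := y)) + c * y)) \<partial>lborel)"
      using nn_integral_real_affine[OF _ c, of "\<lambda>y. f (x(k := y))" b] by simp
  qed
  also have "\<dots> = ennreal \<bar>c\<bar> * (\<integral>\<^sup>+x. (\<integral>\<^sup>+y. f (x(k := \<beta> (x(k := y)) + c * y)) \<partial>lborel) \<partial>?P ?I)"
  proof (rule nn_integral_cmult)
    have "(\<lambda>x. \<integral>\<^sup>+y. (\<lambda>(x, y). f ((x(k := y))(k := \<beta> (x(k := y)) + c * (x(k := y)) k))) (x, y) \<partial>lborel) \<in> borel_measurable (?P ?I)"
    proof (rule sigma_finite_measure.borel_measurable_nn_integral[OF lborel.sigma_finite_measure_axioms])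
      have "(\<lambda>(x, y). (\<lambda>p. f (p(k := \<beta> p + c * p k))) (x(k := y))) \<in> borel_measurable (?P ?I \<Otimes>\<^sub>M lborel)"
        using measurable_comp[OF measurable_add_dim fTm] by (simp add: comp_def case_prod_beta)
      then show "(\<lambda>(x, y). (\<lambda>(x, y). f ((x(k := y))(k := \<beta> (x(k := y)) + c * (x(k := y)) k))) (x, y)) \<in> borel_measurable (?P ?I \<Otimes>\<^sub>M lborel)"
        by simp
    qed
    then show "(\<lambda>x. \<integral>\<^sup>+y. f (x(k := \<beta> (x(k := y)) + c * y)) \<partial>lborel) \<in> borel_measurable (?P ?I)" by simp
  qed
  also have "(\<integral>\<^sup>+x. (\<integral>\<^sup>+y. f (x(k := \<beta> (x(k := y)) + c * y)) \<partial>lborel) \<partial>?P ?I) = (\<integral>\<^sup>+p. f (p(k := \<beta> p + c * p k)) \<partial>lborel_coord m)"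
    using lborel_family.product_nn_integral_insert[OF I fTm] unfolding ins lborel_coord_def by simp
  finally show ?thesis .
qed

definition linmap :: "nat \<Rightarrow> (nat \<Rightarrow> nat \<Rightarrow> real) \<Rightarrow> (nat \<Rightarrow> real) \<Rightarrow> nat \<Rightarrow> real" where
  "linmap m A p = (\<lambda>i\<in>{..<m}. \<Sum>j<m. A i j * p j)"

text \<open>Measurability of the image is part of the notion, since images rather than preimages are
  measured and the property must survive composition.\<close>

definition scales_volume :: "nat \<Rightarrow> (nat \<Rightarrow> nat \<Rightarrow> real) \<Rightarrow> bool" where
  "scales_volume m A \<longleftrightarrow> (\<forall>S\<in>sets (lborel_coord m). linmap m A ` S \<in> sets (lborel_coord m) \<and>
     emeasure (lborel_coord m) (linmap m A ` S) = ennreal \<bar>fdet m A\<bar> * emeasure (lborel_coord m) S)"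

lemma linmap_cong: "(\<And>i j. i < m \<Longrightarrow> j < m \<Longrightarrow> A i j = B i j) \<Longrightarrow> linmap m A = linmap m B"
  unfolding linmap_def by (intro ext restrict_ext sum.cong) auto

lemma scales_volume_cong:
  "(\<And>i j. i < m \<Longrightarrow> j < m \<Longrightarrow> A i j = B i j) \<Longrightarrow> scales_volume m A \<longleftrightarrow> scales_volume m B"
  unfolding scales_volume_def using linmap_cong[of m A B] fdet_cong[of m A B] by simp

lemma linmap_mult: "linmap m A (linmap m B p) = linmap m (\<lambda>i j. \<Sum>k<m. A i k * B k j) p"
  unfolding linmap_def
proof (rule restrict_ext)
  fix i assume "i \<in> {..<m}"
  have "(\<Sum>k<m. A i k * (\<Sum>j<m. B k j * p j)) = (\<Sum>k<m. \<Sum>j<m. A i k * B k j * p j)"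
    by (simp add: sum_distrib_left mult.assoc)
  also have "\<dots> = (\<Sum>j<m. (\<Sum>k<m. A i k * B k j) * p j)"
    unfolding sum_distrib_right by (rule sum.swap)
  finally show "(\<Sum>j<m. A i j * (\<lambda>i\<in>{..<m}. \<Sum>j<m. B i j * p j) j) = (\<Sum>j<m. (\<Sum>k<m. A i k * B k j) * p j)"
    by simp
qed

lemma scales_volume_mult:
  assumes "scales_volume m A" "scales_volume m B"
  shows "scales_volume m (\<lambda>i j. \<Sum>k<m. A i k * B k j)"
  unfolding scales_volume_def
proof (intro ballI)
  fix S assume S: "S \<in> sets (lborel_coord m)"
  have "linmap m (\<lambda>i j. \<Sum>k<m. A i k * B k j) ` S = linmap m A ` (linmap m B ` S)"
    by (simp add: image_image linmap_mult)
  then show "linmap m (\<lambda>i j. \<Sum>k<m. A i k * B k j) ` S \<in> sets (lborel_coord m) \<and>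
      emeasure (lborel_coord m) (linmap m (\<lambda>i j. \<Sum>k<m. A i k * B k j) ` S) =
      ennreal \<bar>fdet m (\<lambda>i j. \<Sum>k<m. A i k * B k j)\<bar> * emeasure (lborel_coord m) S"
    using assms S unfolding scales_volume_def fdet_mult
    by (simp add: abs_mult ennreal_mult mult.assoc)
qed

text \<open>The elementary matrices of the elimination: \<open>rowmat k r\<close> changes coordinate
  k only, and combines a scaling of this coordinate with a shear along all the others.\<close>

definition rowmat :: "nat \<Rightarrow> (nat \<Rightarrow> real) \<Rightarrow> nat \<Rightarrow> nat \<Rightarrow> real" where
  "rowmat k r = (\<lambda>i j. if i = k then r j else if i = j then 1 else 0)"

lemma fdet_rowmat: "k < m \<Longrightarrow> fdet m (rowmat k r) = r k"
proof -
  assume k: "k < m"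
  let ?E = "\<lambda>i j. if i = j then 1 else 0 :: real"
  have "fcof m ?E k j = (if j = k then 1 else 0)" if "j < m" for j
    using fmat_adj(1)[OF that k, of ?E] by (simp add: fdet_one sum_delta_left that)
  moreover have "fdet m (rowmat k r) = (\<Sum>j<m. rowmat k r k j * fcof m ?E k j)"
    by (rule fdet_row[OF k]) (simp add: rowmat_def)
  ultimately show ?thesis using k by (simp add: rowmat_def sum_delta_right cong: if_cong)
qed

lemma mult_rowmat:
  assumes "k < m" "l < m"
  shows "(\<Sum>t<m. B i t * rowmat k r t l) = B i k * r l + (if l = k then 0 else B i l)"
proof -
  have "(\<Sum>t<m. B i t * rowmat k r t l) = B i k * rowmat k r k l + (\<Sum>t\<in>{..<m}-{k}. B i t * rowmat k r t l)"
    by (rule sum.remove) (use assms in auto)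
  also have "(\<Sum>t\<in>{..<m}-{k}. B i t * rowmat k r t l) = (\<Sum>t\<in>{..<m}-{k}. if t = l then B i l else 0)"
    by (rule sum.cong) (auto simp: rowmat_def)
  also have "\<dots> = (if l = k then 0 else B i l)" using assms by (simp add: sum.delta)
  finally show ?thesis by (simp add: rowmat_def)
qed

lemma linmap_rowmat:
  assumes "k < m" "p \<in> cs m"
  shows "linmap m (rowmat k r) p = p(k := (\<Sum>j<m. r j * p j))"
proof
  fix i
  show "linmap m (rowmat k r) p i = (p(k := (\<Sum>j<m. r j * p j))) i"
    using assms
    by (cases "i < m") (auto simp: linmap_def rowmat_def sum_delta_left PiE_iff extensional_def)
qed

lemma linmap_cs: "linmap m A p \<in> cs m"
  by (simp add: linmap_def)

lemma linmap_id:
  assumes "p \<in> cs m" "\<And>i j. i < m \<Longrightarrow> j < m \<Longrightarrow> A i j = (if i = j then 1 else 0)"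
  shows "linmap m A p = p"
  using assms by (auto simp: linmap_def fun_eq_iff sum_delta_left PiE_iff extensional_def)

text \<open>The inverse is again of this shape. The image is therefore a preimage under a map that
  changes one coordinate affinely, and the one-coordinate substitution applies to this inverse with
  factor \<open>1 / r k\<close>.\<close>

lemma scales_volume_rowmat:
  assumes k: "k < m" and r: "r k \<noteq> 0"
  shows "scales_volume m (rowmat k r)"
  unfolding scales_volume_def
proof (intro ballI)
  fix S assume S: "S \<in> sets (lborel_coord m)"
  \<comment> \<open>Row k of the inverse, from solving y_k = sum_j r_j p_j for p_k.\<close>
  define r' where "r' = (\<lambda>j. if j = k then 1 / r k else - r j / r k)"
  define T where "T = linmap m (rowmat k r)"
  define T' where "T' = linmap m (rowmat k r')"
  have TT': "T (T' p) = p" "T' (T p) = p" if "p \<in> cs m" for p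
    unfolding T_def T'_def linmap_mult
    by (rule linmap_id[OF that]; use k r in \<open>simp add: mult_rowmat; simp add: rowmat_def r'_def\<close>)+
  have Ssub: "S \<subseteq> cs m" using sets.sets_into_space[OF S] by simp
  have img: "T ` S = T' -` S \<inter> cs m"
  proof
    have "T p \<in> cs m" for p unfolding T_def by (rule linmap_cs)
    then show "T ` S \<subseteq> T' -` S \<inter> cs m" using TT' Ssub by (auto simp del: PiE_UNIV_domain)
    show "T' -` S \<inter> cs m \<subseteq> T ` S"
    proof
      fix p assume "p \<in> T' -` S \<inter> cs m"
      then have "T' p \<in> S" "p = T (T' p)" using TT' by auto
      then show "p \<in> T ` S" by blast
    qed
  qed
  define \<beta> where "\<beta> p = (\<Sum>j\<in>{..<m}-{k}. r' j * p j)" for p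
  have T'eq: "T' p = p(k := \<beta> p + 1 / r k * p k)" if "p \<in> cs m" for p
  proof -
    have "(\<Sum>j<m. r' j * p j) = \<beta> p + 1 / r k * p k"
      using k by (subst sum.remove[of _ k]) (auto simp: \<beta>_def r'_def)
    then show ?thesis using linmap_rowmat[OF k that] by (simp add: T'_def)
  qed
  have T'm: "T' \<in> measurable (lborel_coord m) (lborel_coord m)"
    by (rule measurable_into_coord) (auto simp: T'_def linmap_cs, auto simp: linmap_def)
  show "T ` S \<in> sets (lborel_coord m) \<and> emeasure (lborel_coord m) (T ` S) =
     ennreal \<bar>fdet m (rowmat k r)\<bar> * emeasure (lborel_coord m) S" (is "?A \<and> ?B")
  proof
    show ?A using measurable_sets[OF T'm S] by (simp add: img)
    have "\<beta> \<in> borel_measurable (lborel_coord m)" unfolding \<beta>_def by measurable auto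
    note \<beta>m = this
    have "(\<integral>\<^sup>+p. indicator S p \<partial>lborel_coord m) =
      ennreal \<bar>1 / r k\<bar> * (\<integral>\<^sup>+p. indicator S (p(k := \<beta> p + 1 / r k * p k)) \<partial>lborel_coord m)"
      by (rule nn_integral_coordinate_affine[OF k]) (use r S \<beta>m in \<open>auto simp: \<beta>_def intro!: sum.cong\<close>)
    also have "(\<integral>\<^sup>+p. indicator S (p(k := \<beta> p + 1 / r k * p k)) \<partial>lborel_coord m) = (\<integral>\<^sup>+p. indicator (T ` S) p \<partial>lborel_coord m)"
    proof (rule nn_integral_cong)
      fix p assume "p \<in> space (lborel_coord m)"
      then have p: "p \<in> cs m" by simp
      have "p \<in> T ` S \<longleftrightarrow> T' p \<in> S" using p unfolding img by blast
      then show "(indicator S (p(k := \<beta> p + 1 / r k * p k)) :: ennreal) = indicator (T ` S) p"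
        unfolding T'eq[OF p, symmetric] indicator_def by simp
    qed
    finally have "emeasure (lborel_coord m) S = ennreal \<bar>1 / r k\<bar> * emeasure (lborel_coord m) (T ` S)"
      using S \<open>?A\<close> by simp
    then have "ennreal \<bar>r k\<bar> * emeasure (lborel_coord m) S = (ennreal \<bar>r k\<bar> * ennreal \<bar>1 / r k\<bar>) * emeasure (lborel_coord m) (T ` S)"
      by (simp add: mult.assoc)
    also have "ennreal \<bar>r k\<bar> * ennreal \<bar>1 / r k\<bar> = 1"
      using r by (simp add: ennreal_mult[symmetric] abs_mult[symmetric] del: abs_divide)
    finally show ?B by (simp add: fdet_rowmat[OF k])
  qed
qed

text \<open>Elimination by columns: multiplying from the right by inverse row operations turns the rows of
  an invertible matrix, one after the other, into unit vectors.\<close>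

lemma scales_volume_invertible:
  assumes "fdet m A \<noteq> 0"
  shows "scales_volume m A"
proof -
  have "\<forall>A::nat \<Rightarrow> nat \<Rightarrow> real. fdet m A \<noteq> 0 \<and> (\<forall>i<k. \<forall>j<m. A i j = (if i = j then 1 else 0)) \<longrightarrow> scales_volume m A" if "k \<le> m" for k
    using that
  proof (induction k rule: inc_induct)
    case base
    show ?case
    proof (intro allI impI, elim conjE)
      fix A :: "nat \<Rightarrow> nat \<Rightarrow> real" assume A: "\<forall>i<m. \<forall>j<m. A i j = (if i = j then 1 else 0)"
      have "linmap m A ` S = S" if "S \<in> sets (lborel_coord m)" for S
      proof -
        have "linmap m A p = p" if "p \<in> S" for p
          by (rule linmap_id) (use that sets.sets_into_space[OF \<open>S \<in> _\<close>] A in \<open>auto simp del: PiE_UNIV_domain\<close>)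
        then show ?thesis by simp
      qed
      moreover have "fdet m A = 1" using A fdet_cong[of m A "\<lambda>i j. if i = j then 1 else 0"] fdet_one by simp
      ultimately show "scales_volume m A" by (simp add: scales_volume_def)
    qed
  next
    case (step k)
    have pivot: "scales_volume m A" if A: "fdet m A \<noteq> 0" "\<forall>i<k. \<forall>j<m. A i j = (if i = j then 1 else 0)" "A k k \<noteq> 0" for A
    proof -
      \<comment> \<open>Column operations clear row k with the pivot \<open>A k k\<close>: A' is A
        times the inverse of \<open>rowmat k (A k)\<close>. Rows above k have a zero in column k and
        so remain unit vectors.\<close>
      define A' where "A' = (\<lambda>i j. if j = k then A i k / A k k else A i j - A i k * A k j / A k k)"
      have eq: "A i j = (\<Sum>t<m. A' i t * rowmat k (A k) t j)" if "i < m" "j < m" for i j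
        unfolding mult_rowmat[OF step(2) that(2), of A' i "A k"] using A(3) by (simp add: A'_def)
      have "fdet m A = fdet m A' * fdet m (rowmat k (A k))"
        unfolding fdet_mult[symmetric] by (rule fdet_cong) (rule eq)
      then have "fdet m A' \<noteq> 0" using A(1) by auto
      moreover have "\<forall>i<Suc k. \<forall>j<m. A' i j = (if i = j then 1 else 0)"
        using A(2,3) step(2) by (auto simp: A'_def less_Suc_eq)
      ultimately have "scales_volume m A'" using step.IH by blast
      moreover have "scales_volume m (rowmat k (A k))" by (rule scales_volume_rowmat) (use step(2) A in auto)
      ultimately have "scales_volume m (\<lambda>i j. \<Sum>t<m. A' i t * rowmat k (A k) t j)" by (rule scales_volume_mult)
      then show ?thesis using scales_volume_cong[of m A, OF eq] by blast
    qed
    show ?case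
    proof (intro allI impI, elim conjE)
      fix A assume A: "fdet m A \<noteq> 0" "\<forall>i<k. \<forall>j<m. A i j = (if i = j then 1 else 0)"
      show "scales_volume m A"
      proof (cases "A k k = 0")
        case True
        \<comment> \<open>The pivot vanishes. For j < k, row j is a unit vector and is orthogonal to
          the cofactors of row k, so the j-th of these is 0. As the determinant is nonzero, row k
          has a nonzero entry to the right of column k, and adding that column to column k creates a
          pivot.\<close>
        have c0: "fcof m A k j = 0" if "j < k" for j
        proof -
          have "(\<Sum>l<m. A j l * fcof m A k l) = fcof m A k j"
            using A(2) that step(2) by (simp add: sum_delta_left)
          then show ?thesis using fmat_adj(1)[of j m k A] that step(2) by simp
        qed
        have "(\<Sum>j<m. A k j * fcof m A k j) \<noteq> 0"
          using fmat_adj(1)[of k m k A] step(2) A(1) by simp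
        then obtain j where j: "j < m" "A k j * fcof m A k j \<noteq> 0"
          by (meson lessThan_iff sum.neutral)
        then have jk: "k < j" "A k j \<noteq> 0" using c0[of j] True by (auto simp: not_less_iff_gr_or_eq intro: linorder_cases[of k j])
        define B where "B = (\<lambda>i l. A i l + (if l = k then A i j else 0))"
        define r where "r = (\<lambda>l. if l = j then 1 else if l = k then -1 else 0 :: real)"
        have eq: "A i l = (\<Sum>t<m. B i t * rowmat j r t l)" if "i < m" "l < m" for i l
          unfolding mult_rowmat[OF j(1) that(2), of B i r] using jk by (simp add: B_def r_def)
        have "fdet m A = fdet m B * fdet m (rowmat j r)"
          unfolding fdet_mult[symmetric] by (rule fdet_cong) (rule eq)
        then have "fdet m B \<noteq> 0" using A(1) by auto
        moreover have "\<forall>i<k. \<forall>l<m. B i l = (if i = l then 1 else 0)"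
          using A(2) jk j by (auto simp: B_def)
        moreover have "B k k \<noteq> 0" using True jk by (simp add: B_def)
        ultimately have "scales_volume m B" by (rule pivot)
        moreover have "scales_volume m (rowmat j r)" by (rule scales_volume_rowmat) (use j in \<open>auto simp: r_def\<close>)
        ultimately have "scales_volume m (\<lambda>i l. \<Sum>t<m. B i t * rowmat j r t l)" by (rule scales_volume_mult)
        then show ?thesis using scales_volume_cong[of m A, OF eq] by blast
      qed (use A pivot in blast)
    qed
  qed
  from this[of 0] show ?thesis using assms by simp
qed

definition shift :: "nat \<Rightarrow> (nat \<Rightarrow> real) \<Rightarrow> (nat \<Rightarrow> real) \<Rightarrow> nat \<Rightarrow> real" where
  "shift m c p = (\<lambda>i\<in>{..<m}. p i + c i)"

text \<open>One coordinate at a time: \<open>s k\<close> has translated the first k of them, and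
  each further step is an affine substitution with factor 1.\<close>

lemma nn_integral_shift:
  assumes f: "f \<in> borel_measurable (lborel_coord m)"
  shows "(\<integral>\<^sup>+p. f (shift m c p) \<partial>lborel_coord m) = (\<integral>\<^sup>+p. f p \<partial>lborel_coord m)"
proof -
  define s where "s k p = (\<lambda>i. if i < k then p i + c i else p i)" for k :: nat and p :: "nat \<Rightarrow> real"
  have sm: "s k \<in> measurable (lborel_coord m) (lborel_coord m)" if "k \<le> m" for k
  proof (rule measurable_into_coord)
    show "(\<lambda>p. s k p i) \<in> borel_measurable (lborel_coord m)" if "i < m" for i
      using that by (cases "i < k") (auto simp: s_def)
    show "s k p \<in> cs m" if "p \<in> space (lborel_coord m)" for p
      using that \<open>k \<le> m\<close> by (auto simp: s_def PiE_iff extensional_def)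
  qed
  have "(\<integral>\<^sup>+p. f (s k p) \<partial>lborel_coord m) = (\<integral>\<^sup>+p. f p \<partial>lborel_coord m)" if "k \<le> m" for k
    using that
  proof (induction k)
    case (Suc k)
    have "(\<integral>\<^sup>+p. f (s k p) \<partial>lborel_coord m) = ennreal \<bar>1\<bar> * (\<integral>\<^sup>+p. f (s k (p(k := c k + 1 * p k))) \<partial>lborel_coord m)"
      by (rule nn_integral_coordinate_affine) (use Suc.prems measurable_compose[OF sm f] in auto)
    moreover have "s k (p(k := c k + 1 * p k)) = s (Suc k) p" for p
      by (auto simp: s_def fun_eq_iff less_Suc_eq)
    ultimately show ?case using Suc by simp
  qed (simp add: s_def)
  moreover have "shift m c p = s m p" if "p \<in> cs m" for p
    using that by (auto simp: shift_def s_def PiE_iff extensional_def)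
  ultimately show ?thesis
    using nn_integral_cong[of "lborel_coord m" "\<lambda>p. f (shift m c p)" "\<lambda>p. f (s m p)"] by simp
qed

lemma shift_image:
  assumes S: "S \<in> sets (lborel_coord m)"
  shows "shift m c ` S \<in> sets (lborel_coord m)" "emeasure (lborel_coord m) (shift m c ` S) = emeasure (lborel_coord m) S"
proof -
  let ?s = "shift m c" and ?s' = "shift m (\<lambda>i. - c i)"
  have ss: "?s (?s' p) = p" "?s' (?s p) = p" if "p \<in> cs m" for p
    using that by (auto simp: shift_def fun_eq_iff PiE_iff extensional_def)
  have Ssub: "S \<subseteq> cs m" using sets.sets_into_space[OF S] by simp
  have img: "?s ` S = ?s' -` S \<inter> cs m"
  proof
    have "?s p \<in> cs m" for p by (simp add: shift_def)
    then show "?s ` S \<subseteq> ?s' -` S \<inter> cs m" using ss Ssub by auto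
    show "?s' -` S \<inter> cs m \<subseteq> ?s ` S"
    proof
      fix p assume "p \<in> ?s' -` S \<inter> cs m"
      then have "?s' p \<in> S" "p = ?s (?s' p)" using ss by auto
      then show "p \<in> ?s ` S" by blast
    qed
  qed
  have "?s' \<in> measurable (lborel_coord m) (lborel_coord m)"
    by (rule measurable_into_coord) (auto simp: shift_def)
  from measurable_sets[OF this S] show 1: "?s ` S \<in> sets (lborel_coord m)" by (simp add: img)
  have "emeasure (lborel_coord m) (?s ` S) = (\<integral>\<^sup>+p. indicator (?s ` S) p \<partial>lborel_coord m)" using 1 by simp
  also have "\<dots> = (\<integral>\<^sup>+p. indicator S (?s' p) \<partial>lborel_coord m)"
    by (rule nn_integral_cong) (auto simp: img indicator_def)
  also have "\<dots> = (\<integral>\<^sup>+p. indicator S p \<partial>lborel_coord m)" by (rule nn_integral_shift) (use S in simp)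
  finally show "emeasure (lborel_coord m) (?s ` S) = emeasure (lborel_coord m) S" using S by simp
qed

lemma compactin_kbox: "compactin (coord_space m) (kbox m a b)"
  unfolding kbox_def by (subst compactin_PiE) (auto simp: compactin_euclidean_iff)

lemma cont_on_coord_bounded:
  assumes K: "compactin (coord_space m) K" "K \<subseteq> V" and h: "cont_on_coord m V h"
  shows "\<exists>B\<ge>0. \<forall>p\<in>K. \<bar>h p\<bar> \<le> B"
proof -
  have "compactin (subtopology (coord_space m) V) K"
    using K by (simp add: compactin_subtopology)
  from image_compactin[OF this h] have "compact (h ` K)" by (simp add: compactin_euclidean_iff)
  then obtain B where "\<forall>x\<in>h ` K. norm x \<le> B" using compact_imp_bounded bounded_iff by metis
  then have "\<forall>p\<in>K. \<bar>h p\<bar> \<le> max B 0" by auto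
  then show ?thesis by (intro exI[of _ "max B 0"]) auto
qed

section \<open>Change of variables\<close>

text \<open>The side lengths are a fixed shape l times a scale s. All boxes of a bisection have the
  same shape, so the error constants of the linear approximation do not deteriorate.\<close>

definition grid_box :: "nat \<Rightarrow> (nat \<Rightarrow> real) \<Rightarrow> real \<Rightarrow> (nat \<Rightarrow> real) \<Rightarrow> (nat \<Rightarrow> real) set" where
  "grid_box m l s a = hbox m a (\<lambda>i. a i + s * l i)"

text \<open>A box is the disjoint union of 2^m boxes of half the scale. If none of them violated the
  inequality, summation would contradict the violation on the whole box.\<close>

lemma grid_box_halve:
  fixes N E :: "(nat \<Rightarrow> real) measure"
  assumes l: "\<And>i. i < m \<Longrightarrow> l i > 0" and s: "s > 0"
    and N: "sets N = sets (restrict_space (lborel_coord m) U)" and E: "sets E = sets (restrict_space (lborel_coord m) U)"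
    and U: "U \<in> sets (lborel_coord m)" "grid_box m l s a \<subseteq> U"
    and gt: "emeasure N (grid_box m l s a) > c * emeasure E (grid_box m l s a)"
  shows "\<exists>a'. (\<forall>i<m. a i \<le> a' i \<and> a' i + s / 2 * l i \<le> a i + s * l i) \<and>
    emeasure N (grid_box m l (s/2) a') > c * emeasure E (grid_box m l (s/2) a')"
proof (rule ccontr)
  assume neg: "\<not> ?thesis"
  \<comment> \<open>Subsets of the coordinates index the small boxes: \<sigma> collects the
    coordinates in which the upper half is taken.\<close>
  define \<alpha> where "\<alpha> \<sigma> = (\<lambda>i. if i \<in> \<sigma> then a i + s / 2 * l i else a i)" for \<sigma> :: "nat set"
  define G where "G \<sigma> = grid_box m l (s/2) (\<alpha> \<sigma>)" for \<sigma>
  have sl: "s * l i > 0" if "i < m" for i using l[OF that] s by simp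
  have le: "emeasure N (G \<sigma>) \<le> c * emeasure E (G \<sigma>)" for \<sigma>
  proof -
    have "\<forall>i<m. a i \<le> \<alpha> \<sigma> i \<and> \<alpha> \<sigma> i + s / 2 * l i \<le> a i + s * l i"
      using sl by (auto simp: \<alpha>_def less_imp_le)
    then have "\<not> c * emeasure E (G \<sigma>) < emeasure N (G \<sigma>)" using neg unfolding G_def by blast
    then show ?thesis by simp
  qed
  have un: "grid_box m l s a = (\<Union>\<sigma>\<in>Pow {..<m}. G \<sigma>)"
  proof
    show "grid_box m l s a \<subseteq> (\<Union>\<sigma>\<in>Pow {..<m}. G \<sigma>)"
    proof
      fix p assume p: "p \<in> grid_box m l s a"
      have "p \<in> G {i. i < m \<and> a i + s / 2 * l i \<le> p i}"
        using p unfolding G_def grid_box_def hbox_iff \<alpha>_def by (auto simp: not_le)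
      then show "p \<in> (\<Union>\<sigma>\<in>Pow {..<m}. G \<sigma>)" by (intro UN_I) auto
    qed
    show "(\<Union>\<sigma>\<in>Pow {..<m}. G \<sigma>) \<subseteq> grid_box m l s a"
    proof
      fix p assume "p \<in> (\<Union>\<sigma>\<in>Pow {..<m}. G \<sigma>)"
      then obtain \<sigma> where \<sigma>: "p \<in> G \<sigma>" by (rule UN_E)
      have "a i \<le> p i \<and> p i < a i + s * l i" if "i < m" for i
      proof -
        have "\<alpha> \<sigma> i \<le> p i \<and> p i < \<alpha> \<sigma> i + s / 2 * l i" using \<sigma> that by (auto simp: G_def grid_box_def hbox_iff)
        then show ?thesis using sl[OF that] by (auto simp: \<alpha>_def split: if_splits)
      qed
      then show "p \<in> grid_box m l s a" using \<sigma> by (auto simp: G_def grid_box_def hbox_iff)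
    qed
  qed
  have disj: "disjoint_family_on G (Pow {..<m})"
    unfolding disjoint_family_on_def
  proof (intro ballI impI)
    fix \<sigma> \<tau> assume st: "\<sigma> \<in> Pow {..<m}" "\<tau> \<in> Pow {..<m}" "\<sigma> \<noteq> \<tau>"
    then obtain i where i: "i < m" "i \<in> \<sigma> \<longleftrightarrow> i \<notin> \<tau>" by blast
    show "G \<sigma> \<inter> G \<tau> = {}"
    proof (rule ccontr)
      assume "G \<sigma> \<inter> G \<tau> \<noteq> {}"
      then obtain p where "p \<in> G \<sigma>" "p \<in> G \<tau>" by auto
      then have "\<alpha> \<sigma> i \<le> p i \<and> p i < \<alpha> \<sigma> i + s / 2 * l i" "\<alpha> \<tau> i \<le> p i \<and> p i < \<alpha> \<tau> i + s / 2 * l i"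
        using i by (auto simp: G_def grid_box_def hbox_iff)
      then show False using i by (auto simp: \<alpha>_def split: if_splits)
    qed
  qed
  have GS: "G \<sigma> \<in> sets (restrict_space (lborel_coord m) U)" if "\<sigma> \<in> Pow {..<m}" for \<sigma>
  proof -
    have "U \<subseteq> cs m" using sets.sets_into_space[OF U(1)] by simp
    moreover have "G \<sigma> \<subseteq> U" using U(2) that unfolding un by (simp add: UN_subset_iff)
    moreover have "G \<sigma> \<in> sets (lborel_coord m)" by (simp add: G_def grid_box_def)
    ultimately show ?thesis using U(1) by (subst sets_restrict_space_iff) (auto simp: Int_absorb2)
  qed
  have fin: "finite (Pow {..<m})" by simp
  have "emeasure N (grid_box m l s a) = (\<Sum>\<sigma>\<in>Pow {..<m}. emeasure N (G \<sigma>))"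
    unfolding un using GS N by (intro sum_emeasure[symmetric] disj fin) auto
  also have "\<dots> \<le> (\<Sum>\<sigma>\<in>Pow {..<m}. c * emeasure E (G \<sigma>))" by (intro sum_mono le)
  also have "\<dots> = c * (\<Sum>\<sigma>\<in>Pow {..<m}. emeasure E (G \<sigma>))" by (simp add: sum_distrib_left)
  also have "(\<Sum>\<sigma>\<in>Pow {..<m}. emeasure E (G \<sigma>)) = emeasure E (grid_box m l s a)"
    unfolding un using GS E by (intro sum_emeasure disj fin) auto
  finally show False using gt by simp
qed

text \<open>A violation survives in nested boxes of scale 2^-n, which shrink to a point z where the
  local hypothesis forbids it. The bound s0 may depend on z, so the hypothesis is purely
  local.\<close>

lemma grid_box_comparison:
  fixes N E :: "(nat \<Rightarrow> real) measure"
  assumes l: "\<And>i. i < m \<Longrightarrow> l i > 0"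
    and N: "sets N = sets (restrict_space (lborel_coord m) U)" and E: "sets E = sets (restrict_space (lborel_coord m) U)"
    and U: "U \<in> sets (lborel_coord m)" "kbox m a (\<lambda>i. a i + l i) \<subseteq> U"
    and loc: "\<And>z. z \<in> U \<Longrightarrow> \<exists>s0>0. \<forall>s a. 0 < s \<and> s < s0 \<and> (\<forall>i<m. a i \<le> z i \<and> z i \<le> a i + s * l i) \<longrightarrow>
       emeasure N (grid_box m l s a) \<le> c * emeasure E (grid_box m l s a)"
  shows "emeasure N (grid_box m l 1 a) \<le> c * emeasure E (grid_box m l 1 a)"
proof (rule ccontr)
  assume neg: "\<not> ?thesis"
  let ?s = "\<lambda>n. 1 / 2 ^ n :: real"
  define P where "P n a' \<longleftrightarrow> (\<forall>i<m. a i \<le> a' i \<and> a' i + ?s n * l i \<le> a i + l i) \<and>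
     c * emeasure E (grid_box m l (?s n) a') < emeasure N (grid_box m l (?s n) a')" for n a'
  have "\<exists>f. \<forall>n. P n (f n) \<and> (\<forall>i<m. f n i \<le> f (Suc n) i \<and> f (Suc n) i + ?s (Suc n) * l i \<le> f n i + ?s n * l i)"
  proof (rule dependent_nat_choice)
    show "\<exists>x. P 0 x" using neg by (intro exI[of _ a]) (auto simp: P_def)
    fix x n assume x: "P n x"
    have "grid_box m l (?s n) x \<subseteq> U"
    proof
      fix p assume p: "p \<in> grid_box m l (?s n) x"
      then have "p \<in> kbox m a (\<lambda>i. a i + l i)"
        using x unfolding P_def grid_box_def hbox_iff kbox_iff by (smt (verit))
      then show "p \<in> U" using U by blast
    qed
    from grid_box_halve[where l = l, OF l _ N E U(1) this, of c] x
    obtain y where y: "\<forall>i<m. x i \<le> y i \<and> y i + ?s n / 2 * l i \<le> x i + ?s n * l i"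
      "c * emeasure E (grid_box m l (?s n / 2) y) < emeasure N (grid_box m l (?s n / 2) y)"
      unfolding P_def by auto
    have s2: "?s n / 2 = ?s (Suc n)" by simp
    have "P (Suc n) y"
      using x y(2) y(1) unfolding P_def s2 by (smt (verit))
    then show "\<exists>y. P (Suc n) y \<and> (\<forall>i<m. x i \<le> y i \<and> y i + ?s (Suc n) * l i \<le> x i + ?s n * l i)"
      using y(1) unfolding s2 by blast
  qed
  then obtain f where f: "\<And>n. P n (f n)"
    "\<And>n i. i < m \<Longrightarrow> f n i \<le> f (Suc n) i \<and> f (Suc n) i + ?s (Suc n) * l i \<le> f n i + ?s n * l i" by blast
  have inc: "f n i \<le> f k i" if "n \<le> k" "i < m" for n k i
    using f(2)[OF that(2)] by (intro lift_Suc_mono_le[of "\<lambda>n. f n i", OF _ that(1)]) blast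
  have dec: "f k i + ?s k * l i \<le> f n i + ?s n * l i" if "n \<le> k" "i < m" for n k i
    using f(2)[OF that(2)] by (intro lift_Suc_antimono_le[of "\<lambda>n. f n i + ?s n * l i", OF _ that(1)]) blast
  have cross: "f n i \<le> f k i + ?s k * l i" if "i < m" for n k i
  proof -
    have "f n i \<le> f (max n k) i" using inc that by simp
    also have "\<dots> \<le> f (max n k) i + ?s (max n k) * l i" using l[OF that] by simp
    also have "\<dots> \<le> f k i + ?s k * l i" using dec that by simp
    finally show ?thesis .
  qed
  \<comment> \<open>The limit point is the coordinatewise supremum of the lower corners. It lies in
    every closed box but may miss the half-open ones; this is why the local hypothesis has weak
    inequalities and why the closed box is assumed to lie in U.\<close>
  define z where "z = (\<lambda>i\<in>{..<m}. SUP n. f n i)"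
  have z: "f n i \<le> z i \<and> z i \<le> f n i + ?s n * l i" if "i < m" for n i
  proof -
    have "bdd_above (range (\<lambda>n. f n i))" using cross[OF that, of _ 0] by (intro bdd_aboveI2) blast
    then have "f n i \<le> (SUP n. f n i)" by (intro cSUP_upper) auto
    moreover have "(SUP n. f n i) \<le> f n i + ?s n * l i" using cross[OF that] by (intro cSUP_least) auto
    ultimately show ?thesis using that by (simp add: z_def)
  qed
  have "z \<in> kbox m a (\<lambda>i. a i + l i)"
    unfolding kbox_iff
  proof (intro conjI allI impI)
    fix i assume i: "i < m"
    have "a i \<le> f 0 i" "f 0 i + l i \<le> a i + l i" using f(1)[of 0] i unfolding P_def by auto
    then show "a i \<le> z i" "z i \<le> a i + l i" using z[OF i, of 0] by auto
  qed (simp add: z_def)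
  then have "z \<in> U" using U by blast
  then obtain s0 where s0: "s0 > 0" "\<And>s a. 0 < s \<Longrightarrow> s < s0 \<Longrightarrow> (\<forall>i<m. a i \<le> z i \<and> z i \<le> a i + s * l i) \<Longrightarrow>
       emeasure N (grid_box m l s a) \<le> c * emeasure E (grid_box m l s a)"
    using loc[OF \<open>z \<in> U\<close>] by blast
  obtain n where n: "?s n < s0"
    using s0(1) real_arch_pow_inv[of s0 "1/2"] by (auto simp: power_one_over)
  have "emeasure N (grid_box m l (?s n) (f n)) \<le> c * emeasure E (grid_box m l (?s n) (f n))"
    by (rule s0(2)) (use n z in auto)
  then show False using f(1)[of n] unfolding P_def by auto
qed

lemma C1_family_linear_approx:
  assumes V: "openin (coord_space m) V" and h: "\<And>k. k < m \<Longrightarrow> C1 m V (\<lambda>p. h p k)" and p: "p \<in> V" and e: "e > 0"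
  shows "\<exists>d>0. \<forall>q\<in>cs m. near m d p q \<longrightarrow> q \<in> V \<and> (\<forall>k<m.
    \<bar>h q k - h p k - (\<Sum>i<m. partial_deriv i (\<lambda>p. h p k) p * (q i - p i))\<bar> \<le> e * (\<Sum>i<m. \<bar>q i - p i\<bar>))"
proof -
  let ?R = "\<lambda>k q. \<bar>h q k - h p k - (\<Sum>i<m. partial_deriv i (\<lambda>p. h p k) p * (q i - p i))\<bar> \<le> e * (\<Sum>i<m. \<bar>q i - p i\<bar>)"
  obtain d0 where d0: "d0 > 0" "\<forall>q\<in>cs m. near m d0 p q \<longrightarrow> q \<in> V" using V p unfolding openin_coord by blast
  have "\<forall>\<^sub>F d in at_right (0::real). \<forall>q\<in>cs m. near m d p q \<longrightarrow> ?R k q" if "k \<in> {..<m}" for k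
  proof -
    have "k < m" using that by simp
    from C1_linear_approx[OF V h[OF this] p e]
    obtain d where d: "d > 0" "\<forall>q\<in>cs m. near m d p q \<longrightarrow> q \<in> V \<and> ?R k q"
      by (elim exE conjE)
    have "?R k q" if "q \<in> cs m" "near m y p q" "y < d" for y q
      using d(2) near_mono[OF that(2) less_imp_le[OF that(3)]] that(1) by simp
    then show ?thesis
      unfolding eventually_at_right_field using d(1) by (intro exI[of _ d] conjI allI impI ballI)
  qed
  then have "\<forall>\<^sub>F d in at_right (0::real). \<forall>k\<in>{..<m}. \<forall>q\<in>cs m. near m d p q \<longrightarrow> ?R k q"
    by (intro eventually_ball_finite) auto
  then obtain d1 where d1: "d1 > 0" "\<And>d. 0 < d \<Longrightarrow> d < d1 \<Longrightarrow> \<forall>k\<in>{..<m}. \<forall>q\<in>cs m. near m d p q \<longrightarrow> ?R k q"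
    unfolding eventually_at_right_field by force
  define d where "d = min d0 (d1 / 2)"
  have "d > 0" "d < d1" "d \<le> d0" using d0 d1(1) by (auto simp: d_def)
  show ?thesis
  proof (intro exI[of _ d] conjI allI impI ballI)
    fix q assume q: "q \<in> cs m" "near m d p q"
    show "q \<in> V" using d0(2) q near_mono[OF q(2) \<open>d \<le> d0\<close>] by simp
    show "?R k q" if "k < m" for k using d1(2)[OF \<open>d > 0\<close> \<open>d < d1\<close>] q that by simp
  qed (fact \<open>d > 0\<close>)
qed

text \<open>Transition maps of an atlas come with a C1 inverse, so the inverse is part of the data.
  Through the chain rule it gives invertibility of the Jacobian, and in the lower volume estimate it
  takes the place of an inverse function theorem.\<close>

locale C1_diffeo =
  fixes m :: nat and U V :: "(nat \<Rightarrow> real) set" and \<psi> \<phi> :: "(nat \<Rightarrow> real) \<Rightarrow> nat \<Rightarrow> real"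
  assumes openU: "openin (coord_space m) U" and openV: "openin (coord_space m) V"
    and \<psi>C1: "\<And>k. k < m \<Longrightarrow> C1 m U (\<lambda>p. \<psi> p k)" and \<phi>C1: "\<And>k. k < m \<Longrightarrow> C1 m V (\<lambda>p. \<phi> p k)"
    and \<psi>V: "\<And>p. p \<in> U \<Longrightarrow> \<psi> p \<in> V" and \<phi>U: "\<And>y. y \<in> V \<Longrightarrow> \<phi> y \<in> U"
    and \<phi>\<psi>: "\<And>p. p \<in> U \<Longrightarrow> \<phi> (\<psi> p) = p" and \<psi>\<phi>: "\<And>y. y \<in> V \<Longrightarrow> \<psi> (\<phi> y) = y"
begin

definition J :: "(nat \<Rightarrow> real) \<Rightarrow> nat \<Rightarrow> nat \<Rightarrow> real" where
  "J p k j = partial_deriv j (\<lambda>p. \<psi> p k) p"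

definition K :: "(nat \<Rightarrow> real) \<Rightarrow> nat \<Rightarrow> nat \<Rightarrow> real" where
  "K y k j = partial_deriv j (\<lambda>y. \<phi> y k) y"

lemma Ucs: "U \<subseteq> cs m" and Vcs: "V \<subseteq> cs m"
  using openU openV openin_coord by blast+

lemma KJ:
  assumes p: "p \<in> U" and ij: "i < m" "j < m"
  shows "(\<Sum>k<m. K (\<psi> p) i k * J p k j) = (if i = j then 1 else 0)"
proof -
  have "partial_deriv j (\<lambda>p. \<phi> (\<psi> p) i) p = (\<Sum>k<m. K (\<psi> p) i k * J p k j)"
    unfolding J_def K_def
    by (rule C1_compose(2)[OF openU openV \<psi>C1 \<psi>V \<phi>C1[OF ij(1)] ij(2) p])
  moreover have "partial_deriv j (\<lambda>p. \<phi> (\<psi> p) i) p = partial_deriv j (\<lambda>p. p i) p"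
    by (rule partial_deriv_cong[OF openU p ij(2)]) (simp add: \<phi>\<psi>)
  moreover have "partial_deriv j (\<lambda>p. p i) p = (if i = j then 1 else 0)"
    by (rule partial_deriv_eqI) auto
  ultimately show ?thesis by simp
qed

lemma J_nonzero:
  assumes p: "p \<in> U"
  shows "fdet m (J p) \<noteq> 0"
proof -
  have "fdet m (\<lambda>i j. \<Sum>k<m. K (\<psi> p) i k * J p k j) = fdet m (\<lambda>i j. if i = j then 1 else 0)"
    by (rule fdet_cong) (rule KJ[OF p])
  then have "fdet m (K (\<psi> p)) * fdet m (J p) = 1"
    by (simp only: fdet_mult fdet_one)
  then show ?thesis by auto
qed

lemma JK:
  assumes p: "p \<in> U" and ij: "i < m" "j < m"
  shows "(\<Sum>k<m. J p i k * K (\<psi> p) k j) = (if i = j then 1 else 0)"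
proof -
  have "K (\<psi> p) k j = finv m (J p) k j" if "k < m" for k
    by (rule left_inverse_eq_right_inverse[of m _ "J p"]) (use that ij KJ[OF p] finv_right[OF J_nonzero[OF p]] in \<open>simp_all only:\<close>)
  then have "(\<Sum>k<m. J p i k * K (\<psi> p) k j) = (\<Sum>k<m. J p i k * finv m (J p) k j)" by simp
  then show ?thesis using finv_right[OF J_nonzero[OF p] ij] by (simp only:)
qed

lemma cont_J: "cont_on_coord m U (\<lambda>p. J p k j)" if "k < m" "j < m"
  using C1D(3)[OF \<psi>C1[OF that(1)] that(2)] unfolding J_def .

lemma cont_det_J: "cont_on_coord m U (\<lambda>p. \<bar>fdet m (J p)\<bar>)"
proof -
  have "cont_on_coord m U (\<lambda>p. fdet m (J p))"
    unfolding fdet_Leibniz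
  proof (intro continuous_map_sum continuous_map_real_mult continuous_map_prod)
    fix \<pi> i assume "\<pi> \<in> {\<pi>. \<pi> permutes {0..<m}}" "i \<in> {0..<m}"
    then have "i < m" "\<pi> i < m" using permutes_in_image[of \<pi> "{0..<m}" i] by auto
    then show "cont_on_coord m U (\<lambda>p. J p i (\<pi> i))" by (rule cont_J)
  qed (auto simp: finite_permutations)
  then show ?thesis by (rule cont_on_coord_real) auto
qed

text \<open>The affine first-order approximation of \<psi> at z, written as translation, linear map,
  translation, so that its effect on volume can be read off.\<close>

definition tangent_map :: "(nat \<Rightarrow> real) \<Rightarrow> (nat \<Rightarrow> real) \<Rightarrow> nat \<Rightarrow> real" where
  "tangent_map z y = shift m (\<psi> z) (linmap m (J z) (shift m (\<lambda>i. - z i) y))"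

lemma tangent_map_apply: "k < m \<Longrightarrow> tangent_map z y k = \<psi> z k + (\<Sum>j<m. J z k j * (y j - z j))"
  by (simp add: tangent_map_def shift_def linmap_def add.commute)

lemma tangent_map_cs: "tangent_map z y \<in> cs m"
  by (simp add: tangent_map_def shift_def)

lemma emeasure_tangent_map:
  assumes z: "z \<in> U" and S: "S \<in> sets (lborel_coord m)"
  shows "tangent_map z ` S \<in> sets (lborel_coord m)"
    and "emeasure (lborel_coord m) (tangent_map z ` S) = ennreal \<bar>fdet m (J z)\<bar> * emeasure (lborel_coord m) S"
proof -
  have eq: "tangent_map z ` S = shift m (\<psi> z) ` linmap m (J z) ` shift m (\<lambda>i. - z i) ` S"
    by (auto simp: tangent_map_def)
  note s1 = shift_image[OF S, of "\<lambda>i. - z i"]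
  have s2: "linmap m (J z) ` shift m (\<lambda>i. - z i) ` S \<in> sets (lborel_coord m)"
    "emeasure (lborel_coord m) (linmap m (J z) ` shift m (\<lambda>i. - z i) ` S) = ennreal \<bar>fdet m (J z)\<bar> * emeasure (lborel_coord m) S"
    using scales_volume_invertible[OF J_nonzero[OF z]] s1 unfolding scales_volume_def by auto
  show "tangent_map z ` S \<in> sets (lborel_coord m)"
    "emeasure (lborel_coord m) (tangent_map z ` S) = ennreal \<bar>fdet m (J z)\<bar> * emeasure (lborel_coord m) S"
    unfolding eq using shift_image[OF s2(1)] s2(2) by auto
qed

lemma \<phi>_measurable: "\<phi> \<in> measurable (restrict_space (lborel_coord m) V) (lborel_coord m)"
proof (rule measurable_into_coord)
  show "(\<lambda>x. \<phi> x i) \<in> borel_measurable (restrict_space (lborel_coord m) V)" if "i < m" for i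
    by (rule cont_on_coord_measurable[OF openV C1D(1)[OF \<phi>C1[OF that]]])
  show "\<phi> x \<in> cs m" if "x \<in> space (restrict_space (lborel_coord m) V)" for x
    using that \<phi>U Ucs by (auto simp: space_restrict_space)
qed

text \<open>Images under \<psi> are treated as preimages under the measurable map \<phi>.\<close>

lemma \<psi>_image:
  assumes "A \<subseteq> U"
  shows "\<psi> ` A = \<phi> -` A \<inter> V"
proof
  show "\<psi> ` A \<subseteq> \<phi> -` A \<inter> V" using assms \<psi>V \<phi>\<psi> by auto
  show "\<phi> -` A \<inter> V \<subseteq> \<psi> ` A"
  proof
    fix y assume y: "y \<in> \<phi> -` A \<inter> V"
    then have "y = \<psi> (\<phi> y)" using \<psi>\<phi> by simp
    then show "y \<in> \<psi> ` A" using y by blast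
  qed
qed

lemma \<psi>_image_sets:
  assumes A: "A \<in> sets (lborel_coord m)" "A \<subseteq> U"
  shows "\<psi> ` A \<in> sets (lborel_coord m)"
proof -
  have "\<phi> -` A \<inter> space (restrict_space (lborel_coord m) V) \<in> sets (restrict_space (lborel_coord m) V)"
    by (rule measurable_sets[OF \<phi>_measurable A(1)])
  moreover have "\<phi> -` A \<inter> space (restrict_space (lborel_coord m) V) = \<psi> ` A"
    using \<psi>_image[OF A(2)] Vcs by (auto simp: space_restrict_space)
  ultimately show ?thesis
    using openin_sets[OF openV] Vcs by (subst (asm) sets_restrict_space_iff) (auto simp: Int_absorb2)
qed

text \<open>The volume of the \<psi>-image as a measure on U. Pushing Lebesgue measure on V forward
  along the inverse makes additivity automatic.\<close>

definition image_measure :: "(nat \<Rightarrow> real) measure" where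
  "image_measure = distr (restrict_space (lborel_coord m) V) (restrict_space (lborel_coord m) U) \<phi>"

definition jacobian_measure :: "(nat \<Rightarrow> real) measure" where
  "jacobian_measure = density (restrict_space (lborel_coord m) U) (\<lambda>p. ennreal \<bar>fdet m (J p)\<bar>)"

lemma sets_restrict_U: "A \<in> sets (restrict_space (lborel_coord m) U) \<longleftrightarrow> A \<in> sets (lborel_coord m) \<and> A \<subseteq> U"
  using openin_sets[OF openU] Ucs by (subst sets_restrict_space_iff) (auto simp: Int_absorb2)

lemma space_restrict_U: "space (restrict_space (lborel_coord m) U) = U"
  and space_restrict_V: "space (restrict_space (lborel_coord m) V) = V"
  using Ucs Vcs by (auto simp: space_restrict_space)

lemma \<phi>_measurable': "\<phi> \<in> measurable (restrict_space (lborel_coord m) V) (restrict_space (lborel_coord m) U)"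
  by (rule measurable_restrict_space2[OF _ \<phi>_measurable]) (use \<phi>U space_restrict_V in auto)

lemma emeasure_image_measure:
  assumes A: "A \<in> sets (lborel_coord m)" "A \<subseteq> U"
  shows "emeasure image_measure A = emeasure (lborel_coord m) (\<psi> ` A)"
proof -
  have "emeasure image_measure A = emeasure (restrict_space (lborel_coord m) V) (\<phi> -` A \<inter> V)"
    unfolding image_measure_def
    by (subst emeasure_distr[OF \<phi>_measurable']) (use A in \<open>auto simp: sets_restrict_U space_restrict_V\<close>)
  also have "\<dots> = emeasure (lborel_coord m) (\<psi> ` A)"
    unfolding \<psi>_image[OF A(2), symmetric]
    by (rule emeasure_restrict_space) (use \<psi>V A openin_sets[OF openV] Vcs in \<open>auto simp: Int_absorb2\<close>)
  finally show ?thesis .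
qed

lemma det_J_measurable: "(\<lambda>p. ennreal \<bar>fdet m (J p)\<bar>) \<in> borel_measurable (restrict_space (lborel_coord m) U)"
  using cont_on_coord_measurable[OF openU cont_det_J] by simp

lemma emeasure_jacobian_measure:
  assumes A: "A \<in> sets (lborel_coord m)" "A \<subseteq> U"
  shows "emeasure jacobian_measure A = (\<integral>\<^sup>+p\<in>A. ennreal \<bar>fdet m (J p)\<bar> \<partial>lborel_coord m)"
proof -
  have "emeasure jacobian_measure A = (\<integral>\<^sup>+p\<in>A. ennreal \<bar>fdet m (J p)\<bar> \<partial>restrict_space (lborel_coord m) U)"
    unfolding jacobian_measure_def
    by (rule emeasure_density[OF det_J_measurable]) (use A sets_restrict_U in auto)
  also have "\<dots> = (\<integral>\<^sup>+p. ennreal \<bar>fdet m (J p)\<bar> * indicator A p * indicator U p \<partial>lborel_coord m)"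
    by (rule nn_integral_restrict_space) (use openin_sets[OF openU] Ucs in \<open>auto simp: Int_absorb2\<close>)
  also have "\<dots> = (\<integral>\<^sup>+p\<in>A. ennreal \<bar>fdet m (J p)\<bar> \<partial>lborel_coord m)"
    by (rule nn_integral_cong) (use A in \<open>auto simp: indicator_def\<close>)
  finally show ?thesis .
qed

end

section \<open>Small boxes under a diffeomorphism\<close>

lemma inverse_matrix_apply:
  fixes A B :: "nat \<Rightarrow> nat \<Rightarrow> real"
  assumes "\<And>i j. i < m \<Longrightarrow> j < m \<Longrightarrow> (\<Sum>k<m. A i k * B k j) = (if i = j then 1 else 0)" "i < m"
  shows "(\<Sum>j<m. A i j * (\<Sum>l<m. B j l * v l)) = v i"
proof -
  have "(\<Sum>j<m. A i j * (\<Sum>l<m. B j l * v l)) = (\<Sum>j<m. \<Sum>l<m. A i j * B j l * v l)"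
    by (simp add: sum_distrib_left mult.assoc)
  also have "\<dots> = (\<Sum>l<m. (\<Sum>j<m. A i j * B j l) * v l)"
    unfolding sum_distrib_right by (rule sum.swap)
  also have "\<dots> = v i" using assms by (simp add: sum_delta_left)
  finally show ?thesis .
qed

lemma finite_pos_lower_bound:
  fixes l :: "nat \<Rightarrow> real"
  assumes "\<And>i. i < m \<Longrightarrow> l i > 0"
  shows "\<exists>\<mu>>0. \<forall>i<m. \<mu> \<le> l i"
  using assms by (intro exI[of _ "Min (insert 1 (l ` {..<m}))"]) auto

lemma abs_matrix_apply_le:
  fixes A :: "nat \<Rightarrow> nat \<Rightarrow> real"
  assumes "\<And>k. k < m \<Longrightarrow> \<bar>w k\<bar> \<le> b" "i < m" "b \<ge> 0"
  shows "\<bar>\<Sum>k<m. A i k * w k\<bar> \<le> (\<Sum>i<m. \<Sum>k<m. \<bar>A i k\<bar>) * b"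
proof -
  have "\<bar>\<Sum>k<m. A i k * w k\<bar> \<le> (\<Sum>k<m. \<bar>A i k\<bar> * b)"
    by (rule order_trans[OF sum_abs sum_mono]) (use assms in \<open>auto simp: abs_mult intro!: mult_left_mono\<close>)
  also have "\<dots> = (\<Sum>k<m. \<bar>A i k\<bar>) * b" by (simp add: sum_distrib_right)
  also have "(\<Sum>k<m. \<bar>A i k\<bar>) \<le> (\<Sum>i<m. \<Sum>k<m. \<bar>A i k\<bar>)"
    by (rule member_le_sum[where f = "\<lambda>i. \<Sum>k<m. \<bar>A i k\<bar>"]) (use assms(2) in \<open>auto intro: sum_nonneg\<close>)
  finally show ?thesis using assms(3) by (simp add: mult_right_mono)
qed

context C1_diffeo
begin

lemma JK_apply: "z \<in> U \<Longrightarrow> i < m \<Longrightarrow> (\<Sum>j<m. J z i j * (\<Sum>l<m. K (\<psi> z) j l * v l)) = v i"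
  and KJ_apply: "z \<in> U \<Longrightarrow> i < m \<Longrightarrow> (\<Sum>j<m. K (\<psi> z) i j * (\<Sum>l<m. J z j l * v l)) = v i"
  by (rule inverse_matrix_apply[of m], rule JK KJ, assumption+)+

text \<open>Undo the linear part: the inverse tangent map sends \<psi> x to a point that differs
  from x by K applied to the Taylor remainder. On a box of small scale this error is at most e times
  each side length.\<close>

lemma image_grid_box_upper:
  assumes z: "z \<in> U" and l: "\<And>i. i < m \<Longrightarrow> l i > 0" and e: "e > 0"
  shows "\<exists>s0>0. \<forall>s a. 0 < s \<and> s < s0 \<and> (\<forall>i<m. a i \<le> z i \<and> z i \<le> a i + s * l i) \<longrightarrow>
    \<psi> ` grid_box m l s a \<subseteq> tangent_map z ` hbox m (\<lambda>i. a i - e * (s * l i)) (\<lambda>i. a i + s * l i + e * (s * l i))"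
proof -
  obtain \<mu> where \<mu>: "\<mu> > 0" "\<And>i. i < m \<Longrightarrow> \<mu> \<le> l i" using finite_pos_lower_bound[of m l] l by blast
  define S where "S = (\<Sum>i<m. \<Sum>k<m. \<bar>K (\<psi> z) i k\<bar>)"
  define L where "L = (\<Sum>i<m. l i)"
  have S0: "S \<ge> 0" and L0: "L \<ge> 0" using l by (auto simp: S_def L_def less_imp_le intro!: sum_nonneg)
  \<comment> \<open>Chosen so that K applied to the remainder is at most e times the shortest side:
    S bounds K, and L is the sum of the side lengths at scale 1. The added ones keep the denominator
    positive.\<close>
  define \<epsilon> where "\<epsilon> = e * \<mu> / ((S + 1) * (L + 1))"
  have \<epsilon>: "\<epsilon> > 0" using e \<mu> S0 L0 by (simp add: \<epsilon>_def)
  have bound: "S * (\<epsilon> * L) \<le> e * \<mu>"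
  proof -
    have "S * L \<le> (S + 1) * (L + 1)" using S0 L0 by (simp add: algebra_simps)
    then have "e * \<mu> * (S * L) \<le> e * \<mu> * ((S + 1) * (L + 1))" using e \<mu> by (intro mult_left_mono) auto
    moreover have "(S + 1) * (L + 1) > 0" using S0 L0 by simp
    moreover have "S * (\<epsilon> * L) = e * \<mu> * (S * L) / ((S + 1) * (L + 1))" by (simp add: \<epsilon>_def)
    ultimately show ?thesis by (simp only: pos_divide_le_eq)
  qed
  obtain d where d: "d > 0" "\<forall>q\<in>cs m. near m d z q \<longrightarrow> q \<in> U \<and> (\<forall>k<m.
    \<bar>\<psi> q k - \<psi> z k - (\<Sum>i<m. J z k i * (q i - z i))\<bar> \<le> \<epsilon> * (\<Sum>i<m. \<bar>q i - z i\<bar>))"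
    using C1_family_linear_approx[of m U \<psi> z \<epsilon>, OF openU \<psi>C1 z \<epsilon>] unfolding J_def by auto
  show ?thesis
  proof (intro exI[of _ "d / (L + 1)"] conjI allI impI subsetI)
    show "d / (L + 1) > 0" using d L0 by simp
    fix s a y assume "0 < s \<and> s < d / (L + 1) \<and> (\<forall>i<m. a i \<le> z i \<and> z i \<le> a i + s * l i)"
    then have s: "0 < s" "s * (L + 1) < d" "\<And>i. i < m \<Longrightarrow> a i \<le> z i \<and> z i \<le> a i + s * l i"
      using L0 by (auto simp: field_simps)
    assume "y \<in> \<psi> ` grid_box m l s a"
    then obtain x where x: "x \<in> grid_box m l s a" "y = \<psi> x" by blast
    have xcs: "x \<in> cs m" and xb: "\<And>i. i < m \<Longrightarrow> a i \<le> x i \<and> x i < a i + s * l i"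
      using x by (auto simp: grid_box_def hbox_iff)
    have xz: "\<bar>x i - z i\<bar> \<le> s * l i" if "i < m" for i using s(3)[OF that] xb[OF that] by linarith
    have sumxz: "(\<Sum>i<m. \<bar>x i - z i\<bar>) \<le> s * L"
      unfolding L_def sum_distrib_left by (intro sum_mono) (use xz in auto)
    have "near m d z x" unfolding near_def
    proof (intro allI impI)
      fix i assume i: "i < m"
      have "\<bar>x i - z i\<bar> \<le> (\<Sum>i<m. \<bar>x i - z i\<bar>)" by (rule abs_component_le_sum[OF i])
      then show "\<bar>x i - z i\<bar> < d" using sumxz s(1,2) by (simp add: algebra_simps)
    qed
    then have dx: "x \<in> U \<and> (\<forall>k<m. \<bar>\<psi> x k - \<psi> z k - (\<Sum>i<m. J z k i * (x i - z i))\<bar> \<le> \<epsilon> * (\<Sum>i<m. \<bar>x i - z i\<bar>))"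
      using d(2) xcs by simp
    then have xU: "x \<in> U" ..
    have rem: "\<bar>\<psi> x k - \<psi> z k - (\<Sum>i<m. J z k i * (x i - z i))\<bar> \<le> \<epsilon> * (s * L)" if "k < m" for k
    proof -
      have "\<epsilon> * (\<Sum>i<m. \<bar>x i - z i\<bar>) \<le> \<epsilon> * (s * L)" using sumxz \<epsilon> by (intro mult_left_mono) auto
      then show ?thesis using dx that by (meson order_trans)
    qed
    \<comment> \<open>The preimage of \<psi> x under the tangent map, computed with the inverse
      matrix K.\<close>
    define w where "w = (\<lambda>i\<in>{..<m}. z i + (\<Sum>k<m. K (\<psi> z) i k * (\<psi> x k - \<psi> z k)))"
    have "tangent_map z w = \<psi> x"
    proof (rule PiE_ext[OF tangent_map_cs])
      show "\<psi> x \<in> cs m" using \<psi>V xU Vcs by auto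
      show "tangent_map z w k = \<psi> x k" if "k \<in> {..<m}" for k
        using that JK_apply[OF z, of k "\<lambda>k. \<psi> x k - \<psi> z k"]
        by (simp add: tangent_map_apply w_def)
    qed
    moreover have "w \<in> hbox m (\<lambda>i. a i - e * (s * l i)) (\<lambda>i. a i + s * l i + e * (s * l i))"
      unfolding hbox_iff
    proof (intro conjI allI impI)
      show "w \<in> cs m" by (simp add: w_def)
      fix i assume i: "i < m"
      have "w i - x i = (\<Sum>k<m. K (\<psi> z) i k * (\<psi> x k - \<psi> z k)) - (\<Sum>k<m. K (\<psi> z) i k * (\<Sum>j<m. J z k j * (x j - z j)))"
        using i KJ_apply[OF z i, of "\<lambda>j. x j - z j"] by (simp add: w_def)
      also have "\<dots> = (\<Sum>k<m. K (\<psi> z) i k * (\<psi> x k - \<psi> z k - (\<Sum>j<m. J z k j * (x j - z j))))"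
        by (simp add: sum_subtractf[symmetric] right_diff_distrib)
      finally have "\<bar>w i - x i\<bar> \<le> S * (\<epsilon> * (s * L))"
        unfolding S_def using \<epsilon> s(1) L0
        by (simp only:) (intro abs_matrix_apply_le rem i, auto)
      also have "\<dots> = s * (S * (\<epsilon> * L))" by simp
      also have "\<dots> \<le> s * (e * \<mu>)" using bound s by (intro mult_left_mono) auto
      also have "\<dots> \<le> e * (s * l i)" using \<mu>(2)[OF i] s(1) e by (simp add: mult.left_commute mult_left_mono)
      finally have "\<bar>w i - x i\<bar> \<le> e * (s * l i)" .
      then show "a i - e * (s * l i) \<le> w i" "w i < a i + s * l i + e * (s * l i)" using xb[OF i] by linarith+
    qed
    ultimately show "y \<in> tangent_map z ` hbox m (\<lambda>i. a i - e * (s * l i)) (\<lambda>i. a i + s * l i + e * (s * l i))"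
      by (intro image_eqI[of _ _ w]) (simp_all only: x(2))
  qed
qed

text \<open>This is a surjectivity statement. Instead of a fixed point argument, the linear
  approximation of the inverse \<phi> at \<psi> z shows that \<phi> maps the tangent image of y to
  within e times the side lengths of y, hence back into the box.\<close>

lemma image_grid_box_lower:
  assumes z: "z \<in> U" and l: "\<And>i. i < m \<Longrightarrow> l i > 0" and e: "e > 0"
  shows "\<exists>s0>0. \<forall>s a. 0 < s \<and> s < s0 \<and> (\<forall>i<m. a i \<le> z i \<and> z i \<le> a i + s * l i) \<longrightarrow>
    tangent_map z ` hbox m (\<lambda>i. a i + e * (s * l i)) (\<lambda>i. a i + s * l i - e * (s * l i)) \<subseteq> \<psi> ` grid_box m l s a"
proof -
  obtain \<mu> where \<mu>: "\<mu> > 0" "\<And>i. i < m \<Longrightarrow> \<mu> \<le> l i" using finite_pos_lower_bound[of m l] l by blast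
  define S where "S = (\<Sum>i<m. \<Sum>k<m. \<bar>J z i k\<bar>)"
  define L where "L = (\<Sum>i<m. l i)"
  have S0: "S \<ge> 0" and L0: "L \<ge> 0" using l by (auto simp: S_def L_def less_imp_le intro!: sum_nonneg)
  \<comment> \<open>Two demands are collected: \<open>real m * S * L\<close> bounds the l1 distance
    from \<psi> z that enters the remainder, and \<open>S * L\<close> being strictly below T keeps w
    within d of \<psi> z.\<close>
  define T where "T = real m * S * L + S * L + 1"
  have T0: "T > 0" "real m * S * L \<le> T" "S * L < T" using S0 L0 by (auto simp: T_def add_nonneg_pos)
  define \<epsilon> where "\<epsilon> = e * \<mu> / T"
  have \<epsilon>: "\<epsilon> > 0" using e \<mu> T0 by (simp add: \<epsilon>_def)
  have bound: "\<epsilon> * (real m * S * L) \<le> e * \<mu>"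
  proof -
    have "e * \<mu> * (real m * S * L) \<le> e * \<mu> * T" using T0(2) e \<mu>(1) by (intro mult_left_mono) auto
    moreover have "\<epsilon> * (real m * S * L) = e * \<mu> * (real m * S * L) / T" by (simp add: \<epsilon>_def)
    ultimately show ?thesis using T0(1) by (simp only: pos_divide_le_eq)
  qed
  have \<psi>z: "\<psi> z \<in> V" by (rule \<psi>V[OF z])
  obtain d where d: "d > 0" "\<forall>q\<in>cs m. near m d (\<psi> z) q \<longrightarrow> q \<in> V \<and> (\<forall>k<m.
    \<bar>\<phi> q k - \<phi> (\<psi> z) k - (\<Sum>i<m. K (\<psi> z) k i * (q i - \<psi> z i))\<bar> \<le> \<epsilon> * (\<Sum>i<m. \<bar>q i - \<psi> z i\<bar>))"
    using C1_family_linear_approx[of m V \<phi> "\<psi> z" \<epsilon>, OF openV \<phi>C1 \<psi>z \<epsilon>] unfolding K_def by auto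
  show ?thesis
  proof (intro exI[of _ "d / T"] conjI allI impI subsetI)
    show "d / T > 0" using d T0 by simp
    fix s a w assume "0 < s \<and> s < d / T \<and> (\<forall>i<m. a i \<le> z i \<and> z i \<le> a i + s * l i)"
    then have s: "0 < s" "s * T < d" "\<And>i. i < m \<Longrightarrow> a i \<le> z i \<and> z i \<le> a i + s * l i"
      using T0 by (auto simp: field_simps)
    assume "w \<in> tangent_map z ` hbox m (\<lambda>i. a i + e * (s * l i)) (\<lambda>i. a i + s * l i - e * (s * l i))"
    then obtain y where y: "w = tangent_map z y" "\<And>i. i < m \<Longrightarrow> a i + e * (s * l i) \<le> y i \<and> y i < a i + s * l i - e * (s * l i)"
      by (auto simp: hbox_iff)
    have yz: "\<bar>y i - z i\<bar> \<le> s * L" if i: "i < m" for i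
    proof -
      have "e * (s * l i) > 0" using e s l[OF i] by simp
      then have "\<bar>y i - z i\<bar> \<le> s * l i" using s(3)[OF i] y(2)[OF i] by linarith
      also have "l i \<le> L" unfolding L_def by (rule member_le_sum) (use i l in \<open>auto simp: less_imp_le\<close>)
      finally show ?thesis using s by simp
    qed
    have wk: "w k - \<psi> z k = (\<Sum>j<m. J z k j * (y j - z j))" if "k < m" for k
      using that by (simp add: y(1) tangent_map_apply)
    have wz: "\<bar>w k - \<psi> z k\<bar> \<le> S * (s * L)" if k: "k < m" for k
      unfolding wk[OF k] S_def using yz s(1) L0 k by (intro abs_matrix_apply_le) auto
    have "near m d (\<psi> z) w"
      unfolding near_def
    proof (intro allI impI)
      fix i assume "i < m"
      have "S * (s * L) = s * (S * L)" by simp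
      also have "\<dots> < s * T" using T0(3) s by simp
      finally show "\<bar>w i - \<psi> z i\<bar> < d" using wz[OF \<open>i < m\<close>] s(2) by linarith
    qed
    moreover have wcs: "w \<in> cs m" unfolding y(1) by (rule tangent_map_cs)
    ultimately have wV: "w \<in> V" and rem: "\<And>k. k < m \<Longrightarrow>
        \<bar>\<phi> w k - \<phi> (\<psi> z) k - (\<Sum>i<m. K (\<psi> z) k i * (w i - \<psi> z i))\<bar> \<le> \<epsilon> * (\<Sum>i<m. \<bar>w i - \<psi> z i\<bar>)"
      using d(2) by auto
    have "\<phi> w \<in> grid_box m l s a"
      unfolding grid_box_def hbox_iff
    proof (intro conjI allI impI)
      show "\<phi> w \<in> cs m" using \<phi>U[OF wV] Ucs by blast
      fix i assume i: "i < m"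
      have "(\<Sum>k<m. K (\<psi> z) i k * (w k - \<psi> z k)) = (\<Sum>k<m. K (\<psi> z) i k * (\<Sum>j<m. J z k j * (y j - z j)))"
        by (intro sum.cong) (auto simp: wk)
      also have "\<dots> = y i - z i" by (rule KJ_apply[OF z i])
      finally have "\<bar>\<phi> w i - y i\<bar> \<le> \<epsilon> * (\<Sum>k<m. \<bar>w k - \<psi> z k\<bar>)"
        using rem[OF i] \<phi>\<psi>[OF z] by simp
      also have "(\<Sum>k<m. \<bar>w k - \<psi> z k\<bar>) \<le> (\<Sum>k<m. S * (s * L))" by (intro sum_mono) (use wz in auto)
      also have "\<epsilon> * (\<Sum>k<m. S * (s * L)) = s * (\<epsilon> * (real m * S * L))" by simp
      also have "\<dots> \<le> s * (e * \<mu>)" using bound s by (intro mult_left_mono) auto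
      also have "\<dots> \<le> e * (s * l i)" using \<mu>(2)[OF i] s(1) e by (simp add: mult.left_commute mult_left_mono)
      finally have "\<bar>\<phi> w i - y i\<bar> \<le> e * (s * l i)" using \<epsilon> by (simp add: mult_left_mono)
      then show "a i \<le> \<phi> w i" "\<phi> w i < a i + s * l i" using y(2)[OF i] by linarith+
    qed
    then show "w \<in> \<psi> ` grid_box m l s a" by (intro image_eqI[of _ _ "\<phi> w"]) (simp_all only: \<psi>\<phi>[OF wV])
  qed
qed

text \<open>With D the absolute Jacobian at z, both measures of a small box near z lie between D /
  \<tau> and D * \<tau> times its volume: the image measure by the two inclusions above, the
  Jacobian measure by continuity. The ratio of these bounds is \<tau>^2.\<close>

lemma local_comparison:
  assumes z: "z \<in> U" and l: "\<And>i. i < m \<Longrightarrow> l i > 0" and \<tau>: "\<tau> > 1"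
  shows "\<exists>s0>0. \<forall>s a. 0 < s \<and> s < s0 \<and> (\<forall>i<m. a i \<le> z i \<and> z i \<le> a i + s * l i) \<longrightarrow>
    emeasure image_measure (grid_box m l s a) \<le> ennreal (\<tau>\<^sup>2) * emeasure jacobian_measure (grid_box m l s a) \<and>
    emeasure jacobian_measure (grid_box m l s a) \<le> ennreal (\<tau>\<^sup>2) * emeasure image_measure (grid_box m l s a)"
proof -
  define D where "D = \<bar>fdet m (J z)\<bar>"
  have D: "D > 0" using J_nonzero[OF z] by (simp add: D_def)
  \<comment> \<open>Moving every face of a box by e times the side length, outwards or inwards,
    multiplies the volume by (1 + 2e)^m or (1 - 2e)^m; e is taken so small that both changes stay
    within the factor \<tau>.\<close>
  have "\<forall>\<^sub>F e in at_right (0::real). 0 < e \<and> e < 1/2 \<and> (1 + 2 * e) ^ m < \<tau> \<and> 1 < \<tau> * (1 - 2 * e) ^ m"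
  proof (intro eventually_conj)
    have "((\<lambda>e::real. (1 + 2 * e) ^ m) \<longlongrightarrow> (1 + 2 * 0) ^ m) (at_right 0)" by (intro tendsto_intros)
    from order_tendstoD(2)[OF this, of \<tau>] show "\<forall>\<^sub>F e in at_right (0::real). (1 + 2 * e) ^ m < \<tau>" using \<tau> by simp
    have "((\<lambda>e::real. \<tau> * (1 - 2 * e) ^ m) \<longlongrightarrow> \<tau> * (1 - 2 * 0) ^ m) (at_right 0)" by (intro tendsto_intros)
    from order_tendstoD(1)[OF this, of 1] show "\<forall>\<^sub>F e in at_right (0::real). 1 < \<tau> * (1 - 2 * e) ^ m" using \<tau> by simp
    show "\<forall>\<^sub>F e in at_right (0::real). 0 < e" by (simp add: eventually_at_right_less)
    show "\<forall>\<^sub>F e in at_right (0::real). e < 1/2" unfolding eventually_at_right_field by (intro exI[of _ "1/2"]) auto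
  qed
  then obtain e :: real where e: "0 < e" "e < 1/2" "(1 + 2 * e) ^ m < \<tau>" "1 < \<tau> * (1 - 2 * e) ^ m"
    using eventually_happens'[OF trivial_limit_at_right_real] by blast
  obtain s1 where s1: "s1 > 0" "\<And>s a. 0 < s \<Longrightarrow> s < s1 \<Longrightarrow> (\<forall>i<m. a i \<le> z i \<and> z i \<le> a i + s * l i) \<Longrightarrow>
    \<psi> ` grid_box m l s a \<subseteq> tangent_map z ` hbox m (\<lambda>i. a i - e * (s * l i)) (\<lambda>i. a i + s * l i + e * (s * l i))"
    using image_grid_box_upper[of z l e] z l e(1) by auto
  obtain s2 where s2: "s2 > 0" "\<And>s a. 0 < s \<Longrightarrow> s < s2 \<Longrightarrow> (\<forall>i<m. a i \<le> z i \<and> z i \<le> a i + s * l i) \<Longrightarrow>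
    tangent_map z ` hbox m (\<lambda>i. a i + e * (s * l i)) (\<lambda>i. a i + s * l i - e * (s * l i)) \<subseteq> \<psi> ` grid_box m l s a"
    using image_grid_box_lower[of z l e] z l e(1) by auto
  have D\<tau>: "D - D / \<tau> > 0" using D \<tau> by (simp add: field_simps)
  obtain d where d: "d > 0" "\<forall>q\<in>cs m. near m d z q \<longrightarrow> q \<in> U \<and> \<bar>\<bar>fdet m (J q)\<bar> - D\<bar> < D - D / \<tau>"
    using cont_det_J[unfolded cont_on_coord_iff[OF openU], rule_format, OF z D\<tau>] unfolding D_def by blast
  define L where "L = (\<Sum>i<m. l i)"
  have L0: "L \<ge> 0" using l by (auto simp: L_def less_imp_le intro!: sum_nonneg)
  define s0 where "s0 = min (min s1 s2) (d / (L + 1))"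
  have s0: "s0 > 0" "s0 \<le> s1" "s0 \<le> s2" "s0 \<le> d / (L + 1)" using s1 s2 d L0 by (auto simp: s0_def)
  show ?thesis
  proof (intro exI[of _ s0] conjI allI impI)
    show "0 < s0" by (rule s0(1))
    fix s a assume "0 < s \<and> s < s0 \<and> (\<forall>i<m. a i \<le> z i \<and> z i \<le> a i + s * l i)"
    then have s: "0 < s" "s < s0" "\<forall>i<m. a i \<le> z i \<and> z i \<le> a i + s * l i" by auto
    let ?Q = "grid_box m l s a"
    define q where "q = (\<Prod>i<m. s * l i)"
    have sl: "s * l i > 0" if "i < m" for i using l[OF that] s by simp
    have q0: "q > 0" unfolding q_def by (intro prod_pos) (use sl in auto)
    have Qs: "?Q \<in> sets (lborel_coord m)" by (simp add: grid_box_def)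
    have lamQ: "emeasure (lborel_coord m) ?Q = ennreal q"
      unfolding grid_box_def q_def by (subst emeasure_hbox) (use sl in \<open>auto simp: less_imp_le\<close>)
    have "s < d / (L + 1)" using s(2) s0(4) by linarith
    then have sd: "s * (L + 1) < d" using L0 by (simp add: pos_less_divide_eq)
    have Qnear: "x \<in> U \<and> D / \<tau> \<le> \<bar>fdet m (J x)\<bar> \<and> \<bar>fdet m (J x)\<bar> \<le> D * \<tau>" if x: "x \<in> ?Q" for x
    proof -
      have "near m d z x" unfolding near_def
      proof (intro allI impI)
        fix i assume i: "i < m"
        have "a i \<le> x i" "x i < a i + s * l i" "a i \<le> z i" "z i \<le> a i + s * l i"
          using x s(3) i by (auto simp: grid_box_def hbox_iff)
        then have "\<bar>x i - z i\<bar> \<le> s * l i" by linarith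
        also have "l i \<le> L" unfolding L_def by (rule member_le_sum) (use i l in \<open>auto simp: less_imp_le\<close>)
        finally show "\<bar>x i - z i\<bar> < d" using s(1) sd by (simp add: algebra_simps)
      qed
      moreover have "x \<in> cs m" using x by (simp add: grid_box_def hbox_iff)
      ultimately have 1: "x \<in> U" "\<bar>\<bar>fdet m (J x)\<bar> - D\<bar> < D - D / \<tau>" using d(2) by auto
      \<comment> \<open>Equivalent to (\<tau> - 1)^2 >= 0. It lets the tolerance D - D / \<tau>,
        made for the lower bound, serve the upper bound as well.\<close>
      have "2 - 1 / \<tau> \<le> \<tau>"
        using \<tau> zero_le_power2[of "\<tau> - 1"] by (simp add: field_simps power2_eq_square)
      from mult_left_mono[OF this, of D] have "D + (D - D / \<tau>) \<le> D * \<tau>" using D by (simp add: algebra_simps)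
      then show ?thesis using 1 by linarith
    qed
    then have QU: "?Q \<subseteq> U" by blast
    have N: "emeasure image_measure ?Q = emeasure (lborel_coord m) (\<psi> ` ?Q)"
      by (rule emeasure_image_measure[OF Qs QU])
    have Nup: "emeasure image_measure ?Q \<le> ennreal (D * \<tau> * q)"
    proof -
      let ?H = "hbox m (\<lambda>i. a i - e * (s * l i)) (\<lambda>i. a i + s * l i + e * (s * l i))"
      have ord: "a i - e * (s * l i) \<le> a i + s * l i + e * (s * l i)" if "i < m" for i
        using sl[OF that] mult_pos_pos[OF e(1) sl[OF that]] by linarith
      have "emeasure (lborel_coord m) (\<psi> ` ?Q) \<le> emeasure (lborel_coord m) (tangent_map z ` ?H)"
        using s s0 by (intro emeasure_mono s1(2) emeasure_tangent_map z) auto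
      also have "\<dots> = ennreal D * emeasure (lborel_coord m) ?H"
        unfolding D_def by (rule emeasure_tangent_map[OF z]) simp
      also have "emeasure (lborel_coord m) ?H = ennreal (\<Prod>i<m. (1 + 2 * e) * (s * l i))"
        by (subst emeasure_hbox[OF ord]) (auto simp: algebra_simps)
      also have "(\<Prod>i<m. (1 + 2 * e) * (s * l i)) = (1 + 2 * e) ^ m * q"
        by (simp add: q_def prod.distrib)
      also have "ennreal D * ennreal ((1 + 2 * e) ^ m * q) = ennreal (D * ((1 + 2 * e) ^ m * q))"
        using D by (simp add: ennreal_mult')
      also have "\<dots> \<le> ennreal (D * (\<tau> * q))" using D q0 e by (intro ennreal_leI mult_left_mono mult_right_mono) auto
      finally show ?thesis by (simp add: N mult.assoc)
    qed
    have Nlow: "emeasure image_measure ?Q \<ge> ennreal (D / \<tau> * q)"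
    proof -
      let ?H = "hbox m (\<lambda>i. a i + e * (s * l i)) (\<lambda>i. a i + s * l i - e * (s * l i))"
      have ord: "a i + e * (s * l i) \<le> a i + s * l i - e * (s * l i)" if "i < m" for i
        using mult_right_mono[of "2 * e" 1 "s * l i"] sl[OF that] e(2) by simp
      have "ennreal (D / \<tau> * q) \<le> ennreal (D * ((1 - 2 * e) ^ m * q))"
      proof -
        have "1 / \<tau> \<le> (1 - 2 * e) ^ m" using e(4) \<tau> by (simp add: field_simps)
        then have "D * (1 / \<tau> * q) \<le> D * ((1 - 2 * e) ^ m * q)" using D q0 by (intro mult_left_mono mult_right_mono) auto
        then show ?thesis by (intro ennreal_leI) simp
      qed
      also have "\<dots> = ennreal D * ennreal ((1 - 2 * e) ^ m * q)"
        using D by (simp add: ennreal_mult')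
      also have "(1 - 2 * e) ^ m * q = (\<Prod>i<m. (1 - 2 * e) * (s * l i))"
        by (simp add: q_def prod.distrib)
      also have "ennreal (\<Prod>i<m. (1 - 2 * e) * (s * l i)) = emeasure (lborel_coord m) ?H"
        by (subst emeasure_hbox[OF ord]) (auto simp: algebra_simps)
      also have "ennreal D * emeasure (lborel_coord m) ?H = emeasure (lborel_coord m) (tangent_map z ` ?H)"
        unfolding D_def by (rule emeasure_tangent_map(2)[OF z, symmetric]) simp
      also have "\<dots> \<le> emeasure (lborel_coord m) (\<psi> ` ?Q)"
        using s s0 by (intro emeasure_mono s2(2) \<psi>_image_sets Qs QU) auto
      finally show ?thesis by (simp add: N)
    qed
    have E: "emeasure jacobian_measure ?Q = (\<integral>\<^sup>+p\<in>?Q. ennreal \<bar>fdet m (J p)\<bar> \<partial>lborel_coord m)"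
      by (rule emeasure_jacobian_measure[OF Qs QU])
    have const: "(\<integral>\<^sup>+p\<in>?Q. ennreal c \<partial>lborel_coord m) = ennreal (c * q)" if "c \<ge> 0" for c
      using that Qs lamQ by (simp add: nn_integral_cmult_indicator ennreal_mult')
    have Eup: "emeasure jacobian_measure ?Q \<le> ennreal (D * \<tau> * q)"
      unfolding E using Qnear D \<tau>
      by (subst const[symmetric]) (auto intro!: nn_integral_mono simp: indicator_def ennreal_leI)
    have Elow: "emeasure jacobian_measure ?Q \<ge> ennreal (D / \<tau> * q)"
      unfolding E using Qnear D \<tau>
      by (subst const[symmetric]) (auto intro!: nn_integral_mono simp: indicator_def ennreal_leI)
    have "ennreal (D * \<tau> * q) = ennreal (\<tau>\<^sup>2) * ennreal (D / \<tau> * q)"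
      using \<tau> D q0 by (simp add: ennreal_mult[symmetric] power2_eq_square)
    then have sq: "ennreal (D * \<tau> * q) \<le> ennreal (\<tau>\<^sup>2) * x" if "ennreal (D / \<tau> * q) \<le> x" for x
      using that by (simp add: mult_left_mono)
    show "emeasure image_measure ?Q \<le> ennreal (\<tau>\<^sup>2) * emeasure jacobian_measure ?Q"
      by (rule order_trans[OF Nup sq[OF Elow]])
    show "emeasure jacobian_measure ?Q \<le> ennreal (\<tau>\<^sup>2) * emeasure image_measure ?Q"
      by (rule order_trans[OF Eup sq[OF Nlow]])
  qed
qed

section \<open>From local comparison to equality of measures\<close>

lemma ennreal_le_of_squares:
  fixes x y :: ennreal
  assumes "\<And>\<tau>. \<tau> > 1 \<Longrightarrow> x \<le> ennreal (\<tau>\<^sup>2) * y"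
  shows "x \<le> y"
proof (cases "y = \<infinity>")
  case False
  \<comment> \<open>Finiteness of y is what makes this product continuous in \<tau> in the extended
    reals.\<close>
  have "((\<lambda>\<tau>. ennreal (\<tau>\<^sup>2) * y) \<longlongrightarrow> ennreal ((1::real) ^ 2) * y) (at_right 1)"
    using False by (intro tendsto_intros ennreal_tendsto_cmult) (auto simp: less_top mult.commute)
  then have "x \<le> ennreal ((1::real) ^ 2) * y"
    by (rule tendsto_lowerbound) (auto simp: eventually_at_right_field assms intro!: exI[of _ 2])
  then show ?thesis by simp
qed simp

text \<open>Comparison with every factor \<tau>^2 > 1 gives equality on boxes. These form an
  intersection-stable generator, and countably many of them, each of finite measure, cover
  U.\<close>

lemma image_measure_eq_jacobian_measure: "image_measure = jacobian_measure"
proof -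
  have sN: "sets image_measure = sets (restrict_space (lborel_coord m) U)" by (simp add: image_measure_def)
  have sE: "sets jacobian_measure = sets (restrict_space (lborel_coord m) U)" by (simp add: jacobian_measure_def)
  \<comment> \<open>The closed box inside U is what the bisection asks for, and it bounds the
    Jacobian. The empty set is adjoined because two disjoint boxes do not intersect in a box with
    strict sides.\<close>
  define G where "G = {hbox m a b | a b. (\<forall>i<m. a i < b i) \<and> kbox m a b \<subseteq> U} \<union> {{}}"
  have gen: "sets (restrict_space (lborel_coord m) U) = sigma_sets U G"
  proof
    have "G \<subseteq> sets (restrict_space (lborel_coord m) U)"
      unfolding G_def using order_trans[OF hbox_subset_kbox, of m _ _ U] by (auto simp: sets_restrict_U)
    then show "sigma_sets U G \<subseteq> sets (restrict_space (lborel_coord m) U)"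
      using sets.sigma_sets_subset[of G "restrict_space (lborel_coord m) U"] space_restrict_U by simp
    have "sets (restrict_space (lborel_coord m) U) = (\<inter>) U ` sigma_sets (cs m) {W. openin (coord_space m) W}"
      by (simp add: sets_restrict_space sets_lborel_coord)
    also have "\<dots> = sigma_sets U ((\<inter>) U ` {W. openin (coord_space m) W})"
      by (rule sigma_sets_Int) (use openU Ucs in \<open>auto simp: sets_lborel_coord[symmetric] intro: openin_sets\<close>)
    also have "\<dots> \<subseteq> sigma_sets U G"
    proof (rule sigma_sets_mono, clarify)
      fix W assume "openin (coord_space m) W"
      then have "openin (coord_space m) (U \<inter> W)" using openU by blast
      from openin_countable_hboxes[OF this]
      obtain C where C: "countable C" "U \<inter> W = (\<Union>(a,b)\<in>C. hbox m a b)"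
        "\<forall>(a,b)\<in>C. (\<forall>i<m. a i < b i) \<and> kbox m a b \<subseteq> U \<inter> W"
        by (elim exE conjE)
      have "hbox m a b \<in> G" if "(a,b) \<in> C" for a b
      proof -
        have "(\<forall>i<m. a i < b i) \<and> kbox m a b \<subseteq> U" using bspec[OF C(3) that] by simp
        then show ?thesis unfolding G_def by blast
      qed
      then have "(\<lambda>(a,b). hbox m a b) ` C \<subseteq> sigma_sets U G"
        by (auto intro: sigma_sets.Basic)
      then have "\<Union>((\<lambda>(a,b). hbox m a b) ` C) \<in> sigma_sets U G"
        using C(1) by (intro sigma_sets_UNION) auto
      then show "U \<inter> W \<in> sigma_sets U G" unfolding C(2) .
    qed
    finally show "sets (restrict_space (lborel_coord m) U) \<subseteq> sigma_sets U G" .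
  qed
  have eqG: "emeasure image_measure X = emeasure jacobian_measure X" if X: "X \<in> G" for X
  proof (cases "X = {}")
    case False
    then obtain a b where ab: "X = hbox m a b" "\<And>i. i < m \<Longrightarrow> a i < b i" "kbox m a b \<subseteq> U"
      using X by (auto simp: G_def)
    define l where "l i = b i - a i" for i
    have l: "l i > 0" if "i < m" for i using ab(2)[OF that] by (simp add: l_def)
    have X': "X = grid_box m l 1 a" unfolding ab(1) grid_box_def l_def by simp
    have K': "kbox m a (\<lambda>i. a i + l i) \<subseteq> U" using ab(3) by (simp add: l_def)
    have Us: "U \<in> sets (lborel_coord m)" by (rule openin_sets[OF openU])
    have le1: "emeasure image_measure X \<le> ennreal (\<tau>\<^sup>2) * emeasure jacobian_measure X" if "\<tau> > 1" for \<tau>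
      unfolding X'
    proof (rule grid_box_comparison[of m l image_measure U jacobian_measure, OF l sN sE Us K'])
      fix z assume "z \<in> U"
      from local_comparison[of z l \<tau>, OF this l that]
      obtain s0 where s0: "s0 > 0" "\<And>s a. 0 < s \<and> s < s0 \<and> (\<forall>i<m. a i \<le> z i \<and> z i \<le> a i + s * l i) \<Longrightarrow>
        emeasure image_measure (grid_box m l s a) \<le> ennreal (\<tau>\<^sup>2) * emeasure jacobian_measure (grid_box m l s a) \<and>
        emeasure jacobian_measure (grid_box m l s a) \<le> ennreal (\<tau>\<^sup>2) * emeasure image_measure (grid_box m l s a)"
        by blast
      show "\<exists>s0>0. \<forall>s a. 0 < s \<and> s < s0 \<and> (\<forall>i<m. a i \<le> z i \<and> z i \<le> a i + s * l i) \<longrightarrow>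
        emeasure image_measure (grid_box m l s a) \<le> ennreal (\<tau>\<^sup>2) * emeasure jacobian_measure (grid_box m l s a)"
        using s0(1) conjunct1[OF s0(2)] by (intro exI[of _ s0] conjI allI impI)
    qed
    have le2: "emeasure jacobian_measure X \<le> ennreal (\<tau>\<^sup>2) * emeasure image_measure X" if "\<tau> > 1" for \<tau>
      unfolding X'
    proof (rule grid_box_comparison[of m l jacobian_measure U image_measure, OF l sE sN Us K'])
      fix z assume "z \<in> U"
      from local_comparison[of z l \<tau>, OF this l that]
      obtain s0 where s0: "s0 > 0" "\<And>s a. 0 < s \<and> s < s0 \<and> (\<forall>i<m. a i \<le> z i \<and> z i \<le> a i + s * l i) \<Longrightarrow>
        emeasure image_measure (grid_box m l s a) \<le> ennreal (\<tau>\<^sup>2) * emeasure jacobian_measure (grid_box m l s a) \<and>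
        emeasure jacobian_measure (grid_box m l s a) \<le> ennreal (\<tau>\<^sup>2) * emeasure image_measure (grid_box m l s a)"
        by blast
      show "\<exists>s0>0. \<forall>s a. 0 < s \<and> s < s0 \<and> (\<forall>i<m. a i \<le> z i \<and> z i \<le> a i + s * l i) \<longrightarrow>
        emeasure jacobian_measure (grid_box m l s a) \<le> ennreal (\<tau>\<^sup>2) * emeasure image_measure (grid_box m l s a)"
        using s0(1) conjunct2[OF s0(2)] by (intro exI[of _ s0] conjI allI impI)
    qed
    show ?thesis by (rule antisym; rule ennreal_le_of_squares; rule le1 le2; assumption)
  qed simp
  obtain C where C: "countable C" "U = (\<Union>(a,b)\<in>C. hbox m a b)"
    "\<forall>(a,b)\<in>C. (\<forall>i<m. a i < b i) \<and> kbox m a b \<subseteq> U"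
    using openin_countable_hboxes[OF openU] by (elim exE conjE)
  show ?thesis
  proof (rule measure_eqI_generator_eq_countable[where E = G and \<Omega> = U and A = "(\<lambda>(a,b). hbox m a b) ` C"])
    show "Int_stable G"
      unfolding Int_stable_def
    proof (intro ballI)
      fix X Y assume XY: "X \<in> G" "Y \<in> G"
      show "X \<inter> Y \<in> G"
      proof (cases "X \<inter> Y = {}")
        case False
        then obtain a b a' b' where ab: "X = hbox m a b" "Y = hbox m a' b'" "kbox m a b \<subseteq> U"
          using XY by (auto simp: G_def)
        have eq: "X \<inter> Y = hbox m (\<lambda>i. max (a i) (a' i)) (\<lambda>i. min (b i) (b' i))"
          unfolding ab by (auto simp: hbox_iff)
        obtain p where p: "p \<in> X \<inter> Y" using False by blast
        have "\<forall>i<m. max (a i) (a' i) < min (b i) (b' i)"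
          using p unfolding eq hbox_iff by (auto intro: le_less_trans)
        moreover have "kbox m (\<lambda>i. max (a i) (a' i)) (\<lambda>i. min (b i) (b' i)) \<subseteq> U"
          using ab(3) by (auto simp: kbox_iff subset_iff)
        ultimately show ?thesis unfolding eq G_def by blast
      qed (simp add: G_def)
    qed
    show "G \<subseteq> Pow U" unfolding G_def using order_trans[OF hbox_subset_kbox, of m _ _ U] by auto
    show "sets image_measure = sigma_sets U G" "sets jacobian_measure = sigma_sets U G"
      using sN sE gen by auto
    have "hbox m a b \<in> G" if "(a,b) \<in> C" for a b
    proof -
      have "(\<forall>i<m. a i < b i) \<and> kbox m a b \<subseteq> U" using bspec[OF C(3) that] by simp
      then show ?thesis unfolding G_def by blast
    qed
    then show "(\<lambda>(a,b). hbox m a b) ` C \<subseteq> G" by auto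
    show "\<Union>((\<lambda>(a,b). hbox m a b) ` C) = U" using C(2) by simp
    show "countable ((\<lambda>(a,b). hbox m a b) ` C)" using C(1) by simp
    fix X assume "X \<in> (\<lambda>(a,b). hbox m a b) ` C"
    then obtain a b where X: "(a,b) \<in> C" "X = hbox m a b" by auto
    then have ab: "X = hbox m a b" "\<forall>i<m. a i < b i" "kbox m a b \<subseteq> U" using bspec[OF C(3) X(1)] by simp_all
    have XU: "X \<in> sets (lborel_coord m)" "X \<subseteq> U" using ab(1,3) order_trans[OF hbox_subset_kbox, of m a b U] by auto
    obtain B where B: "B \<ge> 0" "\<forall>p\<in>kbox m a b. \<bar>\<bar>fdet m (J p)\<bar>\<bar> \<le> B"
      using cont_on_coord_bounded[OF compactin_kbox ab(3) cont_det_J] by blast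
    have "emeasure jacobian_measure X \<le> (\<integral>\<^sup>+p\<in>X. ennreal B \<partial>lborel_coord m)"
      unfolding emeasure_jacobian_measure[OF XU]
      using B subsetD[OF hbox_subset_kbox, of _ m a b] unfolding ab(1)
      by (intro nn_integral_mono) (auto simp: indicator_def intro!: ennreal_leI)
    also have "\<dots> = ennreal B * emeasure (lborel_coord m) X" using XU by (simp add: nn_integral_cmult_indicator)
    also have "emeasure (lborel_coord m) X = ennreal (\<Prod>i<m. b i - a i)"
      unfolding ab(1) by (rule emeasure_hbox) (use ab(2) in \<open>auto simp: less_imp_le\<close>)
    finally have "emeasure jacobian_measure X \<noteq> \<infinity>" by (auto simp: ennreal_mult_eq_top_iff top_unique)
    moreover have "X \<in> G" unfolding G_def using ab by blast
    ultimately show "emeasure image_measure X \<noteq> \<infinity>" using eqG by simp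
  qed (rule eqG)
qed

theorem change_of_variables:
  fixes g :: "(nat \<Rightarrow> real) \<Rightarrow> ennreal"
  assumes A: "A \<in> sets (lborel_coord m)" "A \<subseteq> U"
    and g: "g \<in> borel_measurable (restrict_space (lborel_coord m) V)"
  shows "(\<integral>\<^sup>+y\<in>\<psi> ` A. g y \<partial>lborel_coord m) = (\<integral>\<^sup>+p\<in>A. g (\<psi> p) * ennreal \<bar>fdet m (J p)\<bar> \<partial>lborel_coord m)"
proof -
  let ?U = "restrict_space (lborel_coord m) U" and ?V = "restrict_space (lborel_coord m) V"
  have Us: "U \<inter> space (lborel_coord m) \<in> sets (lborel_coord m)" and Vs: "V \<inter> space (lborel_coord m) \<in> sets (lborel_coord m)"
    using openin_sets[OF openU] openin_sets[OF openV] Ucs Vcs by (auto simp: Int_absorb2)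
  have \<psi>m: "\<psi> \<in> measurable ?U ?V"
  proof (rule measurable_restrict_space2)
    show "\<psi> \<in> space ?U \<rightarrow> V" using \<psi>V space_restrict_U by auto
    show "\<psi> \<in> measurable ?U (lborel_coord m)"
    proof (rule measurable_into_coord)
      show "(\<lambda>x. \<psi> x i) \<in> borel_measurable ?U" if "i < m" for i
        by (rule cont_on_coord_measurable[OF openU C1D(1)[OF \<psi>C1[OF that]]])
      show "\<psi> x \<in> cs m" if "x \<in> space ?U" for x using that \<psi>V Vcs space_restrict_U by auto
    qed
  qed
  have A': "A \<in> sets ?U" using A sets_restrict_U by simp
  have gm: "(\<lambda>p. g (\<psi> p)) \<in> borel_measurable ?U" by (rule measurable_compose[OF \<psi>m g])
  have f: "(\<lambda>p. g (\<psi> p) * indicator A p) \<in> borel_measurable ?U"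
    by (intro borel_measurable_times_ennreal gm borel_measurable_indicator A')
  have "(\<integral>\<^sup>+y\<in>\<psi> ` A. g y \<partial>lborel_coord m) = (\<integral>\<^sup>+y. g y * indicator (\<psi> ` A) y * indicator V y \<partial>lborel_coord m)"
    by (rule nn_integral_cong) (use A \<psi>V in \<open>auto simp: indicator_def\<close>)
  also have "\<dots> = (\<integral>\<^sup>+y. g y * indicator (\<psi> ` A) y \<partial>?V)"
    by (rule nn_integral_restrict_space[OF Vs, symmetric])
  also have "\<dots> = (\<integral>\<^sup>+y. g (\<psi> (\<phi> y)) * indicator A (\<phi> y) \<partial>?V)"
  proof (rule nn_integral_cong)
    fix y assume "y \<in> space ?V"
    then have y: "y \<in> V" by (simp add: space_restrict_V)
    then have "y \<in> \<psi> ` A \<longleftrightarrow> \<phi> y \<in> A" using \<psi>_image[OF A(2)] by blast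
    then show "g y * indicator (\<psi> ` A) y = g (\<psi> (\<phi> y)) * indicator A (\<phi> y)"
      using \<psi>\<phi>[OF y] by (simp add: indicator_def)
  qed
  also have "\<dots> = (\<integral>\<^sup>+p. g (\<psi> p) * indicator A p \<partial>image_measure)"
    unfolding image_measure_def by (rule nn_integral_distr[OF \<phi>_measurable', symmetric]) (use f in simp)
  also have "\<dots> = (\<integral>\<^sup>+p. ennreal \<bar>fdet m (J p)\<bar> * (g (\<psi> p) * indicator A p) \<partial>?U)"
    unfolding image_measure_eq_jacobian_measure jacobian_measure_def
    by (rule nn_integral_density[OF det_J_measurable f])
  also have "\<dots> = (\<integral>\<^sup>+p. ennreal \<bar>fdet m (J p)\<bar> * (g (\<psi> p) * indicator A p) * indicator U p \<partial>lborel_coord m)"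
    by (rule nn_integral_restrict_space[OF Us])
  also have "\<dots> = (\<integral>\<^sup>+p\<in>A. g (\<psi> p) * ennreal \<bar>fdet m (J p)\<bar> \<partial>lborel_coord m)"
    by (rule nn_integral_cong) (use A in \<open>auto simp: indicator_def mult.commute\<close>)
  finally show ?thesis .
qed

end

section \<open>Integration by parts in coordinates\<close>

lemma openin_compl_kbox: "openin (coord_space m) (cs m - kbox m a b)"
proof -
  have "closedin (coord_space m) (kbox m a b)"
    unfolding kbox_def closedin_product_topology by simp
  then show ?thesis using openin_diff[OF openin_cs] by blast
qed

lemma cont_on_coord_measurable_cs:
  assumes "cont_on_coord m (cs m) h"
  shows "h \<in> borel_measurable (lborel_coord m)"
proof -
  have "h \<in> borel_measurable (restrict_space (lborel_coord m) (space (lborel_coord m)))"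
    using cont_on_coord_measurable[OF openin_cs assms] by simp
  then have "(\<lambda>p. indicator (cs m) p *\<^sub>R h p) \<in> borel_measurable (lborel_coord m)"
    using openin_sets[OF openin_cs] by (subst (asm) borel_measurable_restrict_space_iff) simp_all
  then show ?thesis
    by (rule measurable_cong[THEN iffD1, rotated]) simp
qed

lemma integrable_compact_support:
  assumes h: "cont_on_coord m (cs m) h" and supp: "\<And>p. p \<in> cs m \<Longrightarrow> p \<notin> kbox m a b \<Longrightarrow> h p = 0"
  shows "integrable (lborel_coord m) h"
proof -
  have sub: "kbox m a b \<subseteq> cs m" by (auto simp: kbox_iff)
  obtain B where B: "\<forall>p\<in>kbox m a b. \<bar>h p\<bar> \<le> B"
    using cont_on_coord_bounded[OF compactin_kbox sub h] by blast
  have fin: "emeasure (lborel_coord m) (kbox m a b) < \<infinity>"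
  proof (cases "\<forall>i<m. a i \<le> b i")
    case True
    then show ?thesis by (subst emeasure_kbox) auto
  next
    case False
    then obtain i where "i < m" "b i < a i" by (auto simp: not_le)
    then have "kbox m a b = {}" by (force simp: kbox_iff)
    then show ?thesis by simp
  qed
  show ?thesis
    by (rule integrableI_bounded_set[where A = "kbox m a b" and B = B])
       (use B supp fin cont_on_coord_measurable_cs[OF h] in auto)
qed

text \<open>Integrating coordinate i first, the fundamental theorem leaves two boundary values
  outside the support. This is the divergence theorem for compactly supported fields, one component
  at a time.\<close>

lemma integral_partial_deriv_zero:
  assumes W: "C1 m (cs m) W" and supp: "\<And>p. p \<in> cs m \<Longrightarrow> p \<notin> kbox m a b \<Longrightarrow> W p = 0" and i: "i < m"
  shows "integrable (lborel_coord m) (partial_deriv i W)"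
    and "(\<integral>p. partial_deriv i W p \<partial>lborel_coord m) = 0"
proof -
  have supp': "partial_deriv i W p = 0" if "p \<in> cs m" "p \<notin> kbox m a b" for p
  proof -
    have "partial_deriv i W p = partial_deriv i (\<lambda>_. 0) p"
      by (rule partial_deriv_cong[OF openin_compl_kbox _ i]) (use that supp in auto)
    also have "\<dots> = 0" by (rule partial_deriv_eqI) auto
    finally show ?thesis .
  qed
  show int: "integrable (lborel_coord m) (partial_deriv i W)"
    by (rule integrable_compact_support[OF C1D(3)[OF W i] supp'])
  let ?I = "{..<m} - {i}"
  have I: "finite ?I" "i \<notin> ?I" and ins: "insert i ?I = {..<m}" using i by auto
  have "integrable (Pi\<^sub>M (insert i ?I) (\<lambda>_. lborel)) (partial_deriv i W)"
    using int unfolding ins lborel_coord_def .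
  from lborel_family.product_integral_insert[OF I this]
  have "(\<integral>p. partial_deriv i W p \<partial>lborel_coord m)
      = (\<integral>x. (\<integral>y. partial_deriv i W (x(i := y)) \<partial>lborel) \<partial>Pi\<^sub>M ?I (\<lambda>_. lborel))"
    unfolding ins lborel_coord_def .
  also have "\<dots> = (\<integral>x. 0 \<partial>Pi\<^sub>M ?I (\<lambda>_. lborel :: real measure))"
  proof (rule Bochner_Integration.integral_cong[OF refl])
    fix x assume x: "x \<in> space (Pi\<^sub>M ?I (\<lambda>_. lborel :: real measure))"
    have xi: "x(i := t) \<in> cs m" for t
      using x i by (auto simp: space_PiM PiE_iff extensional_def)
    \<comment> \<open>Beyond the support in direction i; the maximum keeps
      \<open>lo \<le> hi\<close> even when the box is empty.\<close>
    define lo hi where "lo = a i - 1" and "hi = max (a i) (b i) + 1"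
    have out: "x(i := y) \<notin> kbox m a b" if "y < a i \<or> y > b i" for y
      using that i by (auto simp: kbox_iff)
    have "(\<integral>y. partial_deriv i W (x(i := y)) \<partial>lborel) = (\<integral>y. partial_deriv i W (x(i := y)) * indicator {lo..hi} y \<partial>lborel)"
    proof (rule Bochner_Integration.integral_cong[OF refl])
      fix y
      show "partial_deriv i W (x(i := y)) = partial_deriv i W (x(i := y)) * indicator {lo..hi} y"
      proof (cases "y \<in> {lo..hi}")
        case False
        then have "y < a i \<or> y > b i" by (auto simp: lo_def hi_def)
        then show ?thesis using supp'[OF xi out] by simp
      qed simp
    qed
    also have "\<dots> = W (x(i := hi)) - W (x(i := lo))"
    proof (rule integral_FTC_Icc_real)
      show "lo \<le> hi" by (simp add: lo_def hi_def)
      fix y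
      show "DERIV (\<lambda>y. W (x(i := y))) y :> partial_deriv i W (x(i := y))"
        using C1D(2)[OF W i xi[of y]] by simp
      have "cont_on_coord m (cs m) (partial_deriv i W)" by (rule C1D(3)[OF W i])
      note c = this[unfolded cont_on_coord_iff[OF openin_cs], rule_format, OF xi[of y]]
      show "isCont (\<lambda>y. partial_deriv i W (x(i := y))) y"
        unfolding continuous_at_eps_delta
      proof (intro allI impI)
        fix e :: real assume "e > 0"
        then obtain d where d: "d > 0" "\<forall>q\<in>cs m. near m d (x(i := y)) q \<longrightarrow> q \<in> cs m \<and> \<bar>partial_deriv i W q - partial_deriv i W (x(i := y))\<bar> < e"
          using c by blast
        have "near m d (x(i := y)) (x(i := y'))" if "dist y' y < d" for y'
          using that d(1) by (auto simp: near_def dist_real_def)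
        then show "\<exists>d>0. \<forall>y'. dist y' y < d \<longrightarrow> dist (partial_deriv i W (x(i := y'))) (partial_deriv i W (x(i := y))) < e"
          using d xi by (intro exI[of _ d]) (auto simp: dist_real_def)
      qed
    qed
    also have "\<dots> = 0"
    proof -
      have "lo < a i" "hi > b i" by (auto simp: lo_def hi_def)
      then show ?thesis using supp[OF xi out, of hi] supp[OF xi out, of lo] by simp
    qed
    finally show "(\<integral>y. partial_deriv i W (x(i := y)) \<partial>lborel) = 0" .
  qed
  finally show "(\<integral>p. partial_deriv i W p \<partial>lborel_coord m) = 0" by simp
qed

text \<open>V and the complement of the closed box form an open cover of the space, and the
  extension is C1 on each of them.\<close>

lemma C1_extend_by_zero:
  assumes V: "openin (coord_space m) V" and w: "C1 m V w" and K: "kbox m a b \<subseteq> V"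
    and supp: "\<And>p. p \<in> V \<Longrightarrow> p \<notin> kbox m a b \<Longrightarrow> w p = 0"
  shows "C1 m (cs m) (\<lambda>p. if p \<in> V then w p else 0)"
proof (rule C1_local[OF openin_cs])
  fix p assume p: "p \<in> cs m"
  have Vcs: "V \<subseteq> cs m" using V openin_coord by blast
  show "\<exists>W. openin (coord_space m) W \<and> p \<in> W \<and> W \<subseteq> cs m \<and> C1 m W (\<lambda>p. if p \<in> V then w p else 0)"
  proof (cases "p \<in> V")
    case True
    moreover have "C1 m V (\<lambda>p. if p \<in> V then w p else 0)" by (rule C1_cong[OF V w]) simp
    ultimately show ?thesis using V Vcs by (intro exI[of _ V]) simp
  next
    case False
    have "C1 m (cs m - kbox m a b) (\<lambda>p. if p \<in> V then w p else 0)"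
      by (rule C1_cong[OF openin_compl_kbox C1_const[of m _ 0]]) (use supp in auto)
    moreover have "p \<in> cs m - kbox m a b" using False K p by blast
    ultimately show ?thesis using openin_compl_kbox by (intro exI[of _ "cs m - kbox m a b"]) simp
  qed
qed

lemma partial_deriv_mult:
  assumes "C1 m V f" "C1 m V g" "i < m" "p \<in> V"
  shows "partial_deriv i (\<lambda>p. f p * g p) p = partial_deriv i f p * g p + f p * partial_deriv i g p"
  using DERIV_mult[OF C1D(2)[OF assms(1,3,4)] C1D(2)[OF assms(2-4)]]
  by (intro partial_deriv_eqI) (simp add: mult.commute add.commute)

lemma partial_deriv_sum:
  assumes "\<And>a. a \<in> I \<Longrightarrow> C1 m V (f a)" "i < m" "p \<in> V"
  shows "partial_deriv i (\<lambda>p. \<Sum>a\<in>I. f a p) p = (\<Sum>a\<in>I. partial_deriv i (f a) p)"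
  by (intro partial_deriv_eqI DERIV_sum C1D(2)[OF assms]) auto

lemma partial_deriv_const: "partial_deriv i (\<lambda>_. c) p = 0"
  by (intro partial_deriv_eqI) auto

lemma partial_deriv_cmult:
  assumes "C1 m V f" "i < m" "p \<in> V"
  shows "partial_deriv i (\<lambda>p. c * f p) p = c * partial_deriv i f p"
  by (intro partial_deriv_eqI DERIV_cmult C1D(2)[OF assms])

lemma partial_deriv_inner:
  assumes "\<And>a. a \<le> n \<Longrightarrow> C1 m V (f a)" "\<And>a. a \<le> n \<Longrightarrow> C1 m V (g a)" "i < m" "p \<in> V"
  shows "partial_deriv i (\<lambda>p. \<Sum>a\<le>(n::nat). f a p * g a p) p =
    (\<Sum>a\<le>n. partial_deriv i (f a) p * g a p) + (\<Sum>a\<le>n. f a p * partial_deriv i (g a) p)"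
proof -
  have "partial_deriv i (\<lambda>p. \<Sum>a\<le>n. f a p * g a p) p = (\<Sum>a\<le>n. partial_deriv i (\<lambda>p. f a p * g a p) p)"
    by (rule partial_deriv_sum[of _ m V]) (use assms in \<open>auto intro: C1_mult\<close>)
  also have "\<dots> = (\<Sum>a\<le>n. partial_deriv i (f a) p * g a p + f a p * partial_deriv i (g a) p)"
    by (intro sum.cong partial_deriv_mult[of m V]) (use assms in auto)
  finally show ?thesis by (simp add: sum.distrib)
qed

section \<open>The Laplacian of a linear function on a minimal submanifold of the sphere\<close>

text \<open>\<open>G\<close>, \<open>h\<close> and \<open>S\<close> are parameters with defining equations only to keep the hypothesis \<open>minimal\<close> readable.\<close>

locale minimal_chart =
  fixes m n :: nat and V :: "(nat \<Rightarrow> real) set" and X :: "nat \<Rightarrow> (nat \<Rightarrow> real) \<Rightarrow> real"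
    and G :: "(nat \<Rightarrow> real) \<Rightarrow> nat \<Rightarrow> nat \<Rightarrow> real" and h :: "(nat \<Rightarrow> real) \<Rightarrow> nat \<Rightarrow> nat \<Rightarrow> real"
    and S :: "(nat \<Rightarrow> real) \<Rightarrow> nat \<Rightarrow> nat \<Rightarrow> nat \<Rightarrow> real"
  assumes openV: "openin (coord_space m) V"
    and XC1: "\<And>a. a \<le> n \<Longrightarrow> C1 m V (X a)"
    and dXC1: "\<And>a i. a \<le> n \<Longrightarrow> i < m \<Longrightarrow> C1 m V (partial_deriv i (X a))"
    and sphere: "\<And>q. q \<in> V \<Longrightarrow> (\<Sum>a\<le>n. X a q * X a q) = 1"
    and G_def: "G = (\<lambda>q i j. \<Sum>a\<le>n. partial_deriv i (X a) q * partial_deriv j (X a) q)"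
    and h_def: "h = (\<lambda>q. finv m (G q))"
    and S_def: "S = (\<lambda>q i j a. partial_deriv i (partial_deriv j (X a)) q)"
    and G_pos: "\<And>q. q \<in> V \<Longrightarrow> pos_def m (G q)"
    and minimal: "\<And>q a. q \<in> V \<Longrightarrow> a \<le> n \<Longrightarrow>
      (\<Sum>i<m. \<Sum>j<m. h q i j * ((S q i j a - (\<Sum>b\<le>n. S q i j b * X b q) * X a q) -
        (\<Sum>k<m. \<Sum>l<m. h q k l * (\<Sum>b\<le>n. (S q i j b - (\<Sum>c\<le>n. S q i j c * X c q) * X b q) * partial_deriv k (X b) q)
           * partial_deriv l (X a) q))) = 0"
begin

lemma G_nonzero: "q \<in> V \<Longrightarrow> fdet m (G q) \<noteq> 0"
  using G_pos pos_def_fdet_nonzero by blast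

lemma G_det_pos: "q \<in> V \<Longrightarrow> fdet m (G q) > 0"
  using G_pos pos_def_fdet_pos by blast

lemma G_sym: "G q i j = G q j i"
  unfolding G_def by (simp add: mult.commute)

lemma h_sym: "q \<in> V \<Longrightarrow> i < m \<Longrightarrow> j < m \<Longrightarrow> h q i j = h q j i"
  unfolding h_def by (rule finv_sym[OF G_nonzero G_sym])

lemma hG: "q \<in> V \<Longrightarrow> i < m \<Longrightarrow> j < m \<Longrightarrow> (\<Sum>k<m. h q i k * G q k j) = (if i = j then 1 else 0)"
  unfolding h_def by (rule finv_left[OF G_nonzero])

lemma Gh: "q \<in> V \<Longrightarrow> i < m \<Longrightarrow> j < m \<Longrightarrow> (\<Sum>k<m. G q i k * h q k j) = (if i = j then 1 else 0)"
  unfolding h_def by (rule finv_right[OF G_nonzero])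

lemma GC1: "i < m \<Longrightarrow> j < m \<Longrightarrow> C1 m V (\<lambda>q. G q i j)"
  unfolding G_def by (intro C1_sum C1_mult dXC1) auto

lemma hC1: "i < m \<Longrightarrow> j < m \<Longrightarrow> C1 m V (\<lambda>q. h q i j)"
  unfolding h_def by (rule C1_finv[OF GC1 G_nonzero])

lemma S_sym: "q \<in> V \<Longrightarrow> i < m \<Longrightarrow> j < m \<Longrightarrow> a \<le> n \<Longrightarrow> S q i j a = S q j i a"
  unfolding S_def by (rule mixed_partials[OF openV]) (auto intro: XC1 dXC1)

lemma X_dX: "q \<in> V \<Longrightarrow> j < m \<Longrightarrow> (\<Sum>a\<le>n. partial_deriv j (X a) q * X a q) = 0"
proof -
  assume q: "q \<in> V" and j: "j < m"
  have "partial_deriv j (\<lambda>q. \<Sum>a\<le>n. X a q * X a q) q = partial_deriv j (\<lambda>_. 1) q"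
    by (rule partial_deriv_cong[OF openV q j]) (rule sphere)
  then have "(\<Sum>a\<le>n. partial_deriv j (X a) q * X a q) + (\<Sum>a\<le>n. X a q * partial_deriv j (X a) q) = 0"
    using partial_deriv_inner[OF XC1 XC1 j q] by (simp add: partial_deriv_const)
  then show ?thesis by (simp add: mult.commute)
qed

text \<open>Differentiate the tangency relation \<open>X_dX\<close> once more. The radial part of
  the second derivatives is minus the metric, and its trace is the source of the eigenvalue
  m.\<close>

lemma X_S: "q \<in> V \<Longrightarrow> i < m \<Longrightarrow> j < m \<Longrightarrow> (\<Sum>a\<le>n. S q i j a * X a q) = - G q i j"
proof -
  assume q: "q \<in> V" and i: "i < m" and j: "j < m"
  have "partial_deriv i (\<lambda>q. \<Sum>a\<le>n. partial_deriv j (X a) q * X a q) q = partial_deriv i (\<lambda>_. 0) q"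
    by (rule partial_deriv_cong[OF openV q i]) (rule X_dX[OF _ j])
  then have "(\<Sum>a\<le>n. S q i j a * X a q) + (\<Sum>a\<le>n. partial_deriv j (X a) q * partial_deriv i (X a) q) = 0"
    using partial_deriv_inner[OF dXC1[OF _ j] XC1 i q] by (simp add: partial_deriv_const S_def)
  then show ?thesis by (simp add: G_def mult.commute)
qed

text \<open>Christoffel symbols of the first kind, obtained from the embedding as products of second
  derivatives with tangent vectors rather than from derivatives of the metric.\<close>

definition \<Gamma> :: "(nat \<Rightarrow> real) \<Rightarrow> nat \<Rightarrow> nat \<Rightarrow> nat \<Rightarrow> real" where
  "\<Gamma> q i j k = (\<Sum>b\<le>n. S q i j b * partial_deriv k (X b) q)"

lemma \<Gamma>_sym: "q \<in> V \<Longrightarrow> i < m \<Longrightarrow> j < m \<Longrightarrow> \<Gamma> q i j k = \<Gamma> q j i k"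
  unfolding \<Gamma>_def by (intro sum.cong) (auto simp: S_sym)

lemma partial_G: "q \<in> V \<Longrightarrow> i < m \<Longrightarrow> j < m \<Longrightarrow> k < m \<Longrightarrow> partial_deriv i (\<lambda>q. G q j k) q = \<Gamma> q i j k + \<Gamma> q i k j"
  using partial_deriv_inner[of n m V "\<lambda>a. partial_deriv j (X a)" "\<lambda>a. partial_deriv k (X a)" i q] dXC1
  unfolding \<Gamma>_def unfolding G_def S_def by (simp add: mult.commute)

text \<open>Takahashi's equation in coordinates. Minimality removes the part of the traced second
  derivatives that is tangent to the sphere and normal to the submanifold; what remains is the
  radial part -m X and the tangential part, which carries the Christoffel symbols.\<close>

lemma trace_S:
  assumes q: "q \<in> V" and a: "a \<le> n"
  shows "(\<Sum>i<m. \<Sum>j<m. h q i j * S q i j a) + real m * X a q =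
    (\<Sum>i<m. \<Sum>j<m. h q i j * (\<Sum>k<m. \<Sum>l<m. h q k l * \<Gamma> q i j k * partial_deriv l (X a) q))"
proof -
  have tr: "(\<Sum>i<m. \<Sum>j<m. h q i j * G q i j) = real m"
  proof -
    have "(\<Sum>i<m. \<Sum>j<m. h q i j * G q i j) = (\<Sum>i<m. \<Sum>j<m. h q i j * G q j i)"
      by (simp add: G_sym[of q])
    also have "\<dots> = (\<Sum>i<m. 1)" by (intro sum.cong refl) (simp add: hG[OF q])
    finally show ?thesis by simp
  qed
  \<comment> \<open>Projection to the sphere adds a multiple of X, which is orthogonal to the
    tangent vectors and does not affect the tangential part.\<close>
  have \<Gamma>': "(\<Sum>b\<le>n. (S q i j b + s * X b q) * partial_deriv k (X b) q) = \<Gamma> q i j k"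
    if "k < m" for i j k s
  proof -
    have "(\<Sum>b\<le>n. (S q i j b + s * X b q) * partial_deriv k (X b) q) = \<Gamma> q i j k + s * (\<Sum>b\<le>n. partial_deriv k (X b) q * X b q)"
      unfolding \<Gamma>_def distrib_right sum.distrib sum_distrib_left by (simp add: mult_ac)
    then show ?thesis using X_dX[OF q that] by simp
  qed
  have "0 = (\<Sum>i<m. \<Sum>j<m. h q i j * ((S q i j a + G q i j * X a q) -
        (\<Sum>k<m. \<Sum>l<m. h q k l * \<Gamma> q i j k * partial_deriv l (X a) q)))"
    unfolding minimal[OF q a, symmetric]
    by (intro sum.cong refl arg_cong2[where f = "(*)"] arg_cong2[where f = "(-)"]) (auto simp: X_S[OF q] \<Gamma>')
  also have "\<dots> = (\<Sum>i<m. \<Sum>j<m. h q i j * S q i j a) + (\<Sum>i<m. \<Sum>j<m. h q i j * G q i j) * X a q -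
     (\<Sum>i<m. \<Sum>j<m. h q i j * (\<Sum>k<m. \<Sum>l<m. h q k l * \<Gamma> q i j k * partial_deriv l (X a) q))"
    by (simp add: right_diff_distrib distrib_left sum_subtractf sum.distrib sum_distrib_right mult.assoc)
  finally show ?thesis unfolding tr by simp
qed

section \<open>Volume density and derivatives of the inverse metric\<close>

definition vol_density :: "(nat \<Rightarrow> real) \<Rightarrow> real" where
  "vol_density q = sqrt (fdet m (G q))"

lemma vol_densityC1: "C1 m V vol_density"
  unfolding vol_density_def[abs_def] by (intro C1_sqrt C1_fdet GC1 G_det_pos)

text \<open>The logarithmic derivative of the density is a contracted Christoffel symbol: Jacobi's
  formula applied to \<open>partial_G\<close>, whose two terms contribute equally because h is
  symmetric. This cancels the 1/2 from the square root.\<close>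

lemma partial_vol_density:
  assumes q: "q \<in> V" and i: "i < m"
  shows "partial_deriv i vol_density q = vol_density q * (\<Sum>j<m. \<Sum>k<m. h q j k * \<Gamma> q i j k)"
proof (rule partial_deriv_eqI)
  define d where "d = fdet m (G q)"
  have d: "d > 0" unfolding d_def by (rule G_det_pos[OF q])
  have cof: "fcof m (G q) j k = d * h q j k" if "j < m" "k < m" for j k
    using h_sym[OF q that] d by (simp add: h_def finv_def d_def)
  have "DERIV (\<lambda>t. fdet m (G (q(i := t)))) (q i) :>
     (\<Sum>j<m. \<Sum>k<m. (\<Gamma> q i j k + \<Gamma> q i k j) * fcof m (G (q(i := q i))) j k)"
    using C1D(2)[OF GC1 i q] partial_G[OF q i] by (intro DERIV_fdet) auto
  also have "(\<Sum>j<m. \<Sum>k<m. (\<Gamma> q i j k + \<Gamma> q i k j) * fcof m (G (q(i := q i))) j k)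
     = d * ((\<Sum>j<m. \<Sum>k<m. h q j k * \<Gamma> q i j k) + (\<Sum>j<m. \<Sum>k<m. h q j k * \<Gamma> q i k j))"
    by (simp add: cof distrib_right sum.distrib sum_distrib_left mult.assoc mult.commute mult.left_commute distrib_left)
  also have "(\<Sum>j<m. \<Sum>k<m. h q j k * \<Gamma> q i k j) = (\<Sum>j<m. \<Sum>k<m. h q j k * \<Gamma> q i j k)"
    by (subst sum.swap) (intro sum.cong refl, simp add: h_sym[OF q])
  finally have D: "DERIV (\<lambda>t. fdet m (G (q(i := t)))) (q i) :> 2 * d * (\<Sum>j<m. \<Sum>k<m. h q j k * \<Gamma> q i j k)"
    by (rule DERIV_cong) simp
  have "DERIV sqrt (fdet m (G (q(i := q i)))) :> inverse (sqrt d) / 2"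
    using DERIV_real_sqrt[OF d] by (simp add: d_def)
  from DERIV_chain2[OF this D]
  have "DERIV (\<lambda>t. vol_density (q(i := t))) (q i) :> inverse (sqrt d) / 2 * (2 * d * (\<Sum>j<m. \<Sum>k<m. h q j k * \<Gamma> q i j k))"
    by (simp add: vol_density_def)
  moreover have "inverse (sqrt d) * d = vol_density q"
    using d by (simp add: vol_density_def d_def[symmetric] field_simps)
  ultimately show "DERIV (\<lambda>t. vol_density (q(i := t))) (q i) :> vol_density q * (\<Sum>j<m. \<Sum>k<m. h q j k * \<Gamma> q i j k)"
    by (simp add: mult.assoc[symmetric])
qed

text \<open>Derivative of an inverse matrix: differentiate h G = 1 and multiply by h from the
  right.\<close>

lemma partial_h:
  assumes q: "q \<in> V" and i: "i < m" and s: "s < m" and l: "l < m"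
  shows "partial_deriv i (\<lambda>q. h q s l) q = - (\<Sum>j<m. \<Sum>k<m. h q s j * (\<Gamma> q i j k + \<Gamma> q i k j) * h q k l)"
proof -
  have z: "(\<Sum>j<m. partial_deriv i (\<lambda>q. h q s j) q * G q j k) = - (\<Sum>j<m. h q s j * (\<Gamma> q i j k + \<Gamma> q i k j))" if k: "k < m" for k
  proof -
    have "partial_deriv i (\<lambda>q. \<Sum>j<m. h q s j * G q j k) q = partial_deriv i (\<lambda>_. if s = k then 1 else 0) q"
      by (rule partial_deriv_cong[OF openV q i]) (use hG s k in auto)
    moreover have "partial_deriv i (\<lambda>q. \<Sum>j<m. h q s j * G q j k) q = (\<Sum>j<m. partial_deriv i (\<lambda>q. h q s j * G q j k) q)"
      by (rule partial_deriv_sum[OF _ i q]) (use s k in \<open>auto intro: C1_mult hC1 GC1\<close>)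
    moreover have "\<dots> = (\<Sum>j<m. partial_deriv i (\<lambda>q. h q s j) q * G q j k + h q s j * partial_deriv i (\<lambda>q. G q j k) q)"
      by (intro sum.cong refl partial_deriv_mult[OF _ _ i q]) (use s k in \<open>auto intro: hC1 GC1\<close>)
    ultimately show ?thesis using partial_G[OF q i] k by (simp add: partial_deriv_const sum.distrib)
  qed
  have "partial_deriv i (\<lambda>q. h q s l) q = (\<Sum>j<m. partial_deriv i (\<lambda>q. h q s j) q * (\<Sum>k<m. G q j k * h q k l))"
    using l by (simp add: Gh[OF q] sum_delta_right)
  also have "\<dots> = (\<Sum>j<m. \<Sum>k<m. partial_deriv i (\<lambda>q. h q s j) q * G q j k * h q k l)"
    by (simp add: sum_distrib_left mult.assoc)
  also have "\<dots> = (\<Sum>k<m. (\<Sum>j<m. partial_deriv i (\<lambda>q. h q s j) q * G q j k) * h q k l)"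
    unfolding sum_distrib_right by (rule sum.swap)
  also have "\<dots> = (\<Sum>k<m. - (\<Sum>j<m. h q s j * (\<Gamma> q i j k + \<Gamma> q i k j)) * h q k l)"
    by (intro sum.cong refl) (simp add: z)
  also have "\<dots> = - (\<Sum>k<m. \<Sum>j<m. h q s j * (\<Gamma> q i j k + \<Gamma> q i k j) * h q k l)"
    by (simp add: sum_distrib_right sum_negf)
  also have "(\<Sum>k<m. \<Sum>j<m. h q s j * (\<Gamma> q i j k + \<Gamma> q i k j) * h q k l) = (\<Sum>j<m. \<Sum>k<m. h q s j * (\<Gamma> q i j k + \<Gamma> q i k j) * h q k l)"
    by (rule sum.swap)
  finally show ?thesis .
qed

lemma sum3_rotate: "(\<Sum>i<m. \<Sum>j<m. \<Sum>k<m. F i j k) = (\<Sum>k<m. \<Sum>i<m. \<Sum>j<m. (F i j k :: real))"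
proof -
  have "(\<Sum>i<m. \<Sum>j<m. \<Sum>k<m. F i j k) = (\<Sum>i<m. \<Sum>k<m. \<Sum>j<m. F i j k)"
    by (intro sum.cong refl sum.swap)
  also have "\<dots> = (\<Sum>k<m. \<Sum>i<m. \<Sum>j<m. F i j k)" by (rule sum.swap)
  finally show ?thesis .
qed

text \<open>Three contracted Christoffel terms arise, one from the density and two from h. Symmetry
  in the first two indices and a renaming identify the density term with one of the others; the
  survivor is the contraction that also occurs in \<open>trace_S\<close>.\<close>

lemma divergence_density_h:
  assumes q: "q \<in> V" and l: "l < m"
  shows "(\<Sum>i<m. partial_deriv i (\<lambda>q. vol_density q * h q i l) q) =
    - vol_density q * (\<Sum>i<m. \<Sum>j<m. \<Sum>k<m. h q i j * h q k l * \<Gamma> q i j k)"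
proof -
  let ?r = "vol_density q"
  have "partial_deriv i (\<lambda>q. vol_density q * h q i l) q =
      ?r * ((\<Sum>j<m. \<Sum>k<m. h q j k * \<Gamma> q i j k * h q i l) - (\<Sum>j<m. \<Sum>k<m. h q i j * h q k l * \<Gamma> q i j k)
         - (\<Sum>j<m. \<Sum>k<m. h q i j * h q k l * \<Gamma> q i k j))" if i: "i < m" for i
  proof -
    have "partial_deriv i (\<lambda>q. vol_density q * h q i l) q =
       partial_deriv i vol_density q * h q i l + ?r * partial_deriv i (\<lambda>q. h q i l) q"
      by (rule partial_deriv_mult[OF vol_densityC1 hC1 i q]) (use i l in auto)
    also have "\<dots> = ?r * ((\<Sum>j<m. \<Sum>k<m. h q j k * \<Gamma> q i j k) * h q i l - (\<Sum>j<m. \<Sum>k<m. h q i j * (\<Gamma> q i j k + \<Gamma> q i k j) * h q k l))"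
      unfolding partial_vol_density[OF q i] partial_h[OF q i i l] by (simp add: algebra_simps)
    also have "(\<Sum>j<m. \<Sum>k<m. h q i j * (\<Gamma> q i j k + \<Gamma> q i k j) * h q k l) =
       (\<Sum>j<m. \<Sum>k<m. h q i j * h q k l * \<Gamma> q i j k) + (\<Sum>j<m. \<Sum>k<m. h q i j * h q k l * \<Gamma> q i k j)"
      by (simp add: sum.distrib[symmetric] algebra_simps)
    finally show ?thesis unfolding sum_distrib_right[symmetric] by (simp add: diff_diff_eq)
  qed
  then have "(\<Sum>i<m. partial_deriv i (\<lambda>q. vol_density q * h q i l) q) =
     ?r * ((\<Sum>i<m. \<Sum>j<m. \<Sum>k<m. h q j k * \<Gamma> q i j k * h q i l) - (\<Sum>i<m. \<Sum>j<m. \<Sum>k<m. h q i j * h q k l * \<Gamma> q i j k)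
         - (\<Sum>i<m. \<Sum>j<m. \<Sum>k<m. h q i j * h q k l * \<Gamma> q i k j))"
    by (simp add: sum_subtractf sum_distrib_left[symmetric])
  also have "(\<Sum>i<m. \<Sum>j<m. \<Sum>k<m. h q i j * h q k l * \<Gamma> q i k j) = (\<Sum>k<m. \<Sum>i<m. \<Sum>j<m. h q i j * h q k l * \<Gamma> q i k j)"
    by (rule sum3_rotate)
  also have "\<dots> = (\<Sum>k<m. \<Sum>i<m. \<Sum>j<m. h q i j * \<Gamma> q k i j * h q k l)"
    by (intro sum.cong refl) (simp add: \<Gamma>_sym[OF q])
  finally show ?thesis by simp
qed

section \<open>Gradients of linear functions and the divergence theorem\<close>

definition gradp :: "((nat \<Rightarrow> real) \<Rightarrow> real) \<Rightarrow> ((nat \<Rightarrow> real) \<Rightarrow> real) \<Rightarrow> (nat \<Rightarrow> real) \<Rightarrow> real" where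
  "gradp u w q = (\<Sum>i<m. \<Sum>l<m. h q i l * partial_deriv l u q * partial_deriv i w q)"

definition height :: "(nat \<Rightarrow> real) \<Rightarrow> (nat \<Rightarrow> real) \<Rightarrow> real" where
  "height v q = (\<Sum>a\<le>n. v a * X a q)"

lemma heightC1: "C1 m V (height v)"
  unfolding height_def[abs_def] by (intro C1_sum C1_mult C1_const XC1) auto

lemma partial_height:
  assumes "q \<in> V" "i < m"
  shows "partial_deriv i (height v) q = (\<Sum>a\<le>n. v a * partial_deriv i (X a) q)"
proof -
  have "partial_deriv i (height v) q = (\<Sum>a\<le>n. partial_deriv i (\<lambda>q. v a * X a q) q)"
    unfolding height_def[abs_def]
    by (rule partial_deriv_sum[OF _ assms(2,1)]) (auto intro!: C1_mult C1_const XC1)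
  also have "\<dots> = (\<Sum>a\<le>n. v a * partial_deriv i (X a) q)"
    by (intro sum.cong refl partial_deriv_cmult[OF _ assms(2,1)]) (auto intro: XC1)
  finally show ?thesis .
qed

lemma dheightC1: "i < m \<Longrightarrow> C1 m V (partial_deriv i (height v))"
  by (rule C1_cong[OF openV, of "\<lambda>q. \<Sum>a\<le>n. v a * partial_deriv i (X a) q"])
     (auto intro!: C1_sum C1_mult C1_const dXC1 simp: partial_height)

lemma partial2_height:
  assumes q: "q \<in> V" and ij: "i < m" "j < m"
  shows "partial_deriv i (partial_deriv j (height v)) q = (\<Sum>a\<le>n. v a * S q i j a)"
proof -
  have "partial_deriv i (partial_deriv j (height v)) q = partial_deriv i (\<lambda>q. \<Sum>a\<le>n. v a * partial_deriv j (X a) q) q"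
    by (rule partial_deriv_cong[OF openV q ij(1)]) (rule partial_height[OF _ ij(2)])
  also have "\<dots> = (\<Sum>a\<le>n. partial_deriv i (\<lambda>q. v a * partial_deriv j (X a) q) q)"
    by (rule partial_deriv_sum[OF _ ij(1) q]) (auto intro!: C1_mult C1_const dXC1 ij)
  also have "\<dots> = (\<Sum>a\<le>n. v a * S q i j a)"
    unfolding S_def by (intro sum.cong refl partial_deriv_cmult[OF _ ij(1) q]) (auto intro: dXC1 ij)
  finally show ?thesis .
qed

text \<open>\<open>trace_S\<close> paired with v, the sums being reordered until the Christoffel
  contraction is the coefficient of a first derivative of the height function.\<close>

lemma trace_hessian_height:
  assumes q: "q \<in> V"
  shows "(\<Sum>i<m. \<Sum>j<m. h q i j * partial_deriv i (partial_deriv j (height v)) q) + real m * height v q =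
    (\<Sum>l<m. (\<Sum>i<m. \<Sum>j<m. \<Sum>k<m. h q i j * h q k l * \<Gamma> q i j k) * partial_deriv l (height v) q)"
proof -
  have "(\<Sum>i<m. \<Sum>j<m. h q i j * partial_deriv i (partial_deriv j (height v)) q) =
     (\<Sum>i<m. \<Sum>j<m. \<Sum>a\<le>n. v a * (h q i j * S q i j a))"
    by (intro sum.cong refl) (simp add: partial2_height[OF q] sum_distrib_left mult.left_commute)
  also have "\<dots> = (\<Sum>i<m. \<Sum>a\<le>n. \<Sum>j<m. v a * (h q i j * S q i j a))"
    by (intro sum.cong refl sum.swap)
  also have "\<dots> = (\<Sum>a\<le>n. v a * (\<Sum>i<m. \<Sum>j<m. h q i j * S q i j a))"
    unfolding sum_distrib_left by (rule sum.swap)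
  finally have "(\<Sum>i<m. \<Sum>j<m. h q i j * partial_deriv i (partial_deriv j (height v)) q) + real m * height v q =
     (\<Sum>a\<le>n. v a * ((\<Sum>i<m. \<Sum>j<m. h q i j * S q i j a) + real m * X a q))"
    by (simp add: height_def sum_distrib_left distrib_left sum.distrib mult.left_commute)
  also have "\<dots> = (\<Sum>a\<le>n. v a * (\<Sum>i<m. \<Sum>j<m. h q i j * (\<Sum>k<m. \<Sum>l<m. h q k l * \<Gamma> q i j k * partial_deriv l (X a) q)))"
    by (intro sum.cong refl) (simp add: trace_S[OF q])
  also have "\<dots> = (\<Sum>a\<le>n. v a * (\<Sum>l<m. (\<Sum>i<m. \<Sum>j<m. \<Sum>k<m. h q i j * h q k l * \<Gamma> q i j k) * partial_deriv l (X a) q))"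
  proof (rule sum.cong[OF refl])
    fix a
    have "(\<Sum>i<m. \<Sum>j<m. h q i j * (\<Sum>k<m. \<Sum>l<m. h q k l * \<Gamma> q i j k * partial_deriv l (X a) q))
        = (\<Sum>i<m. \<Sum>j<m. \<Sum>k<m. \<Sum>l<m. h q i j * h q k l * \<Gamma> q i j k * partial_deriv l (X a) q)"
      by (simp add: sum_distrib_left mult.assoc)
    also have "\<dots> = (\<Sum>i<m. \<Sum>l<m. \<Sum>j<m. \<Sum>k<m. h q i j * h q k l * \<Gamma> q i j k * partial_deriv l (X a) q)"
      by (intro sum.cong refl sum3_rotate)
    also have "\<dots> = (\<Sum>l<m. \<Sum>i<m. \<Sum>j<m. \<Sum>k<m. h q i j * h q k l * \<Gamma> q i j k * partial_deriv l (X a) q)"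
      by (rule sum.swap)
    finally have "(\<Sum>i<m. \<Sum>j<m. h q i j * (\<Sum>k<m. \<Sum>l<m. h q k l * \<Gamma> q i j k * partial_deriv l (X a) q))
        = (\<Sum>l<m. (\<Sum>i<m. \<Sum>j<m. \<Sum>k<m. h q i j * h q k l * \<Gamma> q i j k) * partial_deriv l (X a) q)"
      by (simp only: sum_distrib_right)
    then show "v a * (\<Sum>i<m. \<Sum>j<m. h q i j * (\<Sum>k<m. \<Sum>l<m. h q k l * \<Gamma> q i j k * partial_deriv l (X a) q))
        = v a * (\<Sum>l<m. (\<Sum>i<m. \<Sum>j<m. \<Sum>k<m. h q i j * h q k l * \<Gamma> q i j k) * partial_deriv l (X a) q)"
      by simp
  qed
  also have "\<dots> = (\<Sum>a\<le>n. \<Sum>l<m. (\<Sum>i<m. \<Sum>j<m. \<Sum>k<m. h q i j * h q k l * \<Gamma> q i j k) * (v a * partial_deriv l (X a) q))"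
    unfolding sum_distrib_left by (simp only: mult.left_commute)
  also have "\<dots> = (\<Sum>l<m. \<Sum>a\<le>n. (\<Sum>i<m. \<Sum>j<m. \<Sum>k<m. h q i j * h q k l * \<Gamma> q i j k) * (v a * partial_deriv l (X a) q))"
    by (rule sum.swap)
  also have "\<dots> = (\<Sum>l<m. (\<Sum>i<m. \<Sum>j<m. \<Sum>k<m. h q i j * h q k l * \<Gamma> q i j k) * partial_deriv l (height v) q)"
    by (intro sum.cong refl) (simp add: partial_height[OF q] sum_distrib_left)
  finally show ?thesis .
qed

text \<open>Component i of w times the gradient of the height function, multiplied by the volume
  density. The plain coordinate divergence of this field is the density times the Riemannian
  divergence.\<close>

definition flux :: "(nat \<Rightarrow> real) \<Rightarrow> ((nat \<Rightarrow> real) \<Rightarrow> real) \<Rightarrow> nat \<Rightarrow> (nat \<Rightarrow> real) \<Rightarrow> real" where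
  "flux v w i q = (\<Sum>l<m. vol_density q * h q i l * partial_deriv l (height v) q) * w q"

lemma fluxC1: "C1 m V w \<Longrightarrow> i < m \<Longrightarrow> C1 m V (flux v w i)"
  unfolding flux_def[abs_def]
  by (intro C1_mult C1_sum vol_densityC1 hC1 dheightC1) auto

text \<open>The first-order term of \<open>divergence_density_h\<close> cancels the Christoffel term
  of \<open>trace_hessian_height\<close>. What remains is div(w grad f) = <grad f, grad w> - m f w,
  obtained without defining a Laplace operator.\<close>

lemma divergence_flux:
  assumes q: "q \<in> V" and w: "C1 m V w"
  shows "(\<Sum>i<m. partial_deriv i (flux v w i) q) = vol_density q * (gradp (height v) w q - real m * height v q * w q)"
proof -
  let ?r = "vol_density q" and ?f = "height v"
  let ?C = "\<lambda>l. \<Sum>i<m. \<Sum>j<m. \<Sum>k<m. h q i j * h q k l * \<Gamma> q i j k"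
  have "partial_deriv i (flux v w i) q =
      (\<Sum>l<m. partial_deriv i (\<lambda>q. vol_density q * h q i l) q * partial_deriv l ?f q) * w q
      + ?r * w q * (\<Sum>l<m. h q i l * partial_deriv i (partial_deriv l ?f) q)
      + ?r * (\<Sum>l<m. h q i l * partial_deriv l ?f q * partial_deriv i w q)" if i: "i < m" for i
  proof -
    have rh: "C1 m V (\<lambda>q. vol_density q * h q i l)" if "l < m" for l
      by (intro C1_mult vol_densityC1 hC1 i that)
    have "partial_deriv i (flux v w i) q =
       partial_deriv i (\<lambda>q. \<Sum>l<m. vol_density q * h q i l * partial_deriv l ?f q) q * w q
       + (\<Sum>l<m. ?r * h q i l * partial_deriv l ?f q) * partial_deriv i w q"
      unfolding flux_def[abs_def]
      by (rule partial_deriv_mult[OF _ w i q]) (auto intro!: C1_sum C1_mult rh dheightC1)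
    also have "partial_deriv i (\<lambda>q. \<Sum>l<m. vol_density q * h q i l * partial_deriv l ?f q) q =
       (\<Sum>l<m. partial_deriv i (\<lambda>q. vol_density q * h q i l * partial_deriv l ?f q) q)"
      by (rule partial_deriv_sum[OF _ i q]) (auto intro!: C1_mult rh dheightC1)
    also have "\<dots> = (\<Sum>l<m. partial_deriv i (\<lambda>q. vol_density q * h q i l) q * partial_deriv l ?f q
        + ?r * h q i l * partial_deriv i (partial_deriv l ?f) q)"
      by (intro sum.cong refl partial_deriv_mult[OF _ _ i q] rh dheightC1) auto
    finally show ?thesis
      unfolding sum.distrib distrib_right sum_distrib_left sum_distrib_right by (simp add: mult_ac)
  qed
  then have "(\<Sum>i<m. partial_deriv i (flux v w i) q) =
      (\<Sum>i<m. \<Sum>l<m. partial_deriv i (\<lambda>q. vol_density q * h q i l) q * partial_deriv l ?f q) * w q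
      + ?r * w q * (\<Sum>i<m. \<Sum>l<m. h q i l * partial_deriv i (partial_deriv l ?f) q) + ?r * gradp ?f w q"
    by (simp add: sum.distrib sum_distrib_left[symmetric] sum_distrib_right[symmetric] gradp_def)
  also have "(\<Sum>i<m. \<Sum>l<m. partial_deriv i (\<lambda>q. vol_density q * h q i l) q * partial_deriv l ?f q)
     = (\<Sum>l<m. (\<Sum>i<m. partial_deriv i (\<lambda>q. vol_density q * h q i l) q) * partial_deriv l ?f q)"
    unfolding sum_distrib_right by (rule sum.swap)
  also have "\<dots> = (\<Sum>l<m. - ?r * ?C l * partial_deriv l ?f q)"
    by (intro sum.cong refl) (simp add: divergence_density_h[OF q])
  also have "\<dots> = - ?r * (\<Sum>l<m. ?C l * partial_deriv l ?f q)"
    by (rule trans[OF _ sum_distrib_left[symmetric]]) (simp only: mult.assoc)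
  also have "(\<Sum>i<m. \<Sum>l<m. h q i l * partial_deriv i (partial_deriv l ?f) q) = (\<Sum>l<m. ?C l * partial_deriv l ?f q) - real m * ?f q"
    using trace_hessian_height[OF q, of v] by simp
  finally show ?thesis by (simp add: algebra_simps)
qed

text \<open>The flux vanishes with w off the box, so its extension by zero is a C1 field with
  compact support, and its divergence integrates to zero.\<close>

theorem weak_laplace_equation:
  assumes w: "C1 m V w" and K: "kbox m a b \<subseteq> V" and supp: "\<And>q. q \<in> V \<Longrightarrow> q \<notin> kbox m a b \<Longrightarrow> w q = 0"
  shows "integrable (lborel_coord m) (\<lambda>q. indicator V q * (vol_density q * (gradp (height v) w q - real m * height v q * w q)))"
    and "(\<integral>q. indicator V q * (vol_density q * (gradp (height v) w q - real m * height v q * w q)) \<partial>lborel_coord m) = 0"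
proof -
  define W where "W i = (\<lambda>q. if q \<in> V then flux v w i q else 0)" for i
  have WC1: "C1 m (cs m) (W i)" if "i < m" for i
    unfolding W_def by (rule C1_extend_by_zero[OF openV fluxC1[OF w that] K]) (use supp in \<open>auto simp: flux_def\<close>)
  have Wsupp: "W i p = 0" if "p \<in> cs m" "p \<notin> kbox m a b" for i p
    using that supp by (auto simp: W_def flux_def)
  have eq: "(\<Sum>i<m. partial_deriv i (W i) q) = indicator V q * (vol_density q * (gradp (height v) w q - real m * height v q * w q))"
    if q: "q \<in> cs m" for q
  proof (cases "q \<in> V")
    case True
    have "partial_deriv i (W i) q = partial_deriv i (flux v w i) q" if "i < m" for i
      by (rule partial_deriv_cong[OF openV True that]) (simp add: W_def)
    then show ?thesis using divergence_flux[OF True w] True by simp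
  next
    case False
    \<comment> \<open>A point off V lies in the open complement of the closed box, where the
      extended field is identically zero.\<close>
    have "partial_deriv i (W i) q = partial_deriv i (\<lambda>_. 0) q" if "i < m" for i
      by (rule partial_deriv_cong[OF openin_compl_kbox _ that, of q a b]) (use False K q Wsupp in auto)
    then show ?thesis using False by (simp add: partial_deriv_const)
  qed
  have int: "integrable (lborel_coord m) (partial_deriv i (W i))" "(\<integral>q. partial_deriv i (W i) q \<partial>lborel_coord m) = 0" if "i < m" for i
    using integral_partial_deriv_zero[OF WC1[OF that] Wsupp that] by auto
  have "integrable (lborel_coord m) (\<lambda>q. \<Sum>i<m. partial_deriv i (W i) q)"
    using int(1) by (intro Bochner_Integration.integrable_sum) auto
  then show "integrable (lborel_coord m) (\<lambda>q. indicator V q * (vol_density q * (gradp (height v) w q - real m * height v q * w q)))"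
    by (rule Bochner_Integration.integrable_cong[OF refl, THEN iffD1, rotated]) (use eq in auto)
  have "(\<integral>q. (\<Sum>i<m. partial_deriv i (W i) q) \<partial>lborel_coord m) = (\<Sum>i<m. \<integral>q. partial_deriv i (W i) q \<partial>lborel_coord m)"
    using int(1) by (intro Bochner_Integration.integral_sum) auto
  also have "\<dots> = 0" using int(2) by simp
  finally have "(\<integral>q. (\<Sum>i<m. partial_deriv i (W i) q) \<partial>lborel_coord m) = 0" .
  moreover have "(\<integral>q. (\<Sum>i<m. partial_deriv i (W i) q) \<partial>lborel_coord m) =
     (\<integral>q. indicator V q * (vol_density q * (gradp (height v) w q - real m * height v q * w q)) \<partial>lborel_coord m)"
    by (rule Bochner_Integration.integral_cong[OF refl]) (use eq in auto)
  ultimately show "(\<integral>q. indicator V q * (vol_density q * (gradp (height v) w q - real m * height v q * w q)) \<partial>lborel_coord m) = 0"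
    by simp
qed

text \<open>Bessel's inequality: \<open>v\<close> has orthogonal components \<open>height v q\<close> along \<open>X\<close> and the gradient along the tangent space.\<close>

lemma gradp_height_le:
  assumes q: "q \<in> V" and v: "(\<Sum>a\<le>n. v a * v a) = 1"
  shows "gradp (height v) (height v) q \<le> 1 - height v q * height v q"
proof -
  define d where "d l = partial_deriv l (height v) q" for l
  define c where "c i = (\<Sum>l<m. h q i l * d l)" for i
  \<comment> \<open>T is the gradient as a vector of the ambient space, c its components in the
    chart.\<close>
  define T where "T a = (\<Sum>i<m. c i * partial_deriv i (X a) q)" for a
  define N where "N = (\<Sum>i<m. c i * d i)"
  define f where "f = height v q"
  have d: "d l = (\<Sum>a\<le>n. v a * partial_deriv l (X a) q)" if "l < m" for l
    using partial_height[OF q that] by (simp add: d_def)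
  have N: "gradp (height v) (height v) q = N"
    by (simp add: gradp_def N_def c_def d_def sum_distrib_right)
  have vT: "(\<Sum>a\<le>n. v a * T a) = N"
  proof -
    have "(\<Sum>a\<le>n. v a * T a) = (\<Sum>a\<le>n. \<Sum>i<m. c i * (v a * partial_deriv i (X a) q))"
      by (simp add: T_def sum_distrib_left mult.left_commute)
    also have "\<dots> = (\<Sum>i<m. \<Sum>a\<le>n. c i * (v a * partial_deriv i (X a) q))" by (rule sum.swap)
    also have "\<dots> = N" unfolding N_def by (intro sum.cong refl) (simp add: d sum_distrib_left)
    finally show ?thesis .
  qed
  have XT: "(\<Sum>a\<le>n. X a q * T a) = 0"
  proof -
    have "(\<Sum>a\<le>n. X a q * T a) = (\<Sum>a\<le>n. \<Sum>i<m. c i * (partial_deriv i (X a) q * X a q))"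
      by (simp add: T_def sum_distrib_left mult.left_commute mult.commute)
    also have "\<dots> = (\<Sum>i<m. \<Sum>a\<le>n. c i * (partial_deriv i (X a) q * X a q))" by (rule sum.swap)
    also have "\<dots> = (\<Sum>i<m. c i * (\<Sum>a\<le>n. partial_deriv i (X a) q * X a q))" by (simp add: sum_distrib_left)
    also have "\<dots> = 0" using X_dX[OF q] by simp
    finally show ?thesis .
  qed
  have dXT: "(\<Sum>a\<le>n. partial_deriv j (X a) q * T a) = d j" if j: "j < m" for j
  proof -
    have "(\<Sum>a\<le>n. partial_deriv j (X a) q * T a) = (\<Sum>a\<le>n. \<Sum>i<m. c i * (partial_deriv j (X a) q * partial_deriv i (X a) q))"
      by (simp add: T_def sum_distrib_left mult.left_commute)
    also have "\<dots> = (\<Sum>i<m. \<Sum>a\<le>n. c i * (partial_deriv j (X a) q * partial_deriv i (X a) q))" by (rule sum.swap)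
    also have "\<dots> = (\<Sum>i<m. G q j i * (\<Sum>l<m. h q i l * d l))" by (simp add: sum_distrib_left G_def c_def mult.commute)
    also have "\<dots> = d j" by (rule inverse_matrix_apply[OF Gh[OF q] j])
    finally show ?thesis .
  qed
  have TT: "(\<Sum>a\<le>n. T a * T a) = N"
  proof -
    have "(\<Sum>a\<le>n. T a * T a) = (\<Sum>a\<le>n. \<Sum>i<m. c i * (partial_deriv i (X a) q * T a))"
      unfolding T_def[of _ ] by (simp add: sum_distrib_right mult.assoc)
    also have "\<dots> = (\<Sum>i<m. \<Sum>a\<le>n. c i * (partial_deriv i (X a) q * T a))" by (rule sum.swap)
    also have "\<dots> = (\<Sum>i<m. c i * (\<Sum>a\<le>n. partial_deriv i (X a) q * T a))" by (simp add: sum_distrib_left)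
    also have "\<dots> = N" unfolding N_def by (intro sum.cong refl) (simp add: dXT)
    finally show ?thesis .
  qed
  have vX: "(\<Sum>a\<le>n. v a * X a q) = f" by (simp add: f_def height_def)
  \<comment> \<open>Squared length of what is left of v after removing its components along the
    tangent space and along the position vector.\<close>
  have "0 \<le> (\<Sum>a\<le>n. (v a - T a - f * X a q) * (v a - T a - f * X a q))" by (intro sum_nonneg) auto
  also have "\<dots> = (\<Sum>a\<le>n. v a * v a) - 2 * (\<Sum>a\<le>n. v a * T a) - 2 * f * (\<Sum>a\<le>n. v a * X a q)
     + (\<Sum>a\<le>n. T a * T a) + 2 * f * (\<Sum>a\<le>n. X a q * T a) + f * f * (\<Sum>a\<le>n. X a q * X a q)"
    by (simp add: sum_distrib_left sum.distrib[symmetric] sum_subtractf[symmetric] algebra_simps)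
  also have "\<dots> = 1 - N - f * f" unfolding v vT XT TT vX sphere[OF q] by simp
  finally show ?thesis unfolding N f_def[symmetric] by simp
qed

end

section \<open>The Riemannian volume of a closed manifold\<close>

locale closed_manifold =
  fixes m :: nat and M :: "'a riemannian"
  assumes closed: "closed_riemannian_manifold m M"
begin

abbreviation T :: "'a topology" where "T \<equiv> mtop M"
abbreviation \<Omega> :: "'a set" where "\<Omega> \<equiv> topspace T"

lemma Hausdorff: "Hausdorff_space T" and compact: "compact_space T" and nonempty: "\<Omega> \<noteq> {}"
  and atlas: "is_smooth_atlas m T (atlas M)" and metric: "riemannian_metric m M"
  using closed by (auto simp: closed_riemannian_manifold_def smooth_manifold_def)

lemma chart: "c \<in> atlas M \<Longrightarrow> is_chart m T c"
  using atlas by (simp add: is_smooth_atlas_def)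

lemma dom_open: "c \<in> atlas M \<Longrightarrow> openin T (chart_dom c)"
  and img_open: "c \<in> atlas M \<Longrightarrow> openin (coord_space m) (chart_img c)"
  using chart by (auto simp: is_chart_def)

lemma dom_sub: "c \<in> atlas M \<Longrightarrow> chart_dom c \<subseteq> \<Omega>"
  using dom_open openin_subset by blast

lemma img_sub: "c \<in> atlas M \<Longrightarrow> chart_img c \<subseteq> cs m"
  by (rule conjunct1[OF iffD1[OF openin_coord img_open]])

lemma chart_homeo:
  "c \<in> atlas M \<Longrightarrow> homeomorphic_map (subtopology T (chart_dom c)) (subtopology (coord_space m) (chart_img c)) (chart_map c)"
  using chart by (simp add: is_chart_def)

lemma chart_inj: "c \<in> atlas M \<Longrightarrow> inj_on (chart_map c) (chart_dom c)"
  using homeomorphic_imp_injective_map[OF chart_homeo] dom_sub by (simp add: Int_absorb1)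

lemma inv_chart: "c \<in> atlas M \<Longrightarrow> q \<in> chart_dom c \<Longrightarrow> chart_inv c (chart_map c q) = q"
  using chart_inj by simp

lemma chart_inv_chart: "p \<in> chart_img c \<Longrightarrow> chart_map c (chart_inv c p) = p"
  by (rule f_inv_into_f)

lemma inv_in_dom: "p \<in> chart_img c \<Longrightarrow> chart_inv c p \<in> chart_dom c"
  by (rule inv_into_into)

lemma chart_img_open:
  assumes c: "c \<in> atlas M" and O: "openin T W" "W \<subseteq> chart_dom c"
  shows "openin (coord_space m) (chart_map c ` W)"
proof -
  have "openin (subtopology T (chart_dom c)) W" using O dom_open[OF c] by (simp add: openin_open_subtopology)
  then have "openin (subtopology (coord_space m) (chart_img c)) (chart_map c ` W)"
    using homeomorphic_imp_open_map[OF chart_homeo[OF c]] unfolding open_map_def by blast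
  then show ?thesis using img_open[OF c] by (simp add: openin_open_subtopology)
qed

lemma chart_preimage_open:
  assumes c: "c \<in> atlas M" and W: "openin (coord_space m) W"
  shows "openin T {q \<in> chart_dom c. chart_map c q \<in> W}"
proof -
  have "continuous_map (subtopology T (chart_dom c)) (coord_space m) (chart_map c)"
    using homeomorphic_imp_continuous_map[OF chart_homeo[OF c]] by (simp add: continuous_map_in_subtopology)
  from openin_continuous_map_preimage[OF this W]
  have "openin (subtopology T (chart_dom c)) {q \<in> chart_dom c. chart_map c q \<in> W}"
    using dom_sub[OF c] by (simp add: Int_absorb1)
  then show ?thesis using dom_open[OF c] by (simp add: openin_open_subtopology)
qed

text \<open>Carries only the Borel sets; its measure is zero. It supplies the sigma-algebra while
  the volume is being constructed.\<close>

definition BM :: "'a measure" where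
  "BM = measure_of \<Omega> {U. openin T U} (\<lambda>_. 0)"

lemma open_sub: "{U. openin T U} \<subseteq> Pow \<Omega>"
  using openin_subset by blast

lemma space_BM [simp]: "space BM = \<Omega>"
  unfolding BM_def by (rule space_measure_of[OF open_sub])

lemma sets_BM: "sets BM = sigma_sets \<Omega> {U. openin T U}"
  unfolding BM_def by (rule sets_measure_of[OF open_sub])

lemma open_BM: "openin T U \<Longrightarrow> U \<in> sets BM"
  unfolding sets_BM by (auto intro: sigma_sets.Basic)

lemma space_restrict_img: "c \<in> atlas M \<Longrightarrow> space (restrict_space (lborel_coord m) (chart_img c)) = chart_img c"
  by (simp add: space_restrict_space Int_absorb2[OF img_sub])

lemma img_sets: "c \<in> atlas M \<Longrightarrow> chart_img c \<inter> space (lborel_coord m) \<in> sets (lborel_coord m)"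
  using openin_sets[OF img_open] img_sub by (simp add: Int_absorb2)

lemma sets_restrict_img:
  "c \<in> atlas M \<Longrightarrow> A \<in> sets (restrict_space (lborel_coord m) (chart_img c)) \<longleftrightarrow> A \<in> sets (lborel_coord m) \<and> A \<subseteq> chart_img c"
  using img_sets by (subst sets_restrict_space_iff) auto

lemma chart_inv_measurable:
  assumes c: "c \<in> atlas M"
  shows "chart_inv c \<in> measurable (restrict_space (lborel_coord m) (chart_img c)) BM"
  unfolding BM_def
proof (rule measurable_measure_of[OF open_sub])
  show "chart_inv c \<in> space (restrict_space (lborel_coord m) (chart_img c)) \<rightarrow> \<Omega>"
    unfolding space_restrict_img[OF c] using dom_sub[OF c] by (auto simp: inv_chart[OF c])
  fix U assume "U \<in> {U. openin T U}"
  then have "openin T (U \<inter> chart_dom c)" using dom_open[OF c] by auto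
  then have "openin (coord_space m) (chart_map c ` (U \<inter> chart_dom c))" by (intro chart_img_open[OF c]) auto
  moreover have "chart_inv c -` U \<inter> chart_img c = chart_map c ` (U \<inter> chart_dom c)"
  proof
    show "chart_inv c -` U \<inter> chart_img c \<subseteq> chart_map c ` (U \<inter> chart_dom c)"
    proof
      fix p assume p: "p \<in> chart_inv c -` U \<inter> chart_img c"
      then show "p \<in> chart_map c ` (U \<inter> chart_dom c)"
        using chart_inv_chart[of p c] inv_in_dom[of p c] by (intro image_eqI[of _ _ "chart_inv c p"]) auto
    qed
  qed (auto simp: inv_chart[OF c])
  ultimately show "chart_inv c -` U \<inter> space (restrict_space (lborel_coord m) (chart_img c)) \<in> sets (restrict_space (lborel_coord m) (chart_img c))"
    using space_restrict_img[OF c] sets_restrict_img[OF c] openin_sets by auto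
qed

lemma chart_image_eq:
  assumes c: "c \<in> atlas M"
  shows "chart_map c ` (A \<inter> chart_dom c) = chart_inv c -` A \<inter> chart_img c"
proof
  show "chart_inv c -` A \<inter> chart_img c \<subseteq> chart_map c ` (A \<inter> chart_dom c)"
  proof
    fix p assume p: "p \<in> chart_inv c -` A \<inter> chart_img c"
    then show "p \<in> chart_map c ` (A \<inter> chart_dom c)"
      using chart_inv_chart[of p c] inv_in_dom[of p c] by (intro image_eqI[of _ _ "chart_inv c p"]) auto
  qed
qed (auto simp: inv_chart[OF c])

lemma chart_image_sets:
  assumes c: "c \<in> atlas M" and A: "A \<in> sets BM"
  shows "chart_map c ` (A \<inter> chart_dom c) \<in> sets (lborel_coord m)"
  using measurable_sets[OF chart_inv_measurable[OF c] A] sets_restrict_img[OF c]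
  unfolding space_restrict_img[OF c] chart_image_eq[OF c] by blast

definition \<rho> :: "'a chart \<Rightarrow> (nat \<Rightarrow> real) \<Rightarrow> real" where
  "\<rho> c p = sqrt (fdet m (metric M c (chart_inv c p)))"

lemma metric_pos_def: "c \<in> atlas M \<Longrightarrow> q \<in> chart_dom c \<Longrightarrow> pos_def m (metric M c q)"
  using metric unfolding riemannian_metric_def pos_def_def by blast

lemma metric_smooth: "c \<in> atlas M \<Longrightarrow> i < m \<Longrightarrow> j < m \<Longrightarrow> smooth_on_coord m (chart_img c) (\<lambda>p. metric M c (chart_inv c p) i j)"
  using metric unfolding riemannian_metric_def by blast

lemma metric_transform: "c \<in> atlas M \<Longrightarrow> d \<in> atlas M \<Longrightarrow> q \<in> chart_dom c \<inter> chart_dom d \<Longrightarrow> i < m \<Longrightarrow> j < m \<Longrightarrow>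
  metric M c q i j = (\<Sum>k<m. \<Sum>l<m. metric M d q k l *
             cderiv c i (\<lambda>r. chart_map d r k) q * cderiv c j (\<lambda>r. chart_map d r l) q)"
  by (rule conjunct2[OF metric[unfolded riemannian_metric_def], rule_format])

lemma \<rho>_pos: "c \<in> atlas M \<Longrightarrow> p \<in> chart_img c \<Longrightarrow> \<rho> c p > 0"
  using pos_def_fdet_pos[OF metric_pos_def[OF _ inv_in_dom]] by (simp add: \<rho>_def)

lemma \<rho>C1: "c \<in> atlas M \<Longrightarrow> C1 m (chart_img c) (\<rho> c)"
  unfolding \<rho>_def[abs_def]
  by (intro C1_sqrt C1_fdet smooth_C1[OF metric_smooth] pos_def_fdet_pos[OF metric_pos_def[OF _ inv_in_dom]])

lemma \<rho>_measurable: "c \<in> atlas M \<Longrightarrow> \<rho> c \<in> borel_measurable (restrict_space (lborel_coord m) (chart_img c))"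
  by (rule cont_on_coord_measurable[OF img_open C1D(1)[OF \<rho>C1]])

definition cv :: "'a chart \<Rightarrow> 'a set \<Rightarrow> ennreal" where
  "cv c A = (\<integral>\<^sup>+p\<in>chart_map c ` A. ennreal (\<rho> c p) \<partial>lborel_coord m)"

text \<open>\<open>cv\<close> turned into a measure on the whole manifold, concentrated on the chart
  domain. As the push-forward of a density it is countably additive by construction.\<close>

definition CM :: "'a chart \<Rightarrow> 'a measure" where
  "CM c = distr (density (restrict_space (lborel_coord m) (chart_img c)) (\<lambda>p. ennreal (\<rho> c p))) BM (chart_inv c)"

lemma sets_CM [simp]: "sets (CM c) = sets BM"
  by (simp add: CM_def)

lemma emeasure_CM:
  assumes c: "c \<in> atlas M" and A: "A \<in> sets BM"
  shows "emeasure (CM c) A = cv c (A \<inter> chart_dom c)"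
proof -
  let ?R = "restrict_space (lborel_coord m) (chart_img c)"
  have "emeasure (CM c) A = emeasure (density ?R (\<lambda>p. ennreal (\<rho> c p))) (chart_map c ` (A \<inter> chart_dom c))"
    unfolding CM_def chart_image_eq[OF c]
    by (subst emeasure_distr) (use chart_inv_measurable[OF c] A in \<open>auto simp: space_restrict_img[OF c]\<close>)
  also have "\<dots> = (\<integral>\<^sup>+p\<in>chart_map c ` (A \<inter> chart_dom c). ennreal (\<rho> c p) \<partial>?R)"
    by (rule emeasure_density) (use \<rho>_measurable[OF c] chart_image_sets[OF c A] sets_restrict_img[OF c] in auto)
  also have "\<dots> = (\<integral>\<^sup>+p. ennreal (\<rho> c p) * indicator (chart_map c ` (A \<inter> chart_dom c)) p * indicator (chart_img c) p \<partial>lborel_coord m)"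
    by (rule nn_integral_restrict_space[OF img_sets[OF c]])
  also have "\<dots> = cv c (A \<inter> chart_dom c)"
    unfolding cv_def by (rule nn_integral_cong) (auto simp: indicator_def)
  finally show ?thesis .
qed

section \<open>Independence of the volume from the chart\<close>

lemma transition_diffeo:
  assumes c: "c \<in> atlas M" and d: "d \<in> atlas M"
  shows "C1_diffeo m (chart_map c ` (chart_dom c \<inter> chart_dom d)) (chart_map d ` (chart_dom c \<inter> chart_dom d))
    (\<lambda>p. chart_map d (chart_inv c p)) (\<lambda>y. chart_map c (chart_inv d y))"
proof
  have sm: "smooth_on_coord m (chart_map c ` (chart_dom c \<inter> chart_dom d)) (\<lambda>p. chart_map d (chart_inv c p) k)"
    if "c \<in> atlas M" "d \<in> atlas M" "k < m" for c d k
    using atlas that unfolding is_smooth_atlas_def by blast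
  show "C1 m (chart_map c ` (chart_dom c \<inter> chart_dom d)) (\<lambda>p. chart_map d (chart_inv c p) k)" if "k < m" for k
    by (rule smooth_C1[OF sm[OF c d that]])
  show "C1 m (chart_map d ` (chart_dom c \<inter> chart_dom d)) (\<lambda>y. chart_map c (chart_inv d y) k)" if "k < m" for k
    using smooth_C1[OF sm[OF d c that]] by (simp add: Int_commute)
  have op: "openin T (chart_dom c \<inter> chart_dom d)" using dom_open c d by blast
  show "openin (coord_space m) (chart_map c ` (chart_dom c \<inter> chart_dom d))"
    "openin (coord_space m) (chart_map d ` (chart_dom c \<inter> chart_dom d))"
    by (auto intro!: chart_img_open op c d)
qed (auto simp: inv_chart[OF c] inv_chart[OF d])

text \<open>The transformation law reads g_c = J^T g_d J, so the determinants differ by the square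
  of det J. The square root leaves the absolute value, which is the factor of the substitution
  formula.\<close>

lemma \<rho>_transform:
  assumes c: "c \<in> atlas M" and d: "d \<in> atlas M" and q: "q \<in> chart_dom c \<inter> chart_dom d"
  shows "\<rho> c (chart_map c q) = \<rho> d (chart_map d q) * \<bar>fdet m (\<lambda>k j. partial_deriv j (\<lambda>p. chart_map d (chart_inv c p) k) (chart_map c q))\<bar>"
proof -
  define J where "J = (\<lambda>k j. partial_deriv j (\<lambda>p. chart_map d (chart_inv c p) k) (chart_map c q))"
  have "fdet m (metric M c q) = fdet m (\<lambda>i j. \<Sum>k<m. J k i * (\<Sum>l<m. metric M d q k l * J l j))"
  proof (rule fdet_cong)
    fix i j assume "i < m" "j < m"
    then show "metric M c q i j = (\<Sum>k<m. J k i * (\<Sum>l<m. metric M d q k l * J l j))"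
      unfolding metric_transform[OF c d q \<open>i < m\<close> \<open>j < m\<close>] cderiv_def J_def[symmetric]
      by (simp add: J_def sum_distrib_left mult.assoc mult.left_commute)
  qed
  also have "\<dots> = fdet m (\<lambda>i k. J k i) * (fdet m (metric M d q) * fdet m J)"
    unfolding fdet_mult[of m "\<lambda>i k. J k i" "\<lambda>k j. \<Sum>l<m. metric M d q k l * J l j"]
      fdet_mult[of m "metric M d q" J] ..
  also have "\<dots> = fdet m (metric M d q) * (fdet m J)\<^sup>2"
    unfolding fdet_transpose[of m J] power2_eq_square by simp
  finally show ?thesis
    using q by (simp add: \<rho>_def inv_chart[OF c] inv_chart[OF d] real_sqrt_mult J_def)
qed

text \<open>The substitution formula for the transition map; its Jacobian factor is absorbed by
  \<open>\<rho>_transform\<close>.\<close>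

lemma cv_compat:
  assumes c: "c \<in> atlas M" and d: "d \<in> atlas M" and A: "A \<in> sets BM" "A \<subseteq> chart_dom c \<inter> chart_dom d"
  shows "cv c A = cv d A"
proof -
  let ?U = "chart_map c ` (chart_dom c \<inter> chart_dom d)" and ?V = "chart_map d ` (chart_dom c \<inter> chart_dom d)"
  let ?\<psi> = "\<lambda>p. chart_map d (chart_inv c p)" and ?\<phi> = "\<lambda>y. chart_map c (chart_inv d y)"
  interpret tr: C1_diffeo m ?U ?V ?\<psi> ?\<phi> by (rule transition_diffeo[OF c d])
  have cA: "chart_map c ` A \<in> sets (lborel_coord m)"
    using chart_image_sets[OF c A(1)] A(2) by (simp add: Int_absorb2)
  have gm: "(\<lambda>y. ennreal (\<rho> d y)) \<in> borel_measurable (restrict_space (lborel_coord m) ?V)"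
  proof -
    have "cont_on_coord m ?V (\<rho> d)" by (rule cont_on_coord_subset[OF C1D(1)[OF \<rho>C1[OF d]]]) auto
    then show ?thesis using cont_on_coord_measurable[OF tr.openV] by simp
  qed
  have img: "?\<psi> ` chart_map c ` A = chart_map d ` A"
    unfolding image_image by (rule image_cong) (use A(2) inv_chart[OF c] in auto)
  have "cv d A = (\<integral>\<^sup>+p\<in>chart_map c ` A. ennreal (\<rho> d (?\<psi> p)) * ennreal \<bar>fdet m (tr.J p)\<bar> \<partial>lborel_coord m)"
    unfolding cv_def img[symmetric] by (rule tr.change_of_variables[OF cA _ gm]) (use A(2) in auto)
  also have "\<dots> = cv c A"
    unfolding cv_def
  proof (rule nn_integral_cong)
    fix p
    show "ennreal (\<rho> d (?\<psi> p)) * ennreal \<bar>fdet m (tr.J p)\<bar> * indicator (chart_map c ` A) p = ennreal (\<rho> c p) * indicator (chart_map c ` A) p"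
    proof (cases "p \<in> chart_map c ` A")
      case True
      then obtain q where q: "q \<in> A" "p = chart_map c q" by blast
      then have q': "q \<in> chart_dom c \<inter> chart_dom d" using A(2) by blast
      have "\<rho> d (chart_map d q) > 0" by (rule \<rho>_pos[OF d]) (use q' in auto)
      then show ?thesis
        using \<rho>_transform[OF c d q'] q q' by (simp add: inv_chart[OF c] ennreal_mult' tr.J_def[abs_def])
    qed simp
  qed
  finally show ?thesis ..
qed

section \<open>Finite covers by cubes in charts\<close>

definition piece :: "'a \<Rightarrow> 'a chart \<Rightarrow> real \<Rightarrow> 'a set" where
  "piece q c r = {x \<in> chart_dom c. near m r (chart_map c q) (chart_map c x)}"

definition cube :: "'a \<Rightarrow> 'a chart \<Rightarrow> real \<Rightarrow> (nat \<Rightarrow> real) set" where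
  "cube q c r = kbox m (\<lambda>i. chart_map c q i - r) (\<lambda>i. chart_map c q i + r)"

lemma openin_near: "openin (coord_space m) {p \<in> cs m. near m r a p}"
  unfolding openin_coord
proof (intro conjI ballI)
  fix p assume p: "p \<in> {p \<in> cs m. near m r a p}"
  obtain \<mu> where \<mu>: "\<mu> > 0" "\<And>i. i < m \<Longrightarrow> \<mu> \<le> r - \<bar>p i - a i\<bar>"
    using finite_pos_lower_bound[of m "\<lambda>i. r - \<bar>p i - a i\<bar>"] p by (auto simp: near_def)
  have "near m r a q" if "near m \<mu> p q" for q
    unfolding near_def
  proof (intro allI impI)
    fix i assume i: "i < m"
    have "\<bar>q i - p i\<bar> < \<mu>" using that i by (simp add: near_def)
    then show "\<bar>q i - a i\<bar> < r" using \<mu>(2)[OF i] by linarith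
  qed
  then show "\<exists>d>0. \<forall>q\<in>cs m. near m d p q \<longrightarrow> q \<in> {p \<in> cs m. near m r a p}"
    using \<mu>(1) by auto
qed auto

lemma piece_open:
  assumes c: "c \<in> atlas M"
  shows "openin T (piece q c r)"
proof -
  have "piece q c r = {x \<in> chart_dom c. chart_map c x \<in> {p \<in> cs m. near m r (chart_map c q) p}}"
    unfolding piece_def using img_sub[OF c] by blast
  then show ?thesis using chart_preimage_open[OF c openin_near] by simp
qed

text \<open>Compactness is applied to open cubes whose closures stay inside the chart image. The
  closed cubes are compact there, which bounds the density on them and lets them carry the supports
  of the bump functions.\<close>

lemma finite_cover:
  "\<exists>F ch r. finite F \<and> F \<subseteq> \<Omega> \<and> \<Omega> = (\<Union>q\<in>F. piece q (ch q) (r q)) \<and>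
     (\<forall>q\<in>F. ch q \<in> atlas M \<and> q \<in> chart_dom (ch q) \<and> (0::real) < r q \<and> cube q (ch q) (r q) \<subseteq> chart_img (ch q))"
proof -
  have "\<exists>c r. c \<in> atlas M \<and> q \<in> chart_dom c \<and> (0::real) < r \<and> cube q c r \<subseteq> chart_img c" if q: "q \<in> \<Omega>" for q
  proof -
    obtain c where c: "c \<in> atlas M" "q \<in> chart_dom c" using q atlas unfolding is_smooth_atlas_def by blast
    then have "chart_map c q \<in> chart_img c" by simp
    then obtain d where d: "d > 0" "\<forall>p\<in>cs m. near m d (chart_map c q) p \<longrightarrow> p \<in> chart_img c"
      using img_open[OF c(1)] unfolding openin_coord by blast
    have "cube q c (d/2) \<subseteq> chart_img c"
    proof
      fix p assume p: "p \<in> cube q c (d/2)"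
      have "\<bar>p i - chart_map c q i\<bar> < d" if "i < m" for i
      proof -
        have "chart_map c q i - d/2 \<le> p i" "p i \<le> chart_map c q i + d/2" using p that by (auto simp: cube_def kbox_iff)
        then show ?thesis using d(1) by linarith
      qed
      then show "p \<in> chart_img c" using d(2) p by (auto simp: near_def cube_def kbox_iff)
    qed
    then show ?thesis using c d(1) by (intro exI[of _ c] exI[of _ "d/2"]) simp
  qed
  then obtain ch r where chr: "\<And>q. q \<in> \<Omega> \<Longrightarrow> ch q \<in> atlas M \<and> q \<in> chart_dom (ch q) \<and> (0::real) < r q \<and> cube q (ch q) (r q) \<subseteq> chart_img (ch q)"
    by metis
  let ?P = "\<lambda>q. piece q (ch q) (r q)"
  have "\<exists>\<F>. finite \<F> \<and> \<F> \<subseteq> ?P ` \<Omega> \<and> \<Omega> \<subseteq> \<Union>\<F>"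
  proof (rule compactinD[of T \<Omega>])
    show "compactin T \<Omega>" using compact by (simp add: compact_space_def)
    show "openin T U" if U: "U \<in> ?P ` \<Omega>" for U
    proof -
      obtain q where "q \<in> \<Omega>" "U = ?P q" using U by blast
      then show ?thesis using piece_open[of "ch q" q "r q"] chr[of q] by simp
    qed
    show "\<Omega> \<subseteq> \<Union>(?P ` \<Omega>)"
    proof
      fix q assume q: "q \<in> \<Omega>"
      then have "q \<in> ?P q" using chr[OF q] by (simp add: piece_def near_def)
      then show "q \<in> \<Union>(?P ` \<Omega>)" using q by (intro UnionI[of "?P q"]) simp_all
    qed
  qed
  then obtain \<F> where \<F>: "finite \<F>" "\<F> \<subseteq> ?P ` \<Omega>" "\<Omega> \<subseteq> \<Union>\<F>" by blast
  then obtain F where F: "finite F" "F \<subseteq> \<Omega>" "\<F> = ?P ` F" by (meson finite_subset_image)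
  have "\<Omega> = (\<Union>q\<in>F. ?P q)"
  proof
    show "\<Omega> \<subseteq> (\<Union>q\<in>F. ?P q)" using \<F>(3) F(3) by simp
    show "(\<Union>q\<in>F. ?P q) \<subseteq> \<Omega>"
    proof (rule UN_least)
      fix q assume "q \<in> F"
      then have "ch q \<in> atlas M" using chr[of q] F(2) by blast
      from dom_sub[OF this] show "?P q \<subseteq> \<Omega>" unfolding piece_def by blast
    qed
  qed
  moreover have "\<forall>q\<in>F. ch q \<in> atlas M \<and> q \<in> chart_dom (ch q) \<and> 0 < r q \<and> cube q (ch q) (r q) \<subseteq> chart_img (ch q)"
    using chr subsetD[OF F(2)] by simp
  ultimately show ?thesis using F(1,2) by (intro exI conjI)
qed

text \<open>A volume is prescribed only on subsets of single charts. Cutting the manifold into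
  finitely many disjoint Borel pieces of this kind determines it everywhere.\<close>

lemma finite_disjoint_chart_pieces:
  "\<exists>(N::nat) ch D. (\<forall>k<N. ch k \<in> atlas M \<and> D k \<in> sets BM \<and> D k \<subseteq> chart_dom (ch k)) \<and>
     disjoint_family_on D {..<N} \<and> \<Omega> = (\<Union>k<N. D k)"
proof -
  obtain F ch and r :: "'a \<Rightarrow> real" where F: "finite F" "\<Omega> = (\<Union>q\<in>F. piece q (ch q) (r q))"
    "\<forall>q\<in>F. ch q \<in> atlas M \<and> q \<in> chart_dom (ch q) \<and> 0 < r q \<and> cube q (ch q) (r q) \<subseteq> chart_img (ch q)"
    using finite_cover by (elim exE conjE)
  obtain e where e: "bij_betw e {..<card F} F"
    using ex_bij_betw_nat_finite[OF F(1)] by (auto simp: lessThan_atLeast0)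
  define P where "P k = piece (e k) (ch (e k)) (r (e k))" for k
  define D where "D = (\<lambda>k. P k - (\<Union>j<k. P j))"
  have eF: "e k \<in> F" if "k < card F" for k using e that by (auto simp: bij_betw_def)
  have "ch (e k) \<in> atlas M \<and> D k \<in> sets BM \<and> D k \<subseteq> chart_dom (ch (e k))" if k: "k < card F" for k
  proof (intro conjI)
    show "ch (e k) \<in> atlas M" using F(3) eF[OF k] by blast
    have "P j \<in> sets BM" if "j \<le> k" for j
      unfolding P_def by (intro open_BM piece_open) (use F(3) eF[of j] that k in auto)
    then show "D k \<in> sets BM" unfolding D_def by (intro sets.Diff sets.finite_UN) auto
    show "D k \<subseteq> chart_dom (ch (e k))" by (auto simp: D_def P_def piece_def)
  qed
  moreover have "disjoint_family_on D {..<card F}"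
    unfolding disjoint_family_on_def
  proof (intro ballI impI)
    fix j k assume "j \<in> {..<card F}" "k \<in> {..<card F}" "j \<noteq> k"
    then consider "j < k" | "k < j" by linarith
    then show "D j \<inter> D k = {}" by cases (auto simp: D_def)
  qed
  moreover have "\<Omega> = (\<Union>k<card F. D k)"
  proof -
    have "(\<Union>k<n. D k) = (\<Union>k<n. P k)" for n
      by (induction n) (auto simp: D_def lessThan_Suc)
    moreover have "(\<Union>k<card F. P k) = (\<Union>q\<in>e ` {..<card F}. piece q (ch q) (r q))" by (simp add: P_def)
    moreover have "e ` {..<card F} = F" using e by (simp add: bij_betw_def)
    ultimately show ?thesis using F(2) by simp
  qed
  ultimately show ?thesis
    by (intro exI[of _ "card F"] exI[of _ "\<lambda>k. ch (e k)"] exI[of _ D]) simp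
qed

lemma is_riemannian_volume_iff:
  "is_riemannian_volume m M \<mu> \<longleftrightarrow> space \<mu> = \<Omega> \<and> sets \<mu> = sets BM \<and>
     (\<forall>c\<in>atlas M. \<forall>A\<in>sets BM. A \<subseteq> chart_dom c \<longrightarrow> emeasure \<mu> A = cv c A)"
  unfolding is_riemannian_volume_def sets_BM cv_def \<rho>_def metric_mat_eq_fmat fdet_def by auto

lemma emeasure_split:
  assumes \<mu>: "sets \<mu> = sets BM" and A: "A \<in> sets BM"
    and D: "\<And>k. k < N \<Longrightarrow> D k \<in> sets BM" "disjoint_family_on D {..<N}" "\<Omega> = (\<Union>k<N::nat. D k)"
  shows "emeasure \<mu> A = (\<Sum>k<N. emeasure \<mu> (A \<inter> D k))"
proof -
  have "A = (\<Union>k<N. A \<inter> D k)" using sets.sets_into_space[OF A] D(3) by auto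
  then have "emeasure \<mu> A = emeasure \<mu> (\<Union>k<N. A \<inter> D k)" by simp
  also have "\<dots> = (\<Sum>k<N. emeasure \<mu> (A \<inter> D k))"
    using D(1,2) A \<mu> by (intro sum_emeasure[symmetric]) (auto simp: disjoint_family_on_def)
  finally show ?thesis .
qed

text \<open>Existence: add up the chart volumes over disjoint pieces; agreement on overlaps gives
  the sum the prescribed value in every chart. Uniqueness: two volumes agree on each piece.\<close>

lemma ex1_riemannian_volume: "\<exists>!\<mu>. is_riemannian_volume m M \<mu>"
proof -
  obtain N :: nat and ch D where D: "\<forall>k<N. ch k \<in> atlas M \<and> D k \<in> sets BM \<and> D k \<subseteq> chart_dom (ch k)"
    "disjoint_family_on D {..<N}" "\<Omega> = (\<Union>k<N. D k)"
    using finite_disjoint_chart_pieces by (elim exE conjE)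
  have D1: "ch k \<in> atlas M" "D k \<in> sets BM" "D k \<subseteq> chart_dom (ch k)" if "k < N" for k using D(1) that by auto
  define e where "e A = (\<Sum>k<N. emeasure (CM (ch k)) (A \<inter> D k))" for A
  define \<mu> where "\<mu> = measure_of \<Omega> {U. openin T U} e"
  have sets_\<mu>: "sets \<mu> = sets BM" and space_\<mu>: "space \<mu> = \<Omega>"
    unfolding \<mu>_def sets_BM by (rule sets_measure_of[OF open_sub], rule space_measure_of[OF open_sub])
  have em: "emeasure \<mu> A = e A" if A: "A \<in> sets BM" for A
  proof (rule emeasure_measure_of[OF \<mu>_def open_sub])
    show "positive (sets \<mu>) e" by (simp add: positive_def e_def)
    show "A \<in> sets \<mu>" using A sets_\<mu> by simp
    show "countably_additive (sets \<mu>) e"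
      unfolding countably_additive_def
    proof (intro allI impI)
      fix A :: "nat \<Rightarrow> 'a set" assume A: "range A \<subseteq> sets \<mu>" "disjoint_family A"
      have "(\<Sum>i. e (A i)) = (\<Sum>k<N. \<Sum>i. emeasure (CM (ch k)) (A i \<inter> D k))"
        unfolding e_def by (rule suminf_sum) simp
      also have "\<dots> = (\<Sum>k<N. emeasure (CM (ch k)) (\<Union>i. A i \<inter> D k))"
      proof (intro sum.cong refl suminf_emeasure)
        fix k assume "k \<in> {..<N}"
        then show "range (\<lambda>i. A i \<inter> D k) \<subseteq> sets (CM (ch k))" using A(1) D1 sets_\<mu> by auto
        show "disjoint_family (\<lambda>i. A i \<inter> D k)" using A(2) by (auto simp: disjoint_family_on_def)
      qed
      also have "\<dots> = e (\<Union>(range A))" unfolding e_def by (intro sum.cong refl arg_cong2[where f = emeasure]) auto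
      finally show "(\<Sum>i. e (A i)) = e (\<Union>(range A))" .
    qed
  qed
  have "emeasure \<mu> A = cv c A" if c: "c \<in> atlas M" and A: "A \<in> sets BM" "A \<subseteq> chart_dom c" for c A
  proof -
    have "emeasure \<mu> A = (\<Sum>k<N. emeasure (CM (ch k)) (A \<inter> D k))" using em[OF A(1)] by (simp add: e_def)
    also have "\<dots> = (\<Sum>k<N. emeasure (CM c) (A \<inter> D k))"
    proof (intro sum.cong refl)
      fix k assume "k \<in> {..<N}"
      then have k: "k < N" by simp
      have AD: "A \<inter> D k \<in> sets BM" using A(1) D1(2)[OF k] by auto
      have eqc: "(A \<inter> D k) \<inter> chart_dom (ch k) = A \<inter> D k" "(A \<inter> D k) \<inter> chart_dom c = A \<inter> D k"
        using D1(3)[OF k] A(2) by auto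
      show "emeasure (CM (ch k)) (A \<inter> D k) = emeasure (CM c) (A \<inter> D k)"
        unfolding emeasure_CM[OF D1(1)[OF k] AD] emeasure_CM[OF c AD] eqc
        by (rule cv_compat[OF D1(1)[OF k] c AD]) (use D1(3)[OF k] A(2) in auto)
    qed
    also have "\<dots> = emeasure (CM c) A"
      by (rule emeasure_split[symmetric, OF sets_CM A(1) D1(2) D(2,3)])
    also have "\<dots> = cv c A" using emeasure_CM[OF c A(1)] A(2) by (simp add: Int_absorb2)
    finally show ?thesis .
  qed
  then have ex: "is_riemannian_volume m M \<mu>" unfolding is_riemannian_volume_iff using sets_\<mu> space_\<mu> by blast
  show ?thesis
  proof (rule ex1I)
    show "is_riemannian_volume m M \<mu>" by (rule ex)
    fix \<nu> assume "is_riemannian_volume m M \<nu>"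
    then have \<nu>: "sets \<nu> = sets BM" "\<And>c A. c \<in> atlas M \<Longrightarrow> A \<in> sets BM \<Longrightarrow> A \<subseteq> chart_dom c \<Longrightarrow> emeasure \<nu> A = cv c A"
      unfolding is_riemannian_volume_iff by blast+
    show "\<nu> = \<mu>"
    proof (rule measure_eqI)
      show "sets \<nu> = sets \<mu>" using \<nu>(1) sets_\<mu> by simp
      fix A assume "A \<in> sets \<nu>"
      then have A: "A \<in> sets BM" using \<nu>(1) by simp
      have "emeasure \<nu> A = (\<Sum>k<N. emeasure \<nu> (A \<inter> D k))"
        by (rule emeasure_split[OF \<nu>(1) A D1(2) D(2,3)])
      also have "\<dots> = (\<Sum>k<N. emeasure \<mu> (A \<inter> D k))"
      proof (intro sum.cong refl)
        fix k assume "k \<in> {..<N}"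
        then have k: "k < N" by simp
        have "A \<inter> D k \<in> sets BM" "A \<inter> D k \<subseteq> chart_dom (ch k)" using A D1[OF k] by auto
        then show "emeasure \<nu> (A \<inter> D k) = emeasure \<mu> (A \<inter> D k)"
          using \<nu>(2)[OF D1(1)[OF k]] ex[unfolded is_riemannian_volume_iff] D1(1)[OF k] by auto
      qed
      also have "\<dots> = emeasure \<mu> A"
        by (rule emeasure_split[symmetric, OF sets_\<mu> A D1(2) D(2,3)])
      finally show "emeasure \<nu> A = emeasure \<mu> A" .
    qed
  qed
qed

abbreviation vol :: "'a measure" where "vol \<equiv> riemannian_volume m M"

lemma vol: "is_riemannian_volume m M vol"
  unfolding riemannian_volume_def by (rule theI'[OF ex1_riemannian_volume])

lemma space_vol [simp]: "space vol = \<Omega>" and sets_vol: "sets vol = sets BM"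
  and emeasure_vol: "\<And>c A. c \<in> atlas M \<Longrightarrow> A \<in> sets BM \<Longrightarrow> A \<subseteq> chart_dom c \<Longrightarrow> emeasure vol A = cv c A"
  using vol unfolding is_riemannian_volume_iff by blast+

text \<open>Finite because the density is bounded on the compact cube; positive because the density
  is positive and the image of the piece contains a box of positive measure. Summed over a finite
  cover, this makes the volume ratio meaningful.\<close>

lemma piece_vol:
  assumes c: "c \<in> atlas M" and q: "q \<in> chart_dom c" and r: "r > 0" and K: "cube q c r \<subseteq> chart_img c"
  shows "emeasure vol (piece q c r) < \<infinity>" "emeasure vol (piece q c r) > 0"
proof -
  have sub: "piece q c r \<subseteq> chart_dom c" by (auto simp: piece_def)
  have ps: "piece q c r \<in> sets BM" by (intro open_BM piece_open c)
  have e: "emeasure vol (piece q c r) = cv c (piece q c r)" by (rule emeasure_vol[OF c ps sub])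
  have imgs: "chart_map c ` piece q c r \<in> sets (lborel_coord m)"
    using chart_image_sets[OF c ps] sub by (simp add: Int_absorb2)
  have inK: "chart_map c ` piece q c r \<subseteq> cube q c r"
    using img_sub[OF c] by (fastforce simp: piece_def cube_def kbox_iff near_def abs_less_iff)
  obtain B where B: "\<forall>p\<in>cube q c r. \<bar>\<rho> c p\<bar> \<le> B"
    using cont_on_coord_bounded[OF compactin_kbox K[unfolded cube_def] C1D(1)[OF \<rho>C1[OF c]]] unfolding cube_def by blast
  have "cv c (piece q c r) \<le> (\<integral>\<^sup>+p\<in>cube q c r. ennreal B \<partial>lborel_coord m)"
    unfolding cv_def using B inK by (intro nn_integral_mono) (force simp: indicator_def intro!: ennreal_leI)
  also have "\<dots> = ennreal B * emeasure (lborel_coord m) (cube q c r)"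
    by (simp add: nn_integral_cmult_indicator cube_def)
  also have "emeasure (lborel_coord m) (cube q c r) = ennreal (\<Prod>i<m. (chart_map c q i + r) - (chart_map c q i - r))"
    unfolding cube_def by (rule emeasure_kbox) (use r in auto)
  finally show "emeasure vol (piece q c r) < \<infinity>"
    unfolding e by (auto simp: less_top[symmetric] top_unique ennreal_mult_eq_top_iff)
  have "cv c (piece q c r) \<noteq> 0"
  proof
    assume "cv c (piece q c r) = 0"
    then have "(\<integral>\<^sup>+p. ennreal (\<rho> c p) * indicator (chart_map c ` piece q c r) p * indicator (chart_img c) p \<partial>lborel_coord m) = 0"
      unfolding cv_def using inK K by (subst nn_integral_cong[where v = "\<lambda>p. ennreal (\<rho> c p) * indicator (chart_map c ` piece q c r) p"]) (auto simp: indicator_def)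
    then have z: "(\<integral>\<^sup>+p. ennreal (\<rho> c p) * indicator (chart_map c ` piece q c r) p \<partial>restrict_space (lborel_coord m) (chart_img c)) = 0"
      using nn_integral_restrict_space[OF img_sets[OF c]] by metis
    let ?R = "restrict_space (lborel_coord m) (chart_img c)"
    have im: "chart_map c ` piece q c r \<in> sets ?R" using imgs inK K sets_restrict_img[OF c] by blast
    have "emeasure ?R {p \<in> space ?R. ennreal (\<rho> c p) * indicator (chart_map c ` piece q c r) p \<noteq> 0} = 0"
      using z \<rho>_measurable[OF c] im by (subst (asm) nn_integral_0_iff) auto
    moreover have "{p \<in> space ?R. ennreal (\<rho> c p) * indicator (chart_map c ` piece q c r) p \<noteq> 0} = chart_map c ` piece q c r"
    proof -
      have "\<not> \<rho> c (chart_map c x) \<le> 0" if "x \<in> piece q c r" for x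
        using \<rho>_pos[OF c, of "chart_map c x"] subsetD[OF sub that] by simp
      then show ?thesis
        using subset_trans[OF inK K] unfolding space_restrict_img[OF c]
        by (auto simp: indicator_def ennreal_eq_0_iff)
    qed
    ultimately have "emeasure (lborel_coord m) (chart_map c ` piece q c r) = 0"
      using im inK K by (simp add: emeasure_restrict_space[OF img_sets[OF c]])
    \<comment> \<open>One orthant of the cube is enough, and as a half-open box its measure is
      known.\<close>
    moreover have "hbox m (chart_map c q) (\<lambda>i. chart_map c q i + r) \<subseteq> chart_map c ` piece q c r"
    proof
      fix p assume p: "p \<in> hbox m (chart_map c q) (\<lambda>i. chart_map c q i + r)"
      then have "p \<in> cube q c r" "near m r (chart_map c q) p"
        using r by (fastforce simp: cube_def kbox_iff hbox_iff near_def)+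
      then have "p \<in> chart_img c" using K by blast
      then show "p \<in> chart_map c ` piece q c r"
        using \<open>near m r (chart_map c q) p\<close> chart_inv_chart[of p c] inv_in_dom[of p c]
        by (intro image_eqI[of _ _ "chart_inv c p"]) (auto simp: piece_def)
    qed
    ultimately have "emeasure (lborel_coord m) (hbox m (chart_map c q) (\<lambda>i. chart_map c q i + r)) = 0"
      using emeasure_mono[of "hbox m (chart_map c q) (\<lambda>i. chart_map c q i + r)" "chart_map c ` piece q c r" "lborel_coord m"] imgs by simp
    moreover have "emeasure (lborel_coord m) (hbox m (chart_map c q) (\<lambda>i. chart_map c q i + r)) = ennreal (\<Prod>i<m. r)"
      using r by (subst emeasure_hbox) auto
    ultimately show False using r by simp
  qed
  then show "emeasure vol (piece q c r) > 0" unfolding e by (simp add: zero_less_iff_neq_zero)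
qed

lemma vol_finite: "emeasure vol \<Omega> < \<infinity>" and vol_pos: "emeasure vol \<Omega> > 0"
proof -
  obtain F ch and r :: "'a \<Rightarrow> real" where F: "finite F" "F \<subseteq> \<Omega>" "\<Omega> = (\<Union>q\<in>F. piece q (ch q) (r q))"
    "\<forall>q\<in>F. ch q \<in> atlas M \<and> q \<in> chart_dom (ch q) \<and> 0 < r q \<and> cube q (ch q) (r q) \<subseteq> chart_img (ch q)"
    using finite_cover by (elim exE conjE)
  have pv: "emeasure vol (piece q (ch q) (r q)) < \<infinity>" "emeasure vol (piece q (ch q) (r q)) > 0"
    "piece q (ch q) (r q) \<in> sets vol" if "q \<in> F" for q
    using piece_vol F(4) that open_BM[OF piece_open] sets_vol by auto
  have "emeasure vol \<Omega> \<le> (\<Sum>q\<in>F. emeasure vol (piece q (ch q) (r q)))"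
    unfolding F(3) using pv(3) by (intro emeasure_subadditive_finite F(1)) auto
  also have "\<dots> < \<infinity>" using pv(1) F(1) by (simp add: less_top[symmetric])
  finally show "emeasure vol \<Omega> < \<infinity>" .
  obtain q where q: "q \<in> F" using nonempty F(3) by auto
  have "0 < emeasure vol (piece q (ch q) (r q))" by (rule pv(2)[OF q])
  also have "\<dots> \<le> emeasure vol \<Omega>"
  proof (rule emeasure_mono)
    show "piece q (ch q) (r q) \<subseteq> \<Omega>" using q F(3) by auto
    show "\<Omega> \<in> sets vol" using sets.top[of vol] by simp
  qed
  finally show "emeasure vol \<Omega> > 0" .
qed

lemma finite_measure_vol: "finite_measure vol"
  by (rule finite_measureI) (use vol_finite in auto)

section \<open>Integrals of functions supported in one chart\<close>

lemma chart_map_measurable: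
  assumes c: "c \<in> atlas M"
  shows "chart_map c \<in> measurable (restrict_space BM (chart_dom c)) (restrict_space (lborel_coord m) (chart_img c))"
proof (rule measurable_restrict_space2)
  have sp: "space (restrict_space BM (chart_dom c)) = chart_dom c"
    using dom_sub[OF c] by (auto simp: space_restrict_space)
  show "chart_map c \<in> space (restrict_space BM (chart_dom c)) \<rightarrow> chart_img c" unfolding sp by blast
  show "chart_map c \<in> measurable (restrict_space BM (chart_dom c)) (lborel_coord m)"
  proof (rule measurable_into_coord)
    show "chart_map c x \<in> cs m" if "x \<in> space (restrict_space BM (chart_dom c))" for x
      using that img_sub[OF c] unfolding sp by blast
    fix i assume i: "i < m"
    show "(\<lambda>x. chart_map c x i) \<in> borel_measurable (restrict_space BM (chart_dom c))"
    proof (rule borel_measurableI)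
      fix S :: "real set" assume S: "open S"
      have W: "openin (coord_space m) {p \<in> topspace (coord_space m). p i \<in> S}"
        by (rule openin_continuous_map_preimage[where Y = euclideanreal])
           (use i S in \<open>auto intro: continuous_map_product_coordinates\<close>)
      have "(\<lambda>x. chart_map c x i) -` S \<inter> chart_dom c = {q \<in> chart_dom c. chart_map c q \<in> {p \<in> topspace (coord_space m). p i \<in> S}}"
        using img_sub[OF c] by auto
      then have "(\<lambda>x. chart_map c x i) -` S \<inter> chart_dom c \<in> sets BM"
        using open_BM[OF chart_preimage_open[OF c W]] by simp
      then show "(\<lambda>x. chart_map c x i) -` S \<inter> space (restrict_space BM (chart_dom c)) \<in> sets (restrict_space BM (chart_dom c))"
        unfolding sp using open_BM[OF dom_open[OF c]] dom_sub[OF c]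
        by (subst sets_restrict_space_iff) (auto simp: Int_absorb2)
    qed
  qed
qed

lemma supported_in_chart_measurable:
  assumes c: "c \<in> atlas M" and w: "w \<in> borel_measurable (restrict_space (lborel_coord m) (chart_img c))"
  shows "(\<lambda>q. if q \<in> chart_dom c then w (chart_map c q) else 0 :: real) \<in> borel_measurable BM"
proof -
  have "(\<lambda>q. w (chart_map c q)) \<in> borel_measurable (restrict_space BM (chart_dom c))"
    by (rule measurable_compose[OF chart_map_measurable[OF c] w])
  then have "(\<lambda>q. indicator (chart_dom c) q *\<^sub>R w (chart_map c q)) \<in> borel_measurable BM"
    using open_BM[OF dom_open[OF c]] dom_sub[OF c]
    by (subst (asm) borel_measurable_restrict_space_iff) (auto simp: Int_absorb2)
  then show ?thesis by (rule measurable_cong[THEN iffD1, rotated]) auto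
qed

text \<open>Identifies the chart measure with the volume restricted to the chart domain; through
  this density an integral over the manifold becomes one over coordinates.\<close>

lemma CM_eq_density: "c \<in> atlas M \<Longrightarrow> CM c = density vol (\<lambda>q. ennreal (indicator (chart_dom c) q))"
proof (rule measure_eqI)
  assume c: "c \<in> atlas M"
  show "sets (CM c) = sets (density vol (\<lambda>q. ennreal (indicator (chart_dom c) q)))" by (simp add: sets_vol)
  fix A assume "A \<in> sets (CM c)"
  then have A: "A \<in> sets BM" by simp
  have dom: "chart_dom c \<in> sets BM" by (rule open_BM[OF dom_open[OF c]])
  have "emeasure (density vol (\<lambda>q. ennreal (indicator (chart_dom c) q))) A = (\<integral>\<^sup>+q. ennreal (indicator (chart_dom c) q) * indicator A q \<partial>vol)"
    using A dom sets_vol by (intro emeasure_density) auto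
  also have "\<dots> = (\<integral>\<^sup>+q. indicator (A \<inter> chart_dom c) q \<partial>vol)"
    by (rule nn_integral_cong) (auto simp: indicator_def)
  also have "\<dots> = emeasure vol (A \<inter> chart_dom c)" using A dom sets_vol by (intro nn_integral_indicator) auto
  also have "\<dots> = cv c (A \<inter> chart_dom c)" by (rule emeasure_vol[OF c]) (use A dom in auto)
  finally show "emeasure (CM c) A = emeasure (density vol (\<lambda>q. ennreal (indicator (chart_dom c) q))) A"
    using emeasure_CM[OF c A] by simp
qed

text \<open>Unfold the volume into the chart measure, this into a push-forward, and the push-forward
  into a density. Every step is an identity of Bochner integrals that includes their default value
  0, so the second claim does not presuppose the first.\<close>

lemma integral_supported_in_chart:
  fixes w :: "(nat \<Rightarrow> real) \<Rightarrow> real"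
  assumes c: "c \<in> atlas M" and w: "w \<in> borel_measurable (restrict_space (lborel_coord m) (chart_img c))"
  defines "u \<equiv> (\<lambda>q. if q \<in> chart_dom c then w (chart_map c q) else 0)"
  shows "integrable vol u \<longleftrightarrow> integrable (lborel_coord m) (\<lambda>p. indicator (chart_img c) p * (\<rho> c p * w p))"
    and "integral\<^sup>L vol u = (\<integral>p. indicator (chart_img c) p * (\<rho> c p * w p) \<partial>lborel_coord m)"
proof -
  let ?R = "restrict_space (lborel_coord m) (chart_img c)"
  have u: "u \<in> borel_measurable BM" unfolding u_def by (rule supported_in_chart_measurable[OF c w])
  have uv: "u \<in> borel_measurable vol" using u measurable_cong_sets[OF sets_vol refl] by blast
  have dm: "(\<lambda>q. indicator (chart_dom c) q :: real) \<in> borel_measurable vol"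
    using open_BM[OF dom_open[OF c]] sets_vol by auto
  have eq: "indicator (chart_dom c) q *\<^sub>R u q = u q" for q by (simp add: u_def)
  have inv: "chart_inv c \<in> measurable (density ?R (\<lambda>p. ennreal (\<rho> c p))) BM"
    using chart_inv_measurable[OF c] by simp
  have uw: "u (chart_inv c p) = w p" if "p \<in> chart_img c" for p
    using that chart_inv_chart[of p c] inv_in_dom[of p c] by (simp add: u_def)
  have uinv: "(\<lambda>p. u (chart_inv c p)) \<in> borel_measurable ?R" by (rule measurable_compose[OF chart_inv_measurable[OF c] u])
  have \<rho>0: "AE p in ?R. 0 \<le> \<rho> c p" using \<rho>_pos[OF c] space_restrict_img[OF c] by (intro AE_I2) (auto simp: less_imp_le)
  have conv: "indicator (chart_img c) p *\<^sub>R (\<rho> c p *\<^sub>R u (chart_inv c p)) = indicator (chart_img c) p * (\<rho> c p * w p)" for p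
    using uw by (cases "p \<in> chart_img c") auto
  have "integrable vol u \<longleftrightarrow> integrable vol (\<lambda>q. indicator (chart_dom c) q *\<^sub>R u q)" by (simp only: eq)
  also have "\<dots> \<longleftrightarrow> integrable (CM c) u" unfolding CM_eq_density[OF c] by (rule integrable_density[symmetric]) (use uv dm in auto)
  also have "\<dots> \<longleftrightarrow> integrable (density ?R (\<lambda>p. ennreal (\<rho> c p))) (\<lambda>p. u (chart_inv c p))"
    unfolding CM_def by (rule integrable_distr_eq[OF inv u])
  also have "\<dots> \<longleftrightarrow> integrable ?R (\<lambda>p. \<rho> c p *\<^sub>R u (chart_inv c p))"
    by (rule integrable_density[OF uinv \<rho>_measurable[OF c] \<rho>0])
  also have "\<dots> \<longleftrightarrow> integrable (lborel_coord m) (\<lambda>p. indicator (chart_img c) p *\<^sub>R (\<rho> c p *\<^sub>R u (chart_inv c p)))"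
    by (rule integrable_restrict_space[OF img_sets[OF c]])
  finally show "integrable vol u \<longleftrightarrow> integrable (lborel_coord m) (\<lambda>p. indicator (chart_img c) p * (\<rho> c p * w p))"
    by (simp only: conv)
  have "integral\<^sup>L vol u = (\<integral>q. indicator (chart_dom c) q *\<^sub>R u q \<partial>vol)" by (simp only: eq)
  also have "\<dots> = integral\<^sup>L (CM c) u" unfolding CM_eq_density[OF c] by (rule integral_density[symmetric]) (use uv dm in auto)
  also have "\<dots> = (\<integral>p. u (chart_inv c p) \<partial>density ?R (\<lambda>p. ennreal (\<rho> c p)))"
    unfolding CM_def by (rule integral_distr[OF inv u])
  also have "\<dots> = (\<integral>p. \<rho> c p *\<^sub>R u (chart_inv c p) \<partial>?R)"
    by (rule integral_density[OF uinv \<rho>_measurable[OF c] \<rho>0])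
  also have "\<dots> = (\<integral>p. indicator (chart_img c) p *\<^sub>R (\<rho> c p *\<^sub>R u (chart_inv c p)) \<partial>lborel_coord m)"
    by (rule integral_restrict_space[OF img_sets[OF c]])
  finally show "integral\<^sup>L vol u = (\<integral>p. indicator (chart_img c) p * (\<rho> c p * w p) \<partial>lborel_coord m)"
    by (simp only: conv)
qed

end

section \<open>Partitions of unity and the weak Laplace equation\<close>

text \<open>The function is 2 max(s, 0)^2 written without a case distinction. It vanishes for s <=
  0, and its derivative 4 max(s, 0) is continuous.\<close>

lemma DERIV_square_abs: "DERIV (\<lambda>s::real. s * s + s * \<bar>s\<bar>) s :> 2 * s + 2 * \<bar>s\<bar>"
proof -
  have "DERIV (\<lambda>s::real. s * \<bar>s\<bar>) s :> 2 * \<bar>s\<bar>"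
  proof (cases "s = 0")
    case True
    have "((\<lambda>h::real. \<bar>h\<bar>) \<longlongrightarrow> 0) (at 0)" by (rule tendsto_rabs_zero) (rule tendsto_ident_at)
    then have "((\<lambda>h::real. h * \<bar>h\<bar> / h) \<longlongrightarrow> 0) (at 0)"
      by (rule Lim_transform_eventually) (auto simp: eventually_at_filter)
    then show ?thesis using True by (simp add: DERIV_def)
  next
    case False
    have "DERIV (\<lambda>s::real. s * (sgn s0 * s)) s0 :> 2 * (sgn s0 * s0)" for s0
      by (auto intro!: derivative_eq_intros)
    from this[of s] have "DERIV (\<lambda>t::real. t * (sgn s * t)) s :> 2 * \<bar>s\<bar>"
      by (simp add: sgn_mult_self_eq[symmetric] abs_sgn mult.commute)
    moreover have "\<forall>\<^sub>F t in nhds s. t * \<bar>t\<bar> = t * (sgn s * t)"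
    proof -
      have "\<forall>\<^sub>F t in nhds s. dist t s < \<bar>s\<bar>" unfolding eventually_nhds_metric using False by (intro exI[of _ "\<bar>s\<bar>"]) simp
      then show ?thesis
      proof eventually_elim
        case (elim t)
        have "\<bar>t\<bar> = sgn s * t"
        proof (cases "s > 0")
          case True
          then have "t > 0" using elim by (simp add: dist_real_def abs_less_iff)
          then show ?thesis using True by simp
        next
          case F: False
          then have "s < 0" using False by simp
          then have "t < 0" using elim by (simp add: dist_real_def abs_less_iff)
          then show ?thesis using \<open>s < 0\<close> by simp
        qed
        then show ?case by simp
      qed
    qed
    ultimately show ?thesis by (subst DERIV_cong_ev[OF refl _ refl])
  qed
  moreover have "DERIV (\<lambda>s::real. s * s) s :> 2 * s" by (auto intro!: derivative_eq_intros)
  ultimately show ?thesis by (rule DERIV_add[rotated])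
qed

text \<open>Each factor is 2 max(s, 0)^2. For r > 0 the product is therefore positive exactly on the
  open cube of half-side r around a, and it is C1 across the boundary.\<close>

definition bump :: "nat \<Rightarrow> (nat \<Rightarrow> real) \<Rightarrow> real \<Rightarrow> (nat \<Rightarrow> real) \<Rightarrow> real" where
  "bump m a r p = (\<Prod>i<m. let s = r\<^sup>2 - (p i - a i)\<^sup>2 in s * s + s * \<bar>s\<bar>)"

lemma bump_C1: "C1 m (cs m) (bump m a r)"
  unfolding bump_def[abs_def] Let_def
proof (rule C1_prod)
  fix i assume "i \<in> {..<m}"
  then have "i < m" by simp
  have "C1 m (cs m) (\<lambda>p. r\<^sup>2 + (- 1) * (p i + (- a i))\<^sup>2)"
    by (intro C1_add C1_mult C1_power C1_const C1_coordinate \<open>i < m\<close>)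
  then have s: "C1 m (cs m) (\<lambda>p. r\<^sup>2 - (p i - a i)\<^sup>2)" by simp
  show "C1 m (cs m) (\<lambda>p. (r\<^sup>2 - (p i - a i)\<^sup>2) * (r\<^sup>2 - (p i - a i)\<^sup>2) + (r\<^sup>2 - (p i - a i)\<^sup>2) * \<bar>r\<^sup>2 - (p i - a i)\<^sup>2\<bar>)"
    by (rule C1_real[OF s DERIV_square_abs]) (intro continuous_intros)
qed

lemma square_abs_nonneg: "(s::real) * s + s * \<bar>s\<bar> \<ge> 0"
proof (cases "s \<ge> 0")
  case False
  then show ?thesis by (simp add: abs_if)
qed simp

lemma square_abs_pos_iff: "(s::real) * s + s * \<bar>s\<bar> > 0 \<longleftrightarrow> s > 0"
  by (cases "s > 0") (auto simp: abs_if not_less add_pos_pos)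

lemma bump_nonneg: "bump m a r p \<ge> 0"
  unfolding bump_def Let_def by (intro prod_nonneg ballI square_abs_nonneg)

lemma bump_pos:
  assumes "r > 0" "near m r a p"
  shows "bump m a r p > 0"
  unfolding bump_def Let_def
proof (intro prod_pos ballI)
  fix i assume "i \<in> {..<m}"
  then have "\<bar>p i - a i\<bar> < r" using assms(2) by (auto simp: near_def)
  then have "(p i - a i)\<^sup>2 < r\<^sup>2" using assms(1) by (simp add: abs_le_square_iff[symmetric] not_le[symmetric])
  then show "(r\<^sup>2 - (p i - a i)\<^sup>2) * (r\<^sup>2 - (p i - a i)\<^sup>2) + (r\<^sup>2 - (p i - a i)\<^sup>2) * \<bar>r\<^sup>2 - (p i - a i)\<^sup>2\<bar> > 0"
    by (simp add: square_abs_pos_iff)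
qed

lemma bump_zero:
  assumes "r > 0" "\<not> near m r a p"
  shows "bump m a r p = 0"
proof -
  obtain i where i: "i < m" "r \<le> \<bar>p i - a i\<bar>" using assms(2) by (auto simp: near_def not_less)
  then have "r\<^sup>2 \<le> (p i - a i)\<^sup>2" using assms(1) by (simp add: abs_le_square_iff[symmetric])
  then have "(let s = r\<^sup>2 - (p i - a i)\<^sup>2 in s * s + s * \<bar>s\<bar>) = 0"
    by (cases "r\<^sup>2 = (p i - a i)\<^sup>2") (simp_all add: Let_def abs_if algebra_simps)
  then show ?thesis unfolding bump_def using i(1) by (intro prod_zero) auto
qed

context closed_manifold
begin

section \<open>C1 functions and bumps on the manifold\<close>

definition C1M :: "('a \<Rightarrow> real) \<Rightarrow> bool" where
  "C1M u \<longleftrightarrow> (\<forall>c\<in>atlas M. C1 m (chart_img c) (\<lambda>p. u (chart_inv c p)))"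

lemma C1MD: "C1M u \<Longrightarrow> c \<in> atlas M \<Longrightarrow> C1 m (chart_img c) (\<lambda>p. u (chart_inv c p))"
  by (simp only: C1M_def)

lemma C1M_mult: "C1M u \<Longrightarrow> C1M w \<Longrightarrow> C1M (\<lambda>y. u y * w y)"
  unfolding C1M_def by (intro ballI C1_mult) blast+

lemma C1M_sum: "(\<And>a. a \<in> I \<Longrightarrow> C1M (f a)) \<Longrightarrow> C1M (\<lambda>y. \<Sum>a\<in>I. f a y)"
  unfolding C1M_def by (intro ballI C1_sum) blast

lemma C1M_power: "C1M u \<Longrightarrow> C1M (\<lambda>y. u y ^ k)"
  unfolding C1M_def by (intro ballI C1_power) blast

lemma C1M_inverse:
  assumes "C1M u" "\<And>y. y \<in> \<Omega> \<Longrightarrow> u y \<noteq> 0"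
  shows "C1M (\<lambda>y. inverse (u y))"
  unfolding C1M_def
proof (intro ballI C1_inverse)
  fix c assume c: "c \<in> atlas M"
  show "C1 m (chart_img c) (\<lambda>p. u (chart_inv c p))" by (rule C1MD[OF assms(1) c])
  show "u (chart_inv c p) \<noteq> 0" if "p \<in> chart_img c" for p
    by (rule assms(2)[OF subsetD[OF dom_sub[OF c] inv_in_dom[OF that]]])
qed

lemma chart_inv_continuous:
  assumes c: "c \<in> atlas M"
  shows "continuous_map (subtopology (coord_space m) (chart_img c)) T (chart_inv c)"
  unfolding continuous_map_def
proof (intro conjI allI impI)
  have sp: "topspace (subtopology (coord_space m) (chart_img c)) = chart_img c"
    unfolding topspace_subtopology topspace_coord by (rule Int_absorb1[OF img_sub[OF c]])
  show "chart_inv c \<in> topspace (subtopology (coord_space m) (chart_img c)) \<rightarrow> \<Omega>"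
    unfolding sp using dom_sub[OF c] by (auto simp: inv_chart[OF c])
  fix U assume "openin T U"
  then have "openin T (U \<inter> chart_dom c)" using dom_open[OF c] by auto
  then have o: "openin (coord_space m) (chart_map c ` (U \<inter> chart_dom c))" by (intro chart_img_open[OF c]) auto
  have "{p \<in> topspace (subtopology (coord_space m) (chart_img c)). chart_inv c p \<in> U} = chart_map c ` (U \<inter> chart_dom c)"
    unfolding sp chart_image_eq[OF c] by blast
  then show "openin (subtopology (coord_space m) (chart_img c)) {p \<in> topspace (subtopology (coord_space m) (chart_img c)). chart_inv c p \<in> U}"
    using o openin_open_subtopology[OF img_open[OF c]] by auto
qed

definition bumpM :: "'a \<Rightarrow> 'a chart \<Rightarrow> real \<Rightarrow> 'a \<Rightarrow> real" where
  "bumpM q c r y = (if y \<in> chart_dom c then bump m (chart_map c q) r (chart_map c y) else 0)"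

lemma bumpM_zero_off_cube:
  assumes "r > 0" "y \<in> chart_dom c" "chart_map c y \<in> cs m" "chart_map c y \<notin> cube q c r"
  shows "bumpM q c r y = 0"
proof -
  have "\<not> near m r (chart_map c q) (chart_map c y)"
  proof
    assume n: "near m r (chart_map c q) (chart_map c y)"
    have "chart_map c y \<in> cube q c r"
      unfolding cube_def kbox_iff
    proof (intro conjI allI impI assms(3))
      fix i assume "i < m"
      then have "\<bar>chart_map c y i - chart_map c q i\<bar> < r" using n by (simp add: near_def)
      then show "chart_map c q i - r \<le> chart_map c y i" "chart_map c y i \<le> chart_map c q i + r" by linarith+
    qed
    then show False using assms(4) by simp
  qed
  then show ?thesis using bump_zero[OF assms(1)] by (simp add: bumpM_def)
qed

text \<open>The Hausdorff property enters here: the compact support of a bump is closed in the whole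
  manifold, so extension by zero is harmless at points outside the chart.\<close>

lemma closedin_cube_preimage:
  assumes c: "c \<in> atlas M" and K: "cube q c r \<subseteq> chart_img c"
  shows "closedin T (chart_inv c ` cube q c r)"
proof -
  have "compactin (subtopology (coord_space m) (chart_img c)) (cube q c r)"
    using K compactin_kbox unfolding cube_def by (simp add: compactin_subtopology)
  from image_compactin[OF this chart_inv_continuous[OF c]]
  show ?thesis by (rule compactin_imp_closedin[OF Hausdorff])
qed

lemma bumpM_zero_off_support:
  assumes c: "c \<in> atlas M" and r: "r > 0" and y: "y \<notin> chart_inv c ` cube q c r"
  shows "bumpM q c r y = 0"
proof (cases "y \<in> chart_dom c")
  case True
  have "chart_map c y \<notin> cube q c r"
  proof
    assume "chart_map c y \<in> cube q c r"
    then have "y \<in> chart_inv c ` cube q c r"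
      using inv_chart[OF c True] by (intro image_eqI[of _ _ "chart_map c y"]) simp_all
    then show False using y by blast
  qed
  moreover have "chart_map c y \<in> cs m" using img_sub[OF c] True by blast
  ultimately show ?thesis by (rule bumpM_zero_off_cube[OF r True, rotated])
qed (simp add: bumpM_def)

text \<open>In another chart d two open sets cover everything: on the overlap with c the bump is
  composed with the transition map, and off the closed support it is zero.\<close>

lemma bumpM_C1M:
  assumes c: "c \<in> atlas M" and r: "r > 0" and K: "cube q c r \<subseteq> chart_img c"
  shows "C1M (bumpM q c r)"
  unfolding C1M_def
proof
  fix d assume d: "d \<in> atlas M"
  let ?U = "chart_map d ` (chart_dom d \<inter> chart_dom c)"
  interpret tr: C1_diffeo m ?U "chart_map c ` (chart_dom d \<inter> chart_dom c)"
    "\<lambda>p. chart_map c (chart_inv d p)" "\<lambda>y. chart_map d (chart_inv c y)"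
    by (rule transition_diffeo[OF d c])
  let ?C = "chart_inv c ` cube q c r"
  have "openin T (chart_dom d - ?C)" by (rule openin_diff[OF dom_open[OF d] closedin_cube_preimage[OF c K]])
  then have oC: "openin (coord_space m) (chart_map d ` (chart_dom d - ?C))" by (rule chart_img_open[OF d]) blast
  have zero: "bumpM q c r y = 0" if "y \<in> chart_dom d - ?C" for y
    using that by (intro bumpM_zero_off_support[OF c r]) blast
  show "C1 m (chart_img d) (\<lambda>p. bumpM q c r (chart_inv d p))"
  proof (rule C1_local[OF img_open[OF d]])
    fix p assume p: "p \<in> chart_img d"
    then obtain y where y: "y \<in> chart_dom d" "p = chart_map d y" by blast
    show "\<exists>W. openin (coord_space m) W \<and> p \<in> W \<and> W \<subseteq> chart_img d \<and> C1 m W (\<lambda>p. bumpM q c r (chart_inv d p))"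
    proof (cases "y \<in> chart_dom c")
      case True
      have "C1 m ?U (\<lambda>p. bump m (chart_map c q) r (chart_map c (chart_inv d p)))"
        by (rule C1_compose(1)[OF tr.openU openin_cs tr.\<psi>C1 _ bump_C1]) (use tr.\<psi>V tr.Vcs in blast)+
      then have "C1 m ?U (\<lambda>p. bumpM q c r (chart_inv d p))"
        by (rule C1_cong[OF tr.openU]) (auto simp: bumpM_def inv_chart[OF d])
      then show ?thesis using tr.openU y True by (intro exI[of _ ?U]) auto
    next
      case False
      let ?W = "chart_map d ` (chart_dom d - ?C)"
      have "C1 m ?W (\<lambda>p. bumpM q c r (chart_inv d p))"
        by (rule C1_cong[OF oC C1_const[of m _ 0]]) (auto simp: inv_chart[OF d] zero)
      moreover have "y \<notin> ?C"
      proof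
        assume "y \<in> ?C"
        then obtain z where "z \<in> chart_img c" "y = chart_inv c z" using K by blast
        then show False using inv_in_dom[of z c] False by simp
      qed
      ultimately show ?thesis using oC y by (intro exI[of _ ?W]) auto
    qed
  qed
qed

text \<open>The inner product of two gradients, expressed in the chart c. The chart stays an
  argument because the metric is given by components; for C1 functions the value does not depend on
  it, by \<open>gp_chart_independent\<close>.\<close>

definition gp :: "'a chart \<Rightarrow> ('a \<Rightarrow> real) \<Rightarrow> ('a \<Rightarrow> real) \<Rightarrow> 'a \<Rightarrow> real" where
  "gp c u w y = (\<Sum>i<m. \<Sum>l<m. finv m (metric M c y) i l * cderiv c l u y * cderiv c i w y)"

lemma cderiv_chain:
  assumes c: "c \<in> atlas M" and d: "d \<in> atlas M" and y: "y \<in> chart_dom c \<inter> chart_dom d" and u: "C1M u" and i: "i < m"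
  shows "cderiv c i u y = (\<Sum>k<m. cderiv d k u y * cderiv c i (\<lambda>r. chart_map d r k) y)"
proof -
  let ?U = "chart_map c ` (chart_dom c \<inter> chart_dom d)" and ?V = "chart_map d ` (chart_dom c \<inter> chart_dom d)"
  interpret tr: C1_diffeo m ?U ?V "\<lambda>p. chart_map d (chart_inv c p)" "\<lambda>y. chart_map c (chart_inv d y)"
    by (rule transition_diffeo[OF c d])
  have uV: "C1 m ?V (\<lambda>p. u (chart_inv d p))" by (rule C1_subset[OF C1MD[OF u d]]) blast
  have yU: "chart_map c y \<in> ?U" using y by blast
  have yc: "chart_inv c (chart_map c y) = y" using inv_chart[OF c] y by blast
  have "partial_deriv i (\<lambda>p. u (chart_inv d (chart_map d (chart_inv c p)))) (chart_map c y) =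
    (\<Sum>k<m. partial_deriv k (\<lambda>p. u (chart_inv d p)) (chart_map d (chart_inv c (chart_map c y))) *
       partial_deriv i (\<lambda>p. chart_map d (chart_inv c p) k) (chart_map c y))"
    by (rule C1_compose(2)[OF tr.openU tr.openV tr.\<psi>C1 tr.\<psi>V uV i yU])
  also have "\<dots> = (\<Sum>k<m. cderiv d k u y * cderiv c i (\<lambda>r. chart_map d r k) y)"
    unfolding cderiv_def yc ..
  finally have "partial_deriv i (\<lambda>p. u (chart_inv d (chart_map d (chart_inv c p)))) (chart_map c y) =
    (\<Sum>k<m. cderiv d k u y * cderiv c i (\<lambda>r. chart_map d r k) y)" .
  moreover have "partial_deriv i (\<lambda>p. u (chart_inv d (chart_map d (chart_inv c p)))) (chart_map c y) = cderiv c i u y"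
    unfolding cderiv_def by (rule partial_deriv_cong[OF tr.openU yU i]) (auto simp: inv_chart[OF c] inv_chart[OF d])
  ultimately show ?thesis by simp
qed

text \<open>The components a of the gradient of u in c are pushed by the Jacobian J to b. The
  transformation law shows that J^T annihilates g_d b - du; as J is invertible, b is the gradient in
  d. A transformation rule for inverse metrics is thereby avoided.\<close>

lemma gp_chart_independent:
  assumes c: "c \<in> atlas M" and d: "d \<in> atlas M" and y: "y \<in> chart_dom c \<inter> chart_dom d" and u: "C1M u" and w: "C1M w"
  shows "gp c u w y = gp d u w y"
proof -
  let ?U = "chart_map c ` (chart_dom c \<inter> chart_dom d)" and ?V = "chart_map d ` (chart_dom c \<inter> chart_dom d)"
  interpret tr: C1_diffeo m ?U ?V "\<lambda>p. chart_map d (chart_inv c p)" "\<lambda>y. chart_map c (chart_inv d y)"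
    by (rule transition_diffeo[OF c d])
  define J where "J k i = cderiv c i (\<lambda>r. chart_map d r k) y" for k i
  define K where "K = tr.K (chart_map d y)"
  have yU: "chart_map c y \<in> ?U" using y by blast
  have yc: "chart_inv c (chart_map c y) = y" using inv_chart[OF c] y by blast
  have JK: "(\<Sum>k<m. J i k * K k j) = (if i = j then 1 else 0)" if "i < m" "j < m" for i j
    using tr.JK[OF yU that] by (simp add: J_def K_def tr.J_def cderiv_def yc)
  let ?gc = "metric M c y" and ?gd = "metric M d y"
  have nzc: "fdet m ?gc \<noteq> 0" and nzd: "fdet m ?gd \<noteq> 0"
    using pos_def_fdet_nonzero metric_pos_def c d y by blast+
  define a where "a i = (\<Sum>l<m. finv m ?gc i l * cderiv c l u y)" for i
  define b where "b k = (\<Sum>i<m. J k i * a i)" for k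
  have uc: "cderiv c i u y = (\<Sum>k<m. cderiv d k u y * J k i)" if "i < m" for i
    unfolding J_def by (rule cderiv_chain[OF c d y u that])
  have wc: "cderiv c i w y = (\<Sum>k<m. cderiv d k w y * J k i)" if "i < m" for i
    unfolding J_def by (rule cderiv_chain[OF c d y w that])
  have ga: "(\<Sum>j<m. ?gc i j * a j) = cderiv c i u y" if i: "i < m" for i
    unfolding a_def by (rule inverse_matrix_apply[OF finv_right[OF nzc] i])
  have gb: "(\<Sum>k<m. J k i * ((\<Sum>l<m. ?gd k l * b l) - cderiv d k u y)) = 0" if i: "i < m" for i
  proof -
    have "(\<Sum>j<m. ?gc i j * a j) = (\<Sum>j<m. \<Sum>k<m. \<Sum>l<m. J k i * (?gd k l * (J l j * a j)))"
      by (intro sum.cong refl) (simp add: metric_transform[OF c d y i] J_def sum_distrib_left sum_distrib_right mult_ac)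
    also have "\<dots> = (\<Sum>k<m. \<Sum>j<m. \<Sum>l<m. J k i * (?gd k l * (J l j * a j)))" by (rule sum.swap)
    also have "\<dots> = (\<Sum>k<m. \<Sum>l<m. \<Sum>j<m. J k i * (?gd k l * (J l j * a j)))" by (intro sum.cong refl sum.swap)
    also have "\<dots> = (\<Sum>k<m. J k i * (\<Sum>l<m. ?gd k l * b l))" by (simp add: sum_distrib_left b_def)
    finally have "(\<Sum>k<m. J k i * (\<Sum>l<m. ?gd k l * b l)) = (\<Sum>k<m. J k i * cderiv d k u y)"
      unfolding ga[OF i] uc[OF i] by (simp add: mult.commute)
    then show ?thesis by (simp add: right_diff_distrib sum_subtractf)
  qed
  \<comment> \<open>J^T is cancelled with the Jacobian K of the reverse transition map.\<close>
  have eqd: "(\<Sum>l<m. ?gd s l * b l) = cderiv d s u y" if s: "s < m" for s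
  proof -
    define z where "z k = (\<Sum>l<m. ?gd k l * b l) - cderiv d k u y" for k
    have "z s = (\<Sum>k<m. (\<Sum>i<m. J k i * K i s) * z k)" using s by (simp add: JK if_distrib[of "\<lambda>x. x * _"] cong: if_cong)
    also have "\<dots> = (\<Sum>k<m. \<Sum>i<m. K i s * (J k i * z k))" by (simp add: sum_distrib_right sum_distrib_left mult_ac)
    also have "\<dots> = (\<Sum>i<m. \<Sum>k<m. K i s * (J k i * z k))" by (rule sum.swap)
    also have "\<dots> = (\<Sum>i<m. K i s * (\<Sum>k<m. J k i * z k))" by (simp add: sum_distrib_left)
    also have "\<dots> = 0" using gb by (simp add: z_def)
    finally show ?thesis by (simp add: z_def)
  qed
  have b_eq: "b k = (\<Sum>l<m. finv m ?gd k l * cderiv d l u y)" if k: "k < m" for k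
  proof -
    have "b k = (\<Sum>l<m. finv m ?gd k l * (\<Sum>s<m. ?gd l s * b s))"
      by (rule inverse_matrix_apply[OF finv_left[OF nzd] k, symmetric])
    also have "\<dots> = (\<Sum>l<m. finv m ?gd k l * cderiv d l u y)" by (intro sum.cong refl) (simp add: eqd)
    finally show ?thesis .
  qed
  have "gp c u w y = (\<Sum>i<m. a i * cderiv c i w y)" by (simp add: gp_def a_def sum_distrib_right)
  also have "\<dots> = (\<Sum>i<m. \<Sum>k<m. cderiv d k w y * (J k i * a i))"
    by (intro sum.cong refl) (simp add: wc sum_distrib_left mult_ac)
  also have "\<dots> = (\<Sum>k<m. \<Sum>i<m. cderiv d k w y * (J k i * a i))" by (rule sum.swap)
  also have "\<dots> = (\<Sum>k<m. b k * cderiv d k w y)" by (simp add: b_def sum_distrib_left mult.commute)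
  also have "\<dots> = gp d u w y" by (simp add: gp_def b_eq sum_distrib_right)
  finally show ?thesis .
qed

lemma cderiv_sum:
  assumes c: "c \<in> atlas M" and y: "y \<in> chart_dom c" and w: "\<And>k. k \<in> I \<Longrightarrow> C1M (w k)" and i: "i < m"
  shows "cderiv c i (\<lambda>y. \<Sum>k\<in>I. w k y) y = (\<Sum>k\<in>I. cderiv c i (w k) y)"
  unfolding cderiv_def
  by (rule partial_deriv_sum[of I m "chart_img c"]) (use C1MD[OF w c] i y in blast)+

lemma gp_sum:
  assumes c: "c \<in> atlas M" and y: "y \<in> chart_dom c" and w: "\<And>k. k \<in> I \<Longrightarrow> C1M (w k)"
  shows "gp c u (\<lambda>y. \<Sum>k\<in>I. w k y) y = (\<Sum>k\<in>I. gp c u (w k) y)"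
proof -
  have "gp c u (\<lambda>y. \<Sum>k\<in>I. w k y) y = (\<Sum>i<m. \<Sum>l<m. \<Sum>k\<in>I. finv m (metric M c y) i l * cderiv c l u y * cderiv c i (w k) y)"
    unfolding gp_def by (intro sum.cong refl) (simp add: cderiv_sum[OF c y w] sum_distrib_left)
  also have "\<dots> = (\<Sum>i<m. \<Sum>k\<in>I. \<Sum>l<m. finv m (metric M c y) i l * cderiv c l u y * cderiv c i (w k) y)"
    by (intro sum.cong refl sum.swap)
  also have "\<dots> = (\<Sum>k\<in>I. gp c u (w k) y)" unfolding gp_def by (rule sum.swap)
  finally show ?thesis .
qed

lemma cderiv_local:
  assumes c: "c \<in> atlas M" and W: "openin T W" "y \<in> W" "W \<subseteq> chart_dom c" and i: "i < m" and eq: "\<And>z. z \<in> W \<Longrightarrow> u z = u' z"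
  shows "cderiv c i u y = cderiv c i u' y"
  unfolding cderiv_def
proof (rule partial_deriv_cong[OF chart_img_open[OF c W(1,3)] _ i])
  show "chart_map c y \<in> chart_map c ` W" using W(2) by blast
  fix p assume "p \<in> chart_map c ` W"
  then obtain z where "z \<in> W" "p = chart_map c z" by blast
  then show "u (chart_inv c p) = u' (chart_inv c p)" using eq inv_chart[OF c subsetD[OF W(3)]] by simp
qed

lemma gp_local:
  assumes c: "c \<in> atlas M" and W: "openin T W" "y \<in> W" "W \<subseteq> chart_dom c" and eq: "\<And>z. z \<in> W \<Longrightarrow> w z = w' z"
  shows "gp c u w y = gp c u w' y"
  unfolding gp_def by (intro sum.cong refl) (simp add: cderiv_local[OF c W _ eq])

end

context closed_manifold
begin

lemma cderiv_power:
  assumes c: "c \<in> atlas M" and y: "y \<in> chart_dom c" and u: "C1M u" and i: "i < m"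
  shows "cderiv c i (\<lambda>y. u y ^ Suc k) y = real (Suc k) * u y ^ k * cderiv c i u y"
  unfolding cderiv_def
proof (rule partial_deriv_eqI)
  have "chart_map c y \<in> chart_img c" using y by blast
  from DERIV_power[OF C1D(2)[OF C1MD[OF u c] i this], of "Suc k"]
  show "DERIV (\<lambda>t. u (chart_inv c ((chart_map c y)(i := t))) ^ Suc k) (chart_map c y i) :>
    real (Suc k) * u y ^ k * partial_deriv i (\<lambda>p. u (chart_inv c p)) (chart_map c y)"
    by (rule DERIV_cong) (simp add: inv_chart[OF c y])
qed

lemma gp_power:
  assumes c: "c \<in> atlas M" and y: "y \<in> chart_dom c" and u: "C1M u"
  shows "gp c f (\<lambda>y. u y ^ Suc k) y = real (Suc k) * u y ^ k * gp c f u y"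
  unfolding gp_def sum_distrib_left
  by (intro sum.cong refl) (simp only: cderiv_power[OF c y u] lessThan_iff mult_ac)

lemma gp_zero: "gp c f (\<lambda>_. 0) y = 0"
  by (simp add: gp_def cderiv_def partial_deriv_const)

end

section \<open>Moments of a linear function on a closed minimal submanifold\<close>

locale minimal_immersion = closed_manifold m M
  for m :: nat and M :: "'a riemannian" +
  fixes n :: nat and x :: "'a \<Rightarrow> nat \<Rightarrow> real" and v :: "nat \<Rightarrow> real"
  assumes m_pos: "1 \<le> m" and minimal: "isometric_minimal_immersion m n M x" and v: "(\<Sum>a\<le>n. v a * v a) = 1"
begin

section \<open>The immersion in coordinates\<close>

definition X :: "'a chart \<Rightarrow> nat \<Rightarrow> (nat \<Rightarrow> real) \<Rightarrow> real" where
  "X c a p = x (chart_inv c p) a"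

definition Gm :: "'a chart \<Rightarrow> (nat \<Rightarrow> real) \<Rightarrow> nat \<Rightarrow> nat \<Rightarrow> real" where
  "Gm c = (\<lambda>q i j. \<Sum>a\<le>n. partial_deriv i (X c a) q * partial_deriv j (X c a) q)"

definition Hm :: "'a chart \<Rightarrow> (nat \<Rightarrow> real) \<Rightarrow> nat \<Rightarrow> nat \<Rightarrow> real" where
  "Hm c = (\<lambda>q. finv m (Gm c q))"

definition Sm :: "'a chart \<Rightarrow> (nat \<Rightarrow> real) \<Rightarrow> nat \<Rightarrow> nat \<Rightarrow> nat \<Rightarrow> real" where
  "Sm c = (\<lambda>q i j a. partial_deriv i (partial_deriv j (X c a)) q)"

lemma isometric: "isometric_immersion m n M x" and smap: "sphere_map m n M x"
  using minimal by (auto simp: isometric_minimal_immersion_def isometric_immersion_def immersion_def)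

lemma x_sphere: "y \<in> \<Omega> \<Longrightarrow> x y \<in> topspace (nsphere n)"
  using smap by (simp add: sphere_map_def)

lemma sum_squares_nsphere: "z \<in> topspace (nsphere n) \<Longrightarrow> (\<Sum>a\<le>n. z a * z a) = 1"
  by (simp add: nsphere power2_eq_square)

lemma X_smooth: "c \<in> atlas M \<Longrightarrow> a \<le> n \<Longrightarrow> smooth_on_coord m (chart_img c) (X c a)"
  using smap unfolding sphere_map_def smooth_function_def X_def[abs_def] by blast

lemma frame_eq: "c \<in> atlas M \<Longrightarrow> p \<in> chart_img c \<Longrightarrow> frame c x k (chart_inv c p) a = partial_deriv k (X c a) p"
  by (simp add: frame_def cderiv_def X_def[abs_def] chart_inv_chart)

lemma Gm_metric:
  assumes c: "c \<in> atlas M" and p: "p \<in> chart_img c" and ij: "i < m" "j < m"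
  shows "Gm c p i j = metric M c (chart_inv c p) i j"
proof -
  have "metric M c (chart_inv c p) i j = dotp n (frame c x i (chart_inv c p)) (frame c x j (chart_inv c p))"
    using isometric c inv_in_dom[OF p] ij unfolding isometric_immersion_def by (simp only:)
  then show ?thesis unfolding dotp_def frame_eq[OF c p] Gm_def by simp
qed

lemma Hm_metric:
  assumes c: "c \<in> atlas M" and p: "p \<in> chart_img c"
  shows "Hm c p i j = finv m (metric M c (chart_inv c p)) i j"
  unfolding Hm_def finv_def
  using fcof_cong[of m "Gm c p" "metric M c (chart_inv c p)"] fdet_cong[of m "Gm c p" "metric M c (chart_inv c p)"]
    Gm_metric[OF c p] by simp

text \<open>Unfolds the vanishing mean curvature into the trace identity demanded by the locale. The
  isometry property allows the Gram matrix of the coordinate vectors to replace the given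
  metric.\<close>

lemma minimal_chart: "c \<in> atlas M \<Longrightarrow> minimal_chart m n (chart_img c) (X c) (Gm c) (Hm c) (Sm c)"
proof
  assume c: "c \<in> atlas M"
  show "openin (coord_space m) (chart_img c)" by (rule img_open[OF c])
  show "C1 m (chart_img c) (X c a)" if "a \<le> n" for a by (rule smooth_C1[OF X_smooth[OF c that]])
  show "C1 m (chart_img c) (partial_deriv i (X c a))" if "a \<le> n" "i < m" for a i
    by (rule smooth_C1[OF smooth_partial_deriv[OF X_smooth[OF c that(1)] that(2)]])
  show "(\<Sum>a\<le>n. X c a q * X c a q) = 1" if "q \<in> chart_img c" for q
    unfolding X_def by (rule sum_squares_nsphere[OF x_sphere[OF subsetD[OF dom_sub[OF c] inv_in_dom[OF that]]]])
  show "Gm c = (\<lambda>q i j. \<Sum>a\<le>n. partial_deriv i (X c a) q * partial_deriv j (X c a) q)" by (rule Gm_def)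
  show "Hm c = (\<lambda>q. finv m (Gm c q))" by (rule Hm_def)
  show "Sm c = (\<lambda>q i j a. partial_deriv i (partial_deriv j (X c a)) q)" by (rule Sm_def)
  show "pos_def m (Gm c q)" if q: "q \<in> chart_img c" for q
    using metric_pos_def[OF c inv_in_dom[OF q]] unfolding pos_def_def by (simp add: Gm_metric[OF c q])
  fix q a assume q: "q \<in> chart_img c" and a: "a \<le> n"
  let ?y = "chart_inv c q"
  have cd: "sphere_cov_deriv n c x i j ?y = (\<lambda>b. Sm c q i j b - (\<Sum>b\<le>n. Sm c q i j b * X c b q) * X c b q)" for i j
    by (simp add: sphere_cov_deriv_def sphere_proj_def cderiv2_def dotp_def Sm_def X_def[abs_def] chart_inv_chart[OF q])
  have "mean_curvature m n M x c ?y a = 0"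
    using minimal c inv_in_dom[OF q] a unfolding isometric_minimal_immersion_def by (simp only:)
  \<comment> \<open>Here \<open>m_pos\<close> clears the factor 1 / m of the mean curvature.\<close>
  then have "(\<Sum>i<m. \<Sum>j<m. inverse_metric m M c ?y i j * second_fundamental_form m n M x c ?y i j a) = 0"
    using m_pos by (simp add: mean_curvature_def)
  also have "(\<Sum>i<m. \<Sum>j<m. inverse_metric m M c ?y i j * second_fundamental_form m n M x c ?y i j a) =
    (\<Sum>i<m. \<Sum>j<m. Hm c q i j * ((Sm c q i j a - (\<Sum>b\<le>n. Sm c q i j b * X c b q) * X c a q) -
        (\<Sum>k<m. \<Sum>l<m. Hm c q k l * (\<Sum>b\<le>n. (Sm c q i j b - (\<Sum>c'\<le>n. Sm c q i j c' * X c c' q) * X c b q) * partial_deriv k (X c b) q)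
           * partial_deriv l (X c a) q)))"
    unfolding second_fundamental_form_def cd tangential_part_def dotp_def frame_eq[OF c q]
    by (intro sum.cong refl arg_cong2[where f = "(*)"] arg_cong2[where f = "(-)"])
       (simp_all add: inverse_metric_eq_finv Hm_metric[OF c q])
  finally show "(\<Sum>i<m. \<Sum>j<m. Hm c q i j * ((Sm c q i j a - (\<Sum>b\<le>n. Sm c q i j b * X c b q) * X c a q) -
        (\<Sum>k<m. \<Sum>l<m. Hm c q k l * (\<Sum>b\<le>n. (Sm c q i j b - (\<Sum>c'\<le>n. Sm c q i j c' * X c c' q) * X c b q) * partial_deriv k (X c b) q)
           * partial_deriv l (X c a) q))) = 0" .
qed

definition f :: "'a \<Rightarrow> real" where
  "f y = (\<Sum>a\<le>n. v a * x y a)"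

lemma height_eq: "minimal_chart.height n (X c) v = (\<lambda>p. f (chart_inv c p))" if "c \<in> atlas M"
  by (rule ext) (simp add: minimal_chart.height_def[OF minimal_chart[OF that]] f_def X_def)

lemma f_C1M: "C1M f"
  unfolding C1M_def
proof
  fix c assume c: "c \<in> atlas M"
  show "C1 m (chart_img c) (\<lambda>p. f (chart_inv c p))"
    using minimal_chart.heightC1[OF minimal_chart[OF c], of v] unfolding height_eq[OF c] .
qed

lemma gradp_eq:
  assumes c: "c \<in> atlas M" and p: "p \<in> chart_img c"
  shows "minimal_chart.gradp m (Hm c) (\<lambda>p. u (chart_inv c p)) (\<lambda>p. w (chart_inv c p)) p = gp c u w (chart_inv c p)"
  unfolding minimal_chart.gradp_def[OF minimal_chart[OF c]] gp_def cderiv_def chart_inv_chart[OF p] Hm_metric[OF c p] ..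

lemma vol_density_eq:
  assumes c: "c \<in> atlas M" and p: "p \<in> chart_img c"
  shows "minimal_chart.vol_density m (Gm c) p = \<rho> c p"
  unfolding minimal_chart.vol_density_def[OF minimal_chart[OF c]] \<rho>_def
  using fdet_cong[of m "Gm c p" "metric M c (chart_inv c p)"] Gm_metric[OF c p] by simp

lemma gp_f_le:
  assumes c: "c \<in> atlas M" and y: "y \<in> chart_dom c"
  shows "gp c f f y \<le> 1 - f y * f y"
proof -
  have p: "chart_map c y \<in> chart_img c" using y by blast
  show ?thesis
    using minimal_chart.gradp_height_le[OF minimal_chart[OF c] p v]
    unfolding height_eq[OF c] gradp_eq[OF c p] inv_chart[OF c y] .
qed

text \<open>\<open>weak_laplace_equation\<close> transported to the manifold. E may be set to 0
  outside the chart because w vanishes there.\<close>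

lemma weak_laplace_in_chart:
  assumes c: "c \<in> atlas M" and w: "C1M w" and K: "kbox m a b \<subseteq> chart_img c"
    and supp: "\<And>y. y \<notin> chart_inv c ` kbox m a b \<Longrightarrow> w y = 0"
  defines "E \<equiv> (\<lambda>y. if y \<in> chart_dom c then gp c f w y - real m * f y * w y else 0)"
  shows "integrable vol E" "integral\<^sup>L vol E = 0"
proof -
  interpret mc: minimal_chart m n "chart_img c" "X c" "Gm c" "Hm c" "Sm c" by (rule minimal_chart[OF c])
  define W where "W p = w (chart_inv c p)" for p
  define e where "e p = mc.gradp (mc.height v) W p - real m * mc.height v p * W p" for p
  have WC1: "C1 m (chart_img c) W" unfolding W_def[abs_def] by (rule C1MD[OF w c])
  have Wsupp: "W p = 0" if "p \<in> chart_img c" "p \<notin> kbox m a b" for p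
    unfolding W_def
  proof (rule supp, rule)
    assume "chart_inv c p \<in> chart_inv c ` kbox m a b"
    then obtain q where q: "q \<in> kbox m a b" "chart_inv c p = chart_inv c q" by blast
    then have "chart_map c (chart_inv c p) = chart_map c (chart_inv c q)" by simp
    then have "p = q" using chart_inv_chart[OF that(1)] chart_inv_chart[OF subsetD[OF K q(1)]] by simp
    then show False using q(1) that(2) by simp
  qed
  have em: "e \<in> borel_measurable (restrict_space (lborel_coord m) (chart_img c))"
  proof (rule cont_on_coord_measurable[OF img_open[OF c]])
    show "cont_on_coord m (chart_img c) e"
      unfolding e_def[abs_def] mc.gradp_def[abs_def]
      by (intro continuous_map_diff continuous_map_sum continuous_map_real_mult C1D(1)[OF mc.hC1] C1D(1)[OF mc.dheightC1]
            C1D(3)[OF WC1] C1D(1)[OF mc.heightC1] C1D(1)[OF WC1] continuous_map_const[THEN iffD2]) auto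
  qed
  have eq: "(\<lambda>p. indicator (chart_img c) p * (\<rho> c p * e p)) =
     (\<lambda>p. indicator (chart_img c) p * (mc.vol_density p * (mc.gradp (mc.height v) W p - real m * mc.height v p * W p)))"
    by (rule ext) (auto simp: e_def vol_density_eq[OF c] indicator_def)
  have E: "E = (\<lambda>y. if y \<in> chart_dom c then e (chart_map c y) else 0)"
  proof
    fix y
    show "E y = (if y \<in> chart_dom c then e (chart_map c y) else 0)"
    proof (cases "y \<in> chart_dom c")
      case True
      then have p: "chart_map c y \<in> chart_img c" by blast
      have "e (chart_map c y) = gp c f w y - real m * f y * w y"
        unfolding e_def height_eq[OF c] W_def[abs_def] gradp_eq[OF c p] inv_chart[OF c True] ..
      then show ?thesis using True by (simp add: E_def)
    qed (simp add: E_def)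
  qed
  note wl = mc.weak_laplace_equation[OF WC1 K Wsupp, of v]
  show "integrable vol E" unfolding E integral_supported_in_chart(1)[OF c em] eq by (rule wl(1))
  show "integral\<^sup>L vol E = 0" unfolding E integral_supported_in_chart(2)[OF c em] eq by (rule wl(2))
qed

text \<open>A partition of unity applied to u at once: the bumps are divided by their sum, which is
  positive on the whole manifold, and multiplied by u.\<close>

lemma partition_of_function:
  assumes u: "C1M u"
  shows "\<exists>(F::'a set) ch w a b. finite F \<and> (\<forall>q\<in>F. ch q \<in> atlas M \<and> C1M (w q) \<and> kbox m (a q) (b q) \<subseteq> chart_img (ch q) \<and>
      (\<forall>y. y \<notin> chart_inv (ch q) ` kbox m (a q) (b q) \<longrightarrow> w q y = 0)) \<and> (\<forall>y\<in>\<Omega>. (\<Sum>q\<in>F. w q y) = u y)"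
proof -
  obtain F ch and r :: "'a \<Rightarrow> real" where F: "finite F" "F \<subseteq> \<Omega>" "\<Omega> = (\<Union>q\<in>F. piece q (ch q) (r q))"
    "\<forall>q\<in>F. ch q \<in> atlas M \<and> q \<in> chart_dom (ch q) \<and> 0 < r q \<and> cube q (ch q) (r q) \<subseteq> chart_img (ch q)"
    using finite_cover by (elim exE conjE)
  have Fq: "ch q \<in> atlas M" "0 < r q" "cube q (ch q) (r q) \<subseteq> chart_img (ch q)" if "q \<in> F" for q
    using bspec[OF F(4) that] by simp_all
  define \<beta> where "\<beta> q = bumpM q (ch q) (r q)" for q
  define \<Psi> where "\<Psi> y = (\<Sum>q\<in>F. \<beta> q y)" for y
  have \<beta>C1: "C1M (\<beta> q)" if "q \<in> F" for q unfolding \<beta>_def by (rule bumpM_C1M[OF Fq[OF that]])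
  have \<beta>0: "\<beta> q y \<ge> 0" for q y by (simp add: \<beta>_def bumpM_def bump_nonneg)
  have \<Psi>pos: "\<Psi> y > 0" if y: "y \<in> \<Omega>" for y
  proof -
    obtain q where q: "q \<in> F" "y \<in> piece q (ch q) (r q)" using y F(3) by auto
    have "\<beta> q y > 0" using q(2) bump_pos[OF Fq(2)[OF q(1)]] by (simp add: \<beta>_def bumpM_def piece_def)
    then show ?thesis unfolding \<Psi>_def using F(1) q(1) \<beta>0 by (intro sum_pos2[of F q]) auto
  qed
  define w where "w q y = \<beta> q y * (u y * inverse (\<Psi> y))" for q y
  have "C1M \<Psi>" unfolding \<Psi>_def[abs_def] by (rule C1M_sum[OF \<beta>C1])
  then have wC1: "C1M (w q)" if "q \<in> F" for q
    unfolding w_def[abs_def] using \<Psi>pos by (intro C1M_mult \<beta>C1 that u C1M_inverse) (auto simp: less_imp_neq[symmetric])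
  have wsum: "(\<Sum>q\<in>F. w q y) = u y" if "y \<in> \<Omega>" for y
  proof -
    have "(\<Sum>q\<in>F. w q y) = \<Psi> y * (u y * inverse (\<Psi> y))" by (simp add: w_def \<Psi>_def sum_distrib_right)
    then show ?thesis using \<Psi>pos[OF that] by simp
  qed
  have wsupp: "w q y = 0" if "q \<in> F" "y \<notin> chart_inv (ch q) ` cube q (ch q) (r q)" for q y
    using bumpM_zero_off_support[OF Fq(1,2)[OF that(1)] that(2)] by (simp add: w_def \<beta>_def)
  show ?thesis
    using F(1) Fq wC1 wsum wsupp unfolding cube_def
    by (intro exI[of _ F] exI[of _ ch] exI[of _ w] exI[of _ "\<lambda>q i. chart_map (ch q) q i - r q"]
          exI[of _ "\<lambda>q i. chart_map (ch q) q i + r q"]) simp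
qed

text \<open>Measurability has been transported only for functions supported in one chart, so u is
  split into such functions.\<close>

lemma C1M_measurable:
  assumes u: "C1M u"
  shows "u \<in> borel_measurable vol"
proof -
  obtain F ch w and a b :: "'a \<Rightarrow> nat \<Rightarrow> real" where F: "finite F" "\<forall>q\<in>F. ch q \<in> atlas M \<and> C1M (w q) \<and> kbox m (a q) (b q) \<subseteq> chart_img (ch q) \<and>
      (\<forall>y. y \<notin> chart_inv (ch q) ` kbox m (a q) (b q) \<longrightarrow> w q y = 0)" "\<forall>y\<in>\<Omega>. (\<Sum>q\<in>F. w q y) = u y"
    using partition_of_function[OF u] by (elim exE conjE)
  have "w q \<in> borel_measurable BM" if q: "q \<in> F" for q
  proof -
    have c: "ch q \<in> atlas M" and wC1: "C1M (w q)" and K: "kbox m (a q) (b q) \<subseteq> chart_img (ch q)"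
      and z: "\<And>y. y \<notin> chart_inv (ch q) ` kbox m (a q) (b q) \<Longrightarrow> w q y = 0" using bspec[OF F(2) q] by simp_all
    have "(\<lambda>p. w q (chart_inv (ch q) p)) \<in> borel_measurable (restrict_space (lborel_coord m) (chart_img (ch q)))"
      by (rule cont_on_coord_measurable[OF img_open[OF c] C1D(1)[OF C1MD[OF wC1 c]]])
    from supported_in_chart_measurable[OF c this]
    have "(\<lambda>y. if y \<in> chart_dom (ch q) then w q (chart_inv (ch q) (chart_map (ch q) y)) else 0) \<in> borel_measurable BM" .
    moreover have "(\<lambda>y. if y \<in> chart_dom (ch q) then w q (chart_inv (ch q) (chart_map (ch q) y)) else 0) = w q"
    proof
      fix y
      show "(if y \<in> chart_dom (ch q) then w q (chart_inv (ch q) (chart_map (ch q) y)) else 0) = w q y"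
      proof (cases "y \<in> chart_dom (ch q)")
        case True
        then show ?thesis by (simp add: inv_chart[OF c True])
      next
        case False
        have "y \<notin> chart_inv (ch q) ` kbox m (a q) (b q)"
        proof
          assume "y \<in> chart_inv (ch q) ` kbox m (a q) (b q)"
          then obtain p where "p \<in> kbox m (a q) (b q)" "y = chart_inv (ch q) p" by blast
          then show False using inv_in_dom[OF subsetD[OF K]] False by blast
        qed
        then show ?thesis using z False by simp
      qed
    qed
    ultimately show ?thesis by simp
  qed
  then have "(\<lambda>y. \<Sum>q\<in>F. w q y) \<in> borel_measurable BM" by (intro borel_measurable_sum) auto
  then have "u \<in> borel_measurable BM" by (rule measurable_cong[THEN iffD1, rotated]) (use F(3) in auto)
  then show ?thesis using measurable_cong_sets[OF sets_vol refl] by blast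
qed

text \<open>The identity is summed over the pieces of u. The integrand is given existentially
  because \<open>gp\<close> asks for a chart at each point, and every chart yields the same
  value.\<close>

theorem weak_laplace:
  assumes u: "C1M u"
  shows "\<exists>E. integrable vol E \<and> integral\<^sup>L vol E = 0 \<and>
    (\<forall>c\<in>atlas M. \<forall>y\<in>chart_dom c. E y = gp c f u y - real m * f y * u y)"
proof -
  obtain F ch w and a b :: "'a \<Rightarrow> nat \<Rightarrow> real" where F: "finite F" "\<forall>q\<in>F. ch q \<in> atlas M \<and> C1M (w q) \<and> kbox m (a q) (b q) \<subseteq> chart_img (ch q) \<and>
      (\<forall>y. y \<notin> chart_inv (ch q) ` kbox m (a q) (b q) \<longrightarrow> w q y = 0)" "\<forall>y\<in>\<Omega>. (\<Sum>q\<in>F. w q y) = u y"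
    using partition_of_function[OF u] by (elim exE conjE)
  have Fq: "ch q \<in> atlas M" "C1M (w q)" "kbox m (a q) (b q) \<subseteq> chart_img (ch q)"
    "\<And>y. y \<notin> chart_inv (ch q) ` kbox m (a q) (b q) \<Longrightarrow> w q y = 0" if "q \<in> F" for q
    using bspec[OF F(2) that] by simp_all
  define e where "e q = (\<lambda>y. if y \<in> chart_dom (ch q) then gp (ch q) f (w q) y - real m * f y * w q y else 0)" for q
  have ei: "integrable vol (e q)" "integral\<^sup>L vol (e q) = 0" if "q \<in> F" for q
    unfolding e_def using weak_laplace_in_chart[OF Fq[OF that]] by simp_all
  have e_eq: "e q y = gp c f (w q) y - real m * f y * w q y" if q: "q \<in> F" and c: "c \<in> atlas M" and y: "y \<in> chart_dom c" for q c y
  proof (cases "y \<in> chart_dom (ch q)")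
    case True
    then show ?thesis using gp_chart_independent[OF c Fq(1)[OF q] _ f_C1M Fq(2)[OF q], of y] y by (simp add: e_def)
  next
    case False
    \<comment> \<open>Outside the chart of the piece, a whole neighbourhood avoids its closed
      support, so the gradient term in c vanishes and matches the default value 0 of
      \<open>e q\<close>.\<close>
    let ?C = "chart_inv (ch q) ` kbox m (a q) (b q)"
    have "y \<notin> ?C"
    proof
      assume "y \<in> ?C"
      then obtain p where "p \<in> kbox m (a q) (b q)" "y = chart_inv (ch q) p" by blast
      then show False using inv_in_dom[OF subsetD[OF Fq(3)[OF q]]] False by blast
    qed
    moreover have "closedin T ?C"
    proof -
      have "compactin (subtopology (coord_space m) (chart_img (ch q))) (kbox m (a q) (b q))"
        using Fq(3)[OF q] compactin_kbox by (simp add: compactin_subtopology)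
      from image_compactin[OF this chart_inv_continuous[OF Fq(1)[OF q]]]
      show ?thesis by (rule compactin_imp_closedin[OF Hausdorff])
    qed
    ultimately have "gp c f (w q) y = gp c f (\<lambda>_. 0) y"
      using y Fq(4)[OF q] by (intro gp_local[OF c openin_diff[OF dom_open[OF c]]]) auto
    then show ?thesis using False Fq(4)[OF q \<open>y \<notin> ?C\<close>] by (simp add: e_def gp_zero)
  qed
  have "(\<Sum>q\<in>F. e q y) = gp c f u y - real m * f y * u y" if c: "c \<in> atlas M" and y: "y \<in> chart_dom c" for c y
  proof -
    have "(\<Sum>q\<in>F. e q y) = (\<Sum>q\<in>F. gp c f (w q) y) - real m * f y * (\<Sum>q\<in>F. w q y)"
      by (simp add: e_eq[OF _ c y] sum_subtractf sum_distrib_left)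
    also have "(\<Sum>q\<in>F. gp c f (w q) y) = gp c f (\<lambda>y. \<Sum>q\<in>F. w q y) y"
      by (rule gp_sum[OF c y Fq(2), symmetric])
    also have "\<dots> = gp c f u y"
      by (rule gp_local[OF c dom_open[OF c] y subset_refl]) (use F(3) dom_sub[OF c] in blast)
    also have "(\<Sum>q\<in>F. w q y) = u y" using F(3) dom_sub[OF c] y by blast
    finally show ?thesis .
  qed
  moreover have "integrable vol (\<lambda>y. \<Sum>q\<in>F. e q y)" using ei(1) by (intro Bochner_Integration.integrable_sum) auto
  moreover have "(\<integral>y. (\<Sum>q\<in>F. e q y) \<partial>vol) = 0"
    using ei by (subst Bochner_Integration.integral_sum) auto
  ultimately show ?thesis by (intro exI[of _ "\<lambda>y. \<Sum>q\<in>F. e q y"]) blast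
qed

section \<open>Moments of the linear function and concentration\<close>

lemma f_square_le: "y \<in> \<Omega> \<Longrightarrow> f y * f y \<le> 1"
proof -
  assume y: "y \<in> \<Omega>"
  have x1: "(\<Sum>a\<le>n. x y a * x y a) = 1" by (rule sum_squares_nsphere[OF x_sphere[OF y]])
  have "0 \<le> (\<Sum>a\<le>n. (v a - f y * x y a) * (v a - f y * x y a))" by (intro sum_nonneg) auto
  also have "\<dots> = (\<Sum>a\<le>n. v a * v a) - 2 * f y * (\<Sum>a\<le>n. v a * x y a) + f y * f y * (\<Sum>a\<le>n. x y a * x y a)"
    by (simp add: sum_distrib_left sum.distrib[symmetric] sum_subtractf[symmetric] algebra_simps)
  also have "\<dots> = 1 - f y * f y" unfolding v x1 f_def[symmetric] by simp
  finally show ?thesis by simp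
qed

definition moment :: "nat \<Rightarrow> real" where
  "moment k = (\<integral>y. (f y)\<^sup>2 ^ k \<partial>vol)"

lemma integrable_moment: "integrable vol (\<lambda>y. (f y)\<^sup>2 ^ k)"
proof (rule finite_measure.integrable_const_bound[OF finite_measure_vol, where B = 1])
  show "AE y in vol. norm ((f y)\<^sup>2 ^ k) \<le> 1"
    using f_square_le by (intro AE_I2) (auto simp: power2_eq_square intro!: power_le_one)
  show "(\<lambda>y. (f y)\<^sup>2 ^ k) \<in> borel_measurable vol" using C1M_measurable[OF f_C1M] by simp
qed

lemma moment_step: "(real m + 2 * real k + 1) * moment (Suc k) \<le> (2 * real k + 1) * moment k"
proof -
  obtain E where E: "integrable vol E" "integral\<^sup>L vol E = 0"
    "\<forall>c\<in>atlas M. \<forall>y\<in>chart_dom c. E y = gp c f (\<lambda>y. f y ^ Suc (2 * k)) y - real m * f y * f y ^ Suc (2 * k)"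
    using weak_laplace[OF C1M_power[OF f_C1M, of "Suc (2 * k)"]] by (elim exE conjE)
  have le: "E y \<le> (2 * real k + 1) * (f y)\<^sup>2 ^ k - (real m + 2 * real k + 1) * (f y)\<^sup>2 ^ Suc k" if y: "y \<in> space vol" for y
  proof -
    have "y \<in> (\<Union>c\<in>atlas M. chart_dom c)" using y atlas unfolding is_smooth_atlas_def by simp
    then obtain c where c: "c \<in> atlas M" "y \<in> chart_dom c" by blast
    have "E y = real (Suc (2 * k)) * f y ^ (2 * k) * gp c f f y - real m * f y * f y ^ Suc (2 * k)"
      using bspec[OF bspec[OF E(3) c(1)] c(2)] unfolding gp_power[OF c f_C1M] .
    \<comment> \<open>The gradient bound is multiplied by an even power of f, which is nonnegative;
      this is why the test functions are odd powers.\<close>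
    also have "\<dots> \<le> real (Suc (2 * k)) * f y ^ (2 * k) * (1 - f y * f y) - real m * f y * f y ^ Suc (2 * k)"
      by (intro diff_right_mono mult_left_mono gp_f_le c) (simp add: zero_le_even_power)
    also have "\<dots> = (2 * real k + 1) * (f y)\<^sup>2 ^ k - (real m + 2 * real k + 1) * (f y)\<^sup>2 ^ Suc k"
    proof -
      have "(f y)\<^sup>2 ^ k = f y ^ (2 * k)" by (rule power_mult[symmetric])
      then show ?thesis unfolding power_Suc by (simp add: power2_eq_square algebra_simps del: power_mult_distrib)
    qed
    finally show ?thesis .
  qed
  have "0 \<le> (\<integral>y. (2 * real k + 1) * (f y)\<^sup>2 ^ k - (real m + 2 * real k + 1) * (f y)\<^sup>2 ^ Suc k \<partial>vol)"
    unfolding E(2)[symmetric]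
    by (rule integral_mono[OF E(1) _ le]) (intro Bochner_Integration.integrable_diff integrable_mult_right integrable_moment)
  also have "\<dots> = (2 * real k + 1) * moment k - (real m + 2 * real k + 1) * moment (Suc k)"
    unfolding moment_def
    by (subst Bochner_Integration.integral_diff) (auto intro!: integrable_mult_right integrable_moment simp del: power_Suc)
  finally show ?thesis by simp
qed

abbreviation V :: real where "V \<equiv> measure vol \<Omega>"

lemma moment_0: "moment 0 = V"
  unfolding moment_def by simp

lemma moment_nonneg: "moment k \<ge> 0"
  unfolding moment_def by (rule Bochner_Integration.integral_nonneg) simp

text \<open>Iterates \<open>moment_step\<close> after weakening the factor m + 2k + 1 to m + 1. The
  left factor then becomes a pure power, which fits into an exponential series.\<close>

lemma moment_le: "(real m + 1) ^ k * moment k \<le> (\<Prod>i<k. 2 * real i + 1) * V"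
proof (induction k)
  case (Suc k)
  have "(real m + 1) ^ Suc k * moment (Suc k) = (real m + 1) ^ k * ((real m + 1) * moment (Suc k))" by simp
  also have "\<dots> \<le> (real m + 1) ^ k * ((real m + 2 * real k + 1) * moment (Suc k))"
    by (intro mult_left_mono mult_right_mono moment_nonneg) auto
  also have "\<dots> \<le> (real m + 1) ^ k * ((2 * real k + 1) * moment k)"
    by (intro mult_left_mono moment_step) auto
  also have "\<dots> = (2 * real k + 1) * ((real m + 1) ^ k * moment k)" by simp
  also have "\<dots> \<le> (2 * real k + 1) * ((\<Prod>i<k. 2 * real i + 1) * V)"
    by (intro mult_left_mono Suc.IH) auto
  finally show ?case by (simp add: mult.commute mult.left_commute)
qed (simp add: moment_0)

text \<open>Newton's binomial series for (1 - 2\<delta>)^(-1/2), convergent since 2\<delta> < 1.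
  Each factor -1/2 - i times -2\<delta> equals \<delta>(2i + 1), which turns the binomial
  coefficients into odd double factorials over k!.\<close>

lemma binomial_series_half:
  assumes "0 \<le> \<delta>" "\<delta> < 1 / 2"
  shows "(\<lambda>k. \<delta> ^ k * (\<Prod>i<k. 2 * real i + 1) / fact k) sums sqrt (1 / (1 - 2 * \<delta>))"
proof -
  have "(\<lambda>k. ((- 1 / 2) gchoose k) * (- 2 * \<delta>) ^ k) sums (1 + - 2 * \<delta>) powr (- 1 / 2)"
    by (rule gen_binomial_real) (use assms in auto)
  moreover have "((- 1 / 2) gchoose k) * (- 2 * \<delta>) ^ k = \<delta> ^ k * (\<Prod>i<k. 2 * real i + 1) / fact k" for k
  proof -
    have "(\<Prod>i<k. (- 1 / 2 - real i)) * (- 2 * \<delta>) ^ k = (\<Prod>i<k. (- 1 / 2 - real i) * (- 2 * \<delta>))"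
      by (simp only: prod.distrib[of "\<lambda>i. - 1 / 2 - real i" "\<lambda>_. - 2 * \<delta>"] prod_constant card_lessThan)
    also have "\<dots> = (\<Prod>i<k. \<delta> * (2 * real i + 1))" by (intro prod.cong refl) (simp add: field_simps)
    also have "\<dots> = \<delta> ^ k * (\<Prod>i<k. 2 * real i + 1)" by (simp add: prod.distrib)
    finally show ?thesis by (simp add: gbinomial_prod_rev lessThan_atLeast0)
  qed
  moreover have "(1 + - 2 * \<delta>) powr (- 1 / 2) = sqrt (1 / (1 - 2 * \<delta>))"
    using assms powr_minus_divide[of "1 - 2 * \<delta>" "1/2"] powr_half_sqrt[of "1 - 2 * \<delta>"] by (simp add: real_sqrt_divide)
  ultimately show ?thesis by simp
qed

text \<open>An exponential Markov bound carried out termwise: every moment bounds the measure of the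
  tail set, and the weights t^k / k! assemble exp(t s^2) on one side and the binomial series on the
  other.\<close>

lemma concentration:
  assumes \<delta>: "0 \<le> \<delta>" "\<delta> < 1 / 2"
  shows "measure vol {y \<in> \<Omega>. s\<^sup>2 \<le> (f y)\<^sup>2} \<le> V * (sqrt (1 / (1 - 2 * \<delta>)) * exp (- \<delta> * s\<^sup>2 * (real m + 1)))"
proof -
  let ?A = "{y \<in> \<Omega>. s\<^sup>2 \<le> (f y)\<^sup>2}"
  \<comment> \<open>With this parameter the powers of m + 1 are exactly those that
    \<open>moment_le\<close> absorbs.\<close>
  define t where "t = \<delta> * (real m + 1)"
  have t: "t \<ge> 0" using \<delta> by (simp add: t_def)
  have fm: "f \<in> borel_measurable vol" by (rule C1M_measurable[OF f_C1M])
  have A: "?A \<in> sets vol"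
  proof -
    have "{y \<in> space vol. s\<^sup>2 \<le> (f y)\<^sup>2} \<in> sets vol" using fm by measurable
    then show ?thesis by simp
  qed
  have markov: "(s\<^sup>2) ^ k * measure vol ?A \<le> moment k" for k
  proof -
    have fin: "emeasure vol ?A < \<infinity>"
      using finite_measure.emeasure_finite[OF finite_measure_vol, of ?A] by (simp add: less_top[symmetric])
    have "(s\<^sup>2) ^ k * measure vol ?A = (\<integral>y. (s\<^sup>2) ^ k * indicator ?A y \<partial>vol)"
      using A by (simp add: Int_absorb2 Collect_conj_eq)
    also have "\<dots> \<le> moment k"
      unfolding moment_def
    proof (rule integral_mono)
      show "integrable vol (\<lambda>y. (s\<^sup>2) ^ k * indicator ?A y)"
        using A fin by (intro integrable_mult_right integrable_real_indicator)
      show "(s\<^sup>2) ^ k * indicator ?A y \<le> (f y)\<^sup>2 ^ k" for y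
        by (auto simp: indicator_def intro!: power_mono)
    qed (rule integrable_moment)
    finally show ?thesis .
  qed
  have V0: "V \<ge> 0" by simp
  \<comment> \<open>The bound is the full binomial series and thus independent of N, so the
    exponential series can be completed afterwards by a limit on the left alone.\<close>
  have partial: "measure vol ?A * (\<Sum>k<N. (t * s\<^sup>2) ^ k / fact k) \<le> V * sqrt (1 / (1 - 2 * \<delta>))" for N
  proof -
    have "measure vol ?A * (\<Sum>k<N. (t * s\<^sup>2) ^ k / fact k) = (\<Sum>k<N. t ^ k / fact k * ((s\<^sup>2) ^ k * measure vol ?A))"
      by (subst sum_distrib_left) (simp add: power_mult_distrib mult_ac)
    also have "\<dots> \<le> (\<Sum>k<N. t ^ k / fact k * moment k)"
      using t by (intro sum_mono mult_left_mono markov) auto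
    also have "\<dots> = (\<Sum>k<N. \<delta> ^ k / fact k * ((real m + 1) ^ k * moment k))"
      by (simp add: t_def power_mult_distrib mult_ac)
    also have "\<dots> \<le> (\<Sum>k<N. \<delta> ^ k / fact k * ((\<Prod>i<k. 2 * real i + 1) * V))"
      using \<delta> by (intro sum_mono mult_left_mono moment_le) auto
    also have "\<dots> = V * (\<Sum>k<N. \<delta> ^ k * (\<Prod>i<k. 2 * real i + 1) / fact k)"
      by (simp add: sum_distrib_left mult_ac)
    also have "(\<Sum>k<N. \<delta> ^ k * (\<Prod>i<k. 2 * real i + 1) / fact k) \<le> sqrt (1 / (1 - 2 * \<delta>))"
      unfolding sums_unique[OF binomial_series_half[OF \<delta>]]
      using \<delta> by (intro sum_le_suminf sums_summable[OF binomial_series_half[OF \<delta>]]) (auto intro!: prod_nonneg divide_nonneg_nonneg mult_nonneg_nonneg)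
    finally show ?thesis using V0 by (simp add: mult_left_mono)
  qed
  have "(\<lambda>N. measure vol ?A * (\<Sum>k<N. (t * s\<^sup>2) ^ k / fact k)) \<longlonglongrightarrow> measure vol ?A * exp (t * s\<^sup>2)"
    using exp_converges[of "t * s\<^sup>2"] unfolding sums_def
    by (intro tendsto_mult tendsto_const) (simp add: divide_inverse mult.commute)
  then have "measure vol ?A * exp (t * s\<^sup>2) \<le> V * sqrt (1 / (1 - 2 * \<delta>))"
    by (rule LIMSEQ_le_const2) (use partial in blast)
  then have "measure vol ?A * exp (t * s\<^sup>2) * exp (- (t * s\<^sup>2)) \<le> V * sqrt (1 / (1 - 2 * \<delta>)) * exp (- (t * s\<^sup>2))"
    by (rule mult_right_mono) simp
  moreover have "measure vol ?A * exp (t * s\<^sup>2) * exp (- (t * s\<^sup>2)) = measure vol ?A"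
    unfolding mult.assoc exp_minus_inverse by simp
  moreover have "- (t * s\<^sup>2) = - \<delta> * s\<^sup>2 * (real m + 1)" by (simp add: t_def)
  ultimately show ?thesis by (simp only: mult.assoc)
qed

end

section \<open>The volume of the strip\<close>

lemma arccos_in_strip_iff:
  assumes \<epsilon>: "0 < \<epsilon>" "\<epsilon> < pi / 2" and g: "\<bar>g\<bar> \<le> 1"
  shows "pi / 2 - \<epsilon> < arccos g \<and> arccos g < pi / 2 + \<epsilon> \<longleftrightarrow> \<bar>g\<bar> < sin \<epsilon>"
proof -
  have a: "0 \<le> arccos g" "arccos g \<le> pi" "cos (arccos g) = g"
    using g by (auto simp: arccos_lbound arccos_ubound abs_le_iff)
  have "pi / 2 - \<epsilon> < arccos g \<longleftrightarrow> cos (arccos g) < cos (pi / 2 - \<epsilon>)"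
    by (rule cos_mono_less_eq[symmetric]) (use a \<epsilon> in auto)
  moreover have "arccos g < pi / 2 + \<epsilon> \<longleftrightarrow> cos (pi / 2 + \<epsilon>) < cos (arccos g)"
    by (rule cos_mono_less_eq[symmetric]) (use a \<epsilon> in auto)
  ultimately show ?thesis unfolding a(3) by (auto simp: cos_diff cos_add)
qed

text \<open>The complement of the strip is where the linear function satisfies f^2 >= (sin
  \<epsilon>)^2, so the tail estimate applies with s = sin \<epsilon>. Positivity and finiteness of
  the volume permit the division.\<close>

theorem strip_volume_ratio:
  fixes M :: "'a riemannian"
  assumes m: "1 \<le> m" and M: "closed_riemannian_manifold m M" and x: "isometric_minimal_immersion m n M x"
    and p: "p \<in> topspace (nsphere n)" and \<epsilon>: "0 < \<epsilon>" "\<epsilon> < pi / 2" and \<delta>: "0 \<le> \<delta>" "\<delta> < 1 / 2"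
  shows "vol_ratio m M x (strip n p \<epsilon>) \<le> 1"
    and "vol_ratio m M x (strip n p \<epsilon>) \<ge> 1 - sqrt (1 / (1 - 2 * \<delta>)) * exp (- \<delta> * (sin \<epsilon>)\<^sup>2 * (real m + 1))"
proof -
  have p1: "(\<Sum>a\<le>n. p a * p a) = 1" using p by (simp add: nsphere power2_eq_square)
  \<comment> \<open>The pole p takes the role of the unit vector v, which makes f the cosine of the
    distance to p.\<close>
  interpret minimal_immersion m M n x p by unfold_locales (use m M x p1 in auto)
  let ?A = "{y \<in> \<Omega>. (sin \<epsilon>)\<^sup>2 \<le> (f y)\<^sup>2}"
  have s0: "sin \<epsilon> > 0" using \<epsilon> by (intro sin_gt_zero) auto
  have pre: "x -` strip n p \<epsilon> \<inter> \<Omega> = \<Omega> - ?A"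
  proof -
    have "x y \<in> strip n p \<epsilon> \<longleftrightarrow> \<not> (sin \<epsilon>)\<^sup>2 \<le> (f y)\<^sup>2" if y: "y \<in> \<Omega>" for y
    proof -
      have "\<bar>f y\<bar> \<le> 1" using f_square_le[OF y] by (simp add: abs_square_le_1 power2_eq_square[symmetric])
      moreover have "sphere_dist n p (x y) = arccos (f y)" by (simp add: sphere_dist_def dotp_def f_def)
      moreover have "\<bar>f y\<bar> < sin \<epsilon> \<longleftrightarrow> \<not> (sin \<epsilon>)\<^sup>2 \<le> (f y)\<^sup>2"
        using s0 by (simp add: abs_le_square_iff[symmetric] not_le)
      ultimately show ?thesis
        using x_sphere[OF y] arccos_in_strip_iff[OF \<epsilon>, of "f y"] by (simp add: strip_def)
    qed
    then show ?thesis by blast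
  qed
  have A: "?A \<in> sets vol"
  proof -
    have "{y \<in> space vol. (sin \<epsilon>)\<^sup>2 \<le> (f y)\<^sup>2} \<in> sets vol" using C1M_measurable[OF f_C1M] by measurable
    then show ?thesis by simp
  qed
  have V: "V > 0"
    using vol_pos vol_finite by (simp add: measure_def enn2real_positive_iff)
  have "measure vol (\<Omega> - ?A) = V - measure vol ?A"
    using finite_measure.finite_measure_compl[OF finite_measure_vol A] by simp
  then have ratio: "vol_ratio m M x (strip n p \<epsilon>) = 1 - measure vol ?A / V"
    unfolding vol_ratio_def pre using V by (simp add: diff_divide_distrib)
  show "vol_ratio m M x (strip n p \<epsilon>) \<le> 1" unfolding ratio using V by simp
  have "measure vol ?A / V \<le> sqrt (1 / (1 - 2 * \<delta>)) * exp (- \<delta> * (sin \<epsilon>)\<^sup>2 * (real m + 1))"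
    using concentration[OF \<delta>, of "sin \<epsilon>"] V by (simp add: pos_divide_le_eq mult.commute)
  then show "vol_ratio m M x (strip n p \<epsilon>) \<ge> 1 - sqrt (1 / (1 - 2 * \<delta>)) * exp (- \<delta> * (sin \<epsilon>)\<^sup>2 * (real m + 1))"
    unfolding ratio by simp
qed

lemma strip_volume_ratio_tendsto:
  fixes M :: "nat \<Rightarrow> 'a riemannian"
  assumes \<epsilon>: "0 < \<epsilon>" "\<epsilon> < pi / 2"
    and fam: "\<And>m. 1 \<le> m \<Longrightarrow> closed_riemannian_manifold m (M m) \<and>
      isometric_minimal_immersion m (n m) (M m) (x m) \<and> p m \<in> topspace (nsphere (n m))"
  shows "(\<lambda>m. vol_ratio m (M m) (x m) (strip (n m) (p m) \<epsilon>)) \<longlonglongrightarrow> 1"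
proof (rule tendsto_sandwich)
  \<comment> \<open>The decay rate for \<delta> = 1/4, for which the constant in front is sqrt 2;
    any fixed \<delta> strictly between 0 and 1/2 would give the limit.\<close>
  define a where "a = (sin \<epsilon>)\<^sup>2 / 4"
  have "sin \<epsilon> > 0" using \<epsilon> by (intro sin_gt_zero) auto
  then have a: "a > 0" by (simp add: a_def)
  show "\<forall>\<^sub>F m in sequentially. 1 - sqrt 2 * exp (- (a * (real m + 1))) \<le> vol_ratio m (M m) (x m) (strip (n m) (p m) \<epsilon>)"
    using eventually_ge_at_top[of 1]
  proof eventually_elim
    case (elim m)
    have "1 - sqrt (1 / (1 - 2 * (1/4))) * exp (- (1/4) * (sin \<epsilon>)\<^sup>2 * (real m + 1)) \<le> vol_ratio m (M m) (x m) (strip (n m) (p m) \<epsilon>)"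
      by (rule strip_volume_ratio(2)) (use elim fam[OF elim] \<epsilon> in auto)
    then show ?case by (simp add: a_def)
  qed
  show "\<forall>\<^sub>F m in sequentially. vol_ratio m (M m) (x m) (strip (n m) (p m) \<epsilon>) \<le> 1"
    using eventually_ge_at_top[of 1]
  proof eventually_elim
    case (elim m)
    show ?case by (rule strip_volume_ratio(1)[where \<delta> = 0]) (use elim fam[OF elim] \<epsilon> in auto)
  qed
  show "(\<lambda>m. 1 - sqrt 2 * exp (- (a * (real m + 1)))) \<longlonglongrightarrow> 1"
  proof -
    have "(\<lambda>m. exp (- a) ^ Suc m) \<longlonglongrightarrow> 0"
      using LIMSEQ_Suc[OF LIMSEQ_power_zero[of "exp (- a)"]] a by simp
    moreover have "exp (- a) ^ Suc m = exp (- (a * (real m + 1)))" for m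
      by (simp only: exp_of_nat_mult[symmetric]) (simp add: algebra_simps)
    ultimately have "(\<lambda>m. exp (- (a * (real m + 1)))) \<longlonglongrightarrow> 0" by (simp only:)
    then have "(\<lambda>m. 1 - sqrt 2 * exp (- (a * (real m + 1)))) \<longlonglongrightarrow> 1 - sqrt 2 * 0"
      by (intro tendsto_intros)
    then show ?thesis by simp
  qed
qed simp

theorem theorem1p4:
  shows "(\<forall>(m::nat) (n::nat) (M::'a riemannian) (x::'a \<Rightarrow> nat \<Rightarrow> real) (p::nat \<Rightarrow> real) (\<epsilon>::real) (\<delta>::real).
            1 \<le> m \<and> m \<le> n \<and> closed_riemannian_manifold m M \<and>
            isometric_minimal_immersion m n M x \<and> p \<in> topspace (nsphere n) \<and>
            0 < \<epsilon> \<and> \<epsilon> < pi / 2 \<and> 0 \<le> \<delta> \<and> \<delta> < 1 / 2 \<longrightarrow>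
            1 \<ge> vol_ratio m M x (strip n p \<epsilon>) \<and>
            vol_ratio m M x (strip n p \<epsilon>) \<ge>
              1 - sqrt (1 / (1 - 2 * \<delta>)) * exp (- \<delta> * (sin \<epsilon>)\<^sup>2 * (real m + 1)) \<and>
            sin \<epsilon> \<in> {0<..<1}) \<and>
         (\<forall>(\<epsilon>::real) (n::nat \<Rightarrow> nat) (M::nat \<Rightarrow> 'a riemannian) (x::nat \<Rightarrow> 'a \<Rightarrow> nat \<Rightarrow> real)
            (p::nat \<Rightarrow> nat \<Rightarrow> real).
            0 < \<epsilon> \<and> \<epsilon> < pi / 2 \<and>
            (\<forall>m\<ge>1. m \<le> n m \<and> closed_riemannian_manifold m (M m) \<and>
               isometric_minimal_immersion m (n m) (M m) (x m) \<and> p m \<in> topspace (nsphere (n m))) \<longrightarrow>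
            (\<lambda>m. vol_ratio m (M m) (x m) (strip (n m) (p m) \<epsilon>)) \<longlonglongrightarrow> 1)"
proof (intro conjI allI impI; elim conjE)
  fix m n :: nat and M :: "'a riemannian" and x :: "'a \<Rightarrow> nat \<Rightarrow> real" and p :: "nat \<Rightarrow> real" and \<epsilon> \<delta> :: real
  assume h: "1 \<le> m" "closed_riemannian_manifold m M" "isometric_minimal_immersion m n M x"
    "p \<in> topspace (nsphere n)" "0 < \<epsilon>" "\<epsilon> < pi / 2" "0 \<le> \<delta>" "\<delta> < 1 / 2"
  show "vol_ratio m M x (strip n p \<epsilon>) \<le> 1" by (rule strip_volume_ratio(1)[OF h])
  show "1 - sqrt (1 / (1 - 2 * \<delta>)) * exp (- \<delta> * (sin \<epsilon>)\<^sup>2 * (real m + 1)) \<le> vol_ratio m M x (strip n p \<epsilon>)"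
    by (rule strip_volume_ratio(2)[OF h])
  have "sin \<epsilon> > 0" using h by (intro sin_gt_zero) auto
  moreover have "sin \<epsilon> < sin (pi / 2)" using h by (intro sin_monotone_2pi) auto
  ultimately show "sin \<epsilon> \<in> {0<..<1}" by simp
next
  fix \<epsilon> :: real and n :: "nat \<Rightarrow> nat" and M :: "nat \<Rightarrow> 'a riemannian" and x :: "nat \<Rightarrow> 'a \<Rightarrow> nat \<Rightarrow> real"
    and p :: "nat \<Rightarrow> nat \<Rightarrow> real"
  assume "0 < \<epsilon>" "\<epsilon> < pi / 2" "\<forall>m\<ge>1. m \<le> n m \<and> closed_riemannian_manifold m (M m) \<and>
    isometric_minimal_immersion m (n m) (M m) (x m) \<and> p m \<in> topspace (nsphere (n m))"
  then show "(\<lambda>m. vol_ratio m (M m) (x m) (strip (n m) (p m) \<epsilon>)) \<longlonglongrightarrow> 1"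
    by (intro strip_volume_ratio_tendsto) auto
qed

end
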